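(* Let $N\ge 3$, $\frac{2N}{N+2}<p<\frac N2$ with $p>1$, $p^\ast=\frac{Np}{N-p}$, let $\alpha,\beta>1$ with $\alpha+\beta=p^\ast$ and $\alpha,\beta<p$, and let $\mu_1,\mu_2>0$. For $\gamma>0$ let $I$, $\mathcal{N}$ and $A=\inf_{(u,v)\in\mathcal{N}}I(u,v)$ (all depending on $\gamma$), and $U_{\varepsilon,y}$, be as defined in the context. There exists $$\gamma_1\in\Big(0,\ \frac{Np^2}{(N-p)^2}\max\Big\{\frac{\mu_1}{\alpha}\Big(\frac{p-\beta}{p-\alpha}\Big)^{\frac{p-\beta}{p}},\ \frac{\mu_2}{\beta}\Big(\frac{p-\alpha}{p-\beta}\Big)^{\frac{p-\alpha}{p}}\Big\}\Big]$$ such that for any $\gamma\in(0,\gamma_1)$ there exists a solution $(k(\gamma),l(\gamma))$ of $$\mu_1k^{\frac{p^\ast-p}{p}}+\frac{\alpha\gamma}{p^\ast}k^{\frac{\alpha-p}{p}}l^{\frac{\beta}{p}}=1,\qquad \mu_2l^{\frac{p^\ast-p}{p}}+\frac{\beta\gamma}{p^\ast}k^{\frac{\alpha}{p}}l^{\frac{\beta-p}{p}}=1,\qquad k>0,\ l>0,$$ satisfying, for $\varepsilon>0$ and $y\in\mathbb{R}^N$, $$I\big(\sqrt[p]{k(\gamma)}\,U_{\varepsilon,y},\sqrt[p]{l(\gamma)}\,U_{\varepsilon,y}\big)>A,$$ and $\big(\sqrt[p]{k(\gamma)}\,U_{\varepsilon,y},\sqrt[p]{l(\gamma)}\,U_{\varepsilon,y}\big)$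 is a positive solution of the system $$\begin{cases}-\Delta_pu=\mu_1|u|^{p^\ast-2}u+\frac{\alpha\gamma}{p^\ast}|u|^{\alpha-2}u|v|^\beta,& x\in\mathbb{R}^N,\\ -\Delta_pv=\mu_2|v|^{p^\ast-2}v+\frac{\beta\gamma}{p^\ast}|u|^\alpha|v|^{\beta-2}v,& x\in\mathbb{R}^N,\\ u,v\in D^{1,p}(\mathbb{R}^N)\end{cases}$$ (hence a second positive solution, different from any positive solution at which $I$ takes the value $A$).
   Context: $\Delta_pu=\mathrm{div}(|\nabla u|^{p-2}\nabla u)$. $D^{1,p}(\mathbb{R}^N)=\{u\in L^{p^\ast}(\mathbb{R}^N):|\nabla u|\in L^p(\mathbb{R}^N)\}$ with norm $\|u\|_{D^{1,p}}=\big(\int_{\mathbb{R}^N}|\nabla u|^p\,dx\big)^{1/p}$, and $D=D^{1,p}(\mathbb{R}^N)\times D^{1,p}(\mathbb{R}^N)$. Solutions are understood in the weak sense (critical points of $I$ on $D$); a solution $(u,v)$ is positive if $u>0$ and $v>0$. For $\varepsilon>0$, $y\in\mathbb{R}^N$, $$U_{\varepsilon,y}(x)=\Big[N\Big(\frac{N-p}{p-1}\Big)^{p-1}\Big]^{\frac{N-p}{p^2}}\Bigg(\frac{\varepsilon^{\frac1{p-1}}}{\varepsilon^{\frac p{p-1}}+|x-y|^{\frac p{p-1}}}\Bigg)^{\frac{N-p}{p}}.$$ For $(u,v)\in D$, $$I(u,v)=\frac1p\int_{\mathbb{R}^N}\big(|\nabla u|^p+|\nabla v|^p\big)\,dx-\frac{1}{p^\ast}\int_{\mathbb{R}^N}\big(\mu_1|u|^{p^\ast}+\mu_2|v|^{p^\ast}+\gamma|u|^\alpha|v|^\beta\big)\,dx.$$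 $\mathcal{N}$ is the set of $(u,v)\in D$ with $u\neq0$, $v\neq 0$ such that $$\int_{\mathbb{R}^N}|\nabla u|^p=\int_{\mathbb{R}^N}\Big(\mu_1|u|^{p^\ast}+\frac{\alpha\gamma}{p^\ast}|u|^\alpha|v|^\beta\Big),\qquad \int_{\mathbb{R}^N}|\nabla v|^p=\int_{\mathbb{R}^N}\Big(\mu_2|v|^{p^\ast}+\frac{\beta\gamma}{p^\ast}|u|^\alpha|v|^\beta\Big).$$ *)

theory Defs
  imports "HOL-Analysis.Analysis"
begin

text \<open>
  The ambient space is \<open>real ^ 'n\<close>, so \<open>N = CARD('n)\<close>. Elements of \<open>L\<^sup>q\<close> are represented by
  functions; everything below is invariant under changes on Lebesgue null sets, and
  \<open>u = 0\<close>, \<open>u > 0\<close> and equality of functions are understood almost everywhere.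
\<close>

definition locally_integrable :: "(real ^ 'n \<Rightarrow> 'b::euclidean_space) \<Rightarrow> bool" where
  "locally_integrable f \<longleftrightarrow> (\<forall>K. compact K \<longrightarrow> set_integrable lebesgue K f)"

definition in_Lp :: "real \<Rightarrow> (real ^ 'n \<Rightarrow> real) \<Rightarrow> bool" where
  "in_Lp q f \<longleftrightarrow> f \<in> borel_measurable lebesgue \<and> integrable lebesgue (\<lambda>x. \<bar>f x\<bar> powr q)"

definition C1c_with_gradient :: "(real ^ 'n \<Rightarrow> real) \<Rightarrow> (real ^ 'n \<Rightarrow> real ^ 'n) \<Rightarrow> bool" where
  "C1c_with_gradient \<phi> d\<phi> \<longleftrightarrow>
     (\<forall>x. GDERIV \<phi> x :> d\<phi> x) \<and> continuous_on UNIV d\<phi> \<and> compact (closure {x. \<phi> x \<noteq> 0})"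

text \<open>
  Weak gradient, tested against \<open>C\<^sub>c\<^sup>1\<close> functions as in Evans--Gariepy; by mollification this is the
  same notion as with \<open>C\<^sub>c\<^sup>\<infinity>\<close> test functions. The integrals are vector valued, so the identity
  comprises the integration by parts formulas for all the partial derivatives.
\<close>

definition has_weak_gradient :: "(real ^ 'n \<Rightarrow> real) \<Rightarrow> (real ^ 'n \<Rightarrow> real ^ 'n) \<Rightarrow> bool" where
  "has_weak_gradient u g \<longleftrightarrow>
     locally_integrable u \<and> locally_integrable g \<and>
     (\<forall>\<phi> d\<phi>. C1c_with_gradient \<phi> d\<phi> \<longrightarrow>
        (LINT x|lebesgue. u x *\<^sub>R d\<phi> x) = - (LINT x|lebesgue. \<phi> x *\<^sub>R g x))"

text \<open>A choice of representative: weak gradients are unique almost everywhere.\<close>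

definition wgrad :: "(real ^ 'n \<Rightarrow> real) \<Rightarrow> real ^ 'n \<Rightarrow> real ^ 'n" where
  "wgrad u = (SOME g. has_weak_gradient u g)"

definition crit_exp :: "real \<Rightarrow> real \<Rightarrow> real" where
  "crit_exp N p = N * p / (N - p)"

definition D1p :: "real \<Rightarrow> (real ^ 'n \<Rightarrow> real) set" where
  "D1p p = {u. in_Lp (crit_exp (real CARD('n)) p) u \<and>
               (\<exists>g. has_weak_gradient u g \<and> in_Lp p (\<lambda>x. norm (g x)))}"

definition energy ::
  "real \<Rightarrow> real \<Rightarrow> real \<Rightarrow> real \<Rightarrow> real \<Rightarrow> real \<Rightarrow> (real ^ 'n \<Rightarrow> real) \<Rightarrow> (real ^ 'n \<Rightarrow> real) \<Rightarrow> real" where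
  "energy p \<alpha> \<beta> \<mu>\<^sub>1 \<mu>\<^sub>2 \<gamma> u v =
     (let ps = crit_exp (real CARD('n)) p in
       1 / p * (LINT x|lebesgue. norm (wgrad u x) powr p + norm (wgrad v x) powr p)
       - 1 / ps * (LINT x|lebesgue. \<mu>\<^sub>1 * \<bar>u x\<bar> powr ps + \<mu>\<^sub>2 * \<bar>v x\<bar> powr ps
                                     + \<gamma> * \<bar>u x\<bar> powr \<alpha> * \<bar>v x\<bar> powr \<beta>))"

definition nehari ::
  "real \<Rightarrow> real \<Rightarrow> real \<Rightarrow> real \<Rightarrow> real \<Rightarrow> real \<Rightarrow> ((real ^ 'n \<Rightarrow> real) \<times> (real ^ 'n \<Rightarrow> real)) set" where
  "nehari p \<alpha> \<beta> \<mu>\<^sub>1 \<mu>\<^sub>2 \<gamma> =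
     {(u, v). let ps = crit_exp (real CARD('n)) p in
        u \<in> D1p p \<and> v \<in> D1p p \<and>
        \<not> (AE x in lebesgue. u x = 0) \<and> \<not> (AE x in lebesgue. v x = 0) \<and>
        (LINT x|lebesgue. norm (wgrad u x) powr p) =
          (LINT x|lebesgue. \<mu>\<^sub>1 * \<bar>u x\<bar> powr ps
                             + \<alpha> * \<gamma> / ps * \<bar>u x\<bar> powr \<alpha> * \<bar>v x\<bar> powr \<beta>) \<and>
        (LINT x|lebesgue. norm (wgrad v x) powr p) =
          (LINT x|lebesgue. \<mu>\<^sub>2 * \<bar>v x\<bar> powr ps
                             + \<beta> * \<gamma> / ps * \<bar>u x\<bar> powr \<alpha> * \<bar>v x\<bar> powr \<beta>)}"

text \<open>
  The type argument fixes the space \<open>real ^ 'n\<close>. For the parameters of interest the energy is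
  nonnegative on the nonempty set \<open>nehari\<close>, so the real-valued infimum is the true one.
\<close>

definition least_energy ::
  "'n::finite itself \<Rightarrow> real \<Rightarrow> real \<Rightarrow> real \<Rightarrow> real \<Rightarrow> real \<Rightarrow> real \<Rightarrow> real" where
  "least_energy _ p \<alpha> \<beta> \<mu>\<^sub>1 \<mu>\<^sub>2 \<gamma> =
     (INF (u, v)\<in>(nehari p \<alpha> \<beta> \<mu>\<^sub>1 \<mu>\<^sub>2 \<gamma> :: ((real ^ 'n \<Rightarrow> real) \<times> (real ^ 'n \<Rightarrow> real)) set).
        energy p \<alpha> \<beta> \<mu>\<^sub>1 \<mu>\<^sub>2 \<gamma> u v)"

definition weak_solution ::
  "real \<Rightarrow> real \<Rightarrow> real \<Rightarrow> real \<Rightarrow> real \<Rightarrow> real \<Rightarrow> (real ^ 'n \<Rightarrow> real) \<Rightarrow> (real ^ 'n \<Rightarrow> real) \<Rightarrow> bool" where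
  "weak_solution p \<alpha> \<beta> \<mu>\<^sub>1 \<mu>\<^sub>2 \<gamma> u v \<longleftrightarrow>
     (let ps = crit_exp (real CARD('n)) p in
       u \<in> D1p p \<and> v \<in> D1p p \<and>
       (\<forall>\<phi>\<in>D1p p.
          (LINT x|lebesgue. norm (wgrad u x) powr (p - 2) * (wgrad u x \<bullet> wgrad \<phi> x)) =
          (LINT x|lebesgue. (\<mu>\<^sub>1 * \<bar>u x\<bar> powr (ps - 2) * u x
              + \<alpha> * \<gamma> / ps * \<bar>u x\<bar> powr (\<alpha> - 2) * u x * \<bar>v x\<bar> powr \<beta>) * \<phi> x)) \<and>
       (\<forall>\<psi>\<in>D1p p.
          (LINT x|lebesgue. norm (wgrad v x) powr (p - 2) * (wgrad v x \<bullet> wgrad \<psi> x)) =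
          (LINT x|lebesgue. (\<mu>\<^sub>2 * \<bar>v x\<bar> powr (ps - 2) * v x
              + \<beta> * \<gamma> / ps * \<bar>u x\<bar> powr \<alpha> * \<bar>v x\<bar> powr (\<beta> - 2) * v x) * \<psi> x)))"

text \<open>Critical points of the energy on \<open>D = D1p p \<times> D1p p\<close>: all directional derivatives vanish.\<close>

definition critical_point ::
  "real \<Rightarrow> real \<Rightarrow> real \<Rightarrow> real \<Rightarrow> real \<Rightarrow> real \<Rightarrow> (real ^ 'n \<Rightarrow> real) \<Rightarrow> (real ^ 'n \<Rightarrow> real) \<Rightarrow> bool" where
  "critical_point p \<alpha> \<beta> \<mu>\<^sub>1 \<mu>\<^sub>2 \<gamma> u v \<longleftrightarrow>
     u \<in> D1p p \<and> v \<in> D1p p \<and>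
     (\<forall>\<phi>\<in>D1p p. \<forall>\<psi>\<in>D1p p.
        ((\<lambda>t. energy p \<alpha> \<beta> \<mu>\<^sub>1 \<mu>\<^sub>2 \<gamma> (\<lambda>x. u x + t * \<phi> x) (\<lambda>x. v x + t * \<psi> x))
           has_real_derivative 0) (at 0))"

text \<open>
  Solutions are weak solutions, equivalently critical points of the energy. Both descriptions are
  recorded, so that the equations of the system and the functional are both visible.
\<close>

definition positive_solution ::
  "real \<Rightarrow> real \<Rightarrow> real \<Rightarrow> real \<Rightarrow> real \<Rightarrow> real \<Rightarrow> (real ^ 'n \<Rightarrow> real) \<Rightarrow> (real ^ 'n \<Rightarrow> real) \<Rightarrow> bool" where
  "positive_solution p \<alpha> \<beta> \<mu>\<^sub>1 \<mu>\<^sub>2 \<gamma> u v \<longleftrightarrow>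
     weak_solution p \<alpha> \<beta> \<mu>\<^sub>1 \<mu>\<^sub>2 \<gamma> u v \<and> critical_point p \<alpha> \<beta> \<mu>\<^sub>1 \<mu>\<^sub>2 \<gamma> u v \<and>
     (AE x in lebesgue. u x > 0) \<and> (AE x in lebesgue. v x > 0)"

definition bubble :: "real \<Rightarrow> real \<Rightarrow> real ^ 'n \<Rightarrow> real ^ 'n \<Rightarrow> real" where
  "bubble p \<epsilon> y x =
     (let N = real CARD('n) in
       (N * ((N - p) / (p - 1)) powr (p - 1)) powr ((N - p) / p\<^sup>2) *
       (\<epsilon> powr (1 / (p - 1)) / (\<epsilon> powr (p / (p - 1)) + norm (x - y) powr (p / (p - 1))))
         powr ((N - p) / p))"

end

theory Submission
  imports Defs
begin

text \<open>
  Every solution \<open>(k, l)\<close> of the algebraic system yields a positive solution on the Nehari set whose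
  energy is \<open>k + l\<close> times a positive constant. So it suffices to find, for small \<open>\<gamma>\<close>, two solutions of the
  algebraic system with different sums; the one with the larger sum is then above the least energy,
  and no Sobolev inequality is involved. In the quotient \<open>\<tau> = l / k\<close> the system is a single equation.
  As \<open>\<gamma>\<close> tends to \<open>0\<close> it has one root that stays away from \<open>0\<close> and, because \<open>\<beta> < p\<close>, another one that
  tends to \<open>0\<close> and gives a smaller sum.

  The bubble solves its equation because its flux is a multiple of the explicit vector field
  \<open>(a + norm (x - y) powr q) powr (- N / q) *\<^sub>R (x - y)\<close> with \<open>q = p / (p - 1)\<close>. This field is
  continuously differentiable, so after a cutoff it is admissible in the definition of the weak
  gradient of an arbitrary element of \<open>D1p p\<close>.
\<close>

subsection \<open>Test functions\<close>

text \<open>\<open>wgrad\<close> picks an unspecified weak gradient, so no integral containing it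
  can be evaluated until weak gradients are known to be unique a.e. This is why the fundamental
  lemma of the calculus of variations comes early. Multiples of one bubble reduce the system to
  algebra because the p-Laplacian is homogeneous of degree p - 1 while every term on the right has
  total degree \<open>ps - 1\<close>. Each equation for such a pair is therefore the equation of the
  bubble times a number, and the algebraic system says that these numbers match. The bubble equation
  must hold against all of \<open>D1p p\<close>, whose elements need not have compact support.
  Rather than approximating these elements, the proof cuts off the explicit field and lets the
  radius tend to infinity; the radial derivative of the cutoff is bounded uniformly in the radius,
  so dominated convergence applies. A real-valued infimum lies below its members only if the set is
  bounded below. The energy formula on the Nehari set provides the lower bound 0.\<close>

definition C1_with_gradient :: "(real ^ 'n \<Rightarrow> real) \<Rightarrow> (real ^ 'n \<Rightarrow> real ^ 'n) \<Rightarrow> bool" where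
  "C1_with_gradient f df \<longleftrightarrow> (\<forall>x. GDERIV f x :> df x) \<and> continuous_on UNIV df"

lemma GDERIV_continuous_on:
  assumes "\<And>x. GDERIV f x :> df x"
  shows "continuous_on S f"
proof (rule continuous_at_imp_continuous_on, rule ballI)
  show "isCont f x" for x
    using assms[of x] unfolding gderiv_def by (rule has_derivative_continuous)
qed

lemma C1_continuous_on: "C1_with_gradient f df \<Longrightarrow> continuous_on S f"
  unfolding C1_with_gradient_def by (blast intro: GDERIV_continuous_on)

text \<open>In finite dimension a closure is compact exactly when the set is bounded, and
  boundedness passes directly to smaller supports.\<close>

lemma C1c_iff:
  "C1c_with_gradient f df \<longleftrightarrow> C1_with_gradient f df \<and> bounded {x. f x \<noteq> 0}"
  unfolding C1c_with_gradient_def C1_with_gradient_def by (simp add: compact_closure)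

lemma C1_mult:
  assumes "C1_with_gradient f df" "C1_with_gradient g dg"
  shows "C1_with_gradient (\<lambda>x. f x * g x) (\<lambda>x. f x *\<^sub>R dg x + g x *\<^sub>R df x)"
  using assms C1_continuous_on[of f df] C1_continuous_on[of g dg]
  by (auto simp: C1_with_gradient_def intro!: GDERIV_mult continuous_intros)

lemma C1c_mult:
  assumes "C1_with_gradient f df" "C1c_with_gradient g dg"
  shows "C1c_with_gradient (\<lambda>x. f x * g x) (\<lambda>x. f x *\<^sub>R dg x + g x *\<^sub>R df x)"
proof -
  have "bounded {x. f x * g x \<noteq> 0}"
    by (rule bounded_subset[of "{x. g x \<noteq> 0}"]) (use assms C1c_iff in auto)
  then show ?thesis
    using assms by (auto simp: C1c_iff intro: C1_mult)
qed

text \<open>Continuity of \<open>h'\<close> is asked only on \<open>range f\<close>, so that real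
  powers, which are singular at 0, can serve as outer functions.\<close>

lemma C1_compose:
  assumes f: "C1_with_gradient f df" and h: "\<And>x. (h has_real_derivative h' (f x)) (at (f x))"
    and h': "continuous_on (range f) h'"
  shows "C1_with_gradient (\<lambda>x. h (f x)) (\<lambda>x. h' (f x) *\<^sub>R df x)"
proof -
  have "continuous_on UNIV (\<lambda>x. h' (f x))"
    using continuous_on_compose2[OF h' C1_continuous_on[OF f]] by auto
  then show ?thesis
    using assms unfolding C1_with_gradient_def
    by (intro conjI allI GDERIV_DERIV_compose continuous_intros) auto
qed

lemma C1_inner_translate: "C1_with_gradient (\<lambda>x. (x - y) \<bullet> b) (\<lambda>x. b)"
  unfolding C1_with_gradient_def gderiv_def
  using bounded_linear.has_derivative[OF bounded_linear_inner_left
      has_derivative_diff[OF has_derivative_ident has_derivative_const[of y]]] by simp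

lemma C1_norm_square: "C1_with_gradient (\<lambda>x. (norm (x - y))\<^sup>2) (\<lambda>x. 2 *\<^sub>R (x - y))"
proof -
  have "((\<lambda>x. (x - y) \<bullet> (x - y)) has_derivative (\<lambda>h. h \<bullet> (2 *\<^sub>R (x - y)))) (at x)" for x
    by (rule derivative_eq_intros refl | simp add: inner_commute)+
  then show ?thesis
    unfolding C1_with_gradient_def gderiv_def power2_norm_eq_inner by (auto intro!: continuous_intros)
qed

text \<open>Squaring removes the kink of the positive part: at 0 the difference quotient is at most
  \<open>\<bar>h\<bar>\<close>. This gives compactly supported \<open>C1\<close> functions without
  exponential bumps.\<close>

lemma has_real_derivative_pos_part_square:
  "((\<lambda>s::real. (max 0 s)\<^sup>2) has_real_derivative 2 * max 0 s) (at s)"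
proof -
  consider "s > 0" | "s < 0" | "s = 0" by linarith
  then show ?thesis
  proof cases
    case 1
    have "((\<lambda>s::real. s\<^sup>2) has_real_derivative 2 * max 0 s) (at s)"
      using 1 by (auto intro!: derivative_eq_intros)
    then show ?thesis
      by (rule has_field_derivative_transform_within_open[where S = "{0<..}"]) (use 1 in auto)
  next
    case 2
    have "((\<lambda>s::real. 0) has_real_derivative 2 * max 0 s) (at s)"
      using 2 by (auto intro!: derivative_eq_intros)
    then show ?thesis
      by (rule has_field_derivative_transform_within_open[where S = "{..<0}"]) (use 2 in auto)
  next
    case 3
    have "((\<lambda>h::real. (max 0 h)\<^sup>2 / h) \<longlongrightarrow> 0) (at 0)"
    proof (rule Lim_null_comparison)
      show "\<forall>\<^sub>F h in at (0::real). norm ((max 0 h)\<^sup>2 / h) \<le> \<bar>h\<bar>"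
        by (auto simp: max_def power2_eq_square)
      show "((\<lambda>h::real. \<bar>h\<bar>) \<longlongrightarrow> 0) (at 0)"
        by (rule tendsto_eq_intros | simp)+
    qed
    then show ?thesis
      using 3 by (simp add: has_field_derivative_iff)
  qed
qed

text \<open>The squared norm keeps the function differentiable at the centre, and the outer square
  makes it \<open>C1\<close> across the sphere. It is nonzero exactly on
  \<open>ball y R\<close>.\<close>

definition cutoff :: "real ^ 'n \<Rightarrow> real \<Rightarrow> real ^ 'n \<Rightarrow> real" where
  "cutoff y R x = (max 0 (1 - (norm (x - y))\<^sup>2 / R\<^sup>2))\<^sup>2"

definition cutoff_grad :: "real ^ 'n \<Rightarrow> real \<Rightarrow> real ^ 'n \<Rightarrow> real ^ 'n" where
  "cutoff_grad y R x = (- 4 / R\<^sup>2 * max 0 (1 - (norm (x - y))\<^sup>2 / R\<^sup>2)) *\<^sub>R (x - y)"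

lemma cutoff_nonzero_iff:
  assumes "R > 0"
  shows "cutoff y R x \<noteq> 0 \<longleftrightarrow> x \<in> ball y R"
proof -
  have "max 0 (1 - (norm (x - y))\<^sup>2 / R\<^sup>2) \<noteq> 0 \<longleftrightarrow> (norm (x - y))\<^sup>2 / R\<^sup>2 < 1"
    by linarith
  then have "cutoff y R x \<noteq> 0 \<longleftrightarrow> (norm (x - y))\<^sup>2 < R\<^sup>2"
    using assms unfolding cutoff_def zero_less_power2 by (simp add: divide_less_eq del: power_one_over)
  also have "\<dots> \<longleftrightarrow> norm (x - y) < R"
    using assms power_strict_mono[of "norm (x - y)" R 2] power_mono[of R "norm (x - y)" 2]
    by (metis less_eq_real_def linorder_not_less norm_ge_zero zero_less_numeral)
  finally show ?thesis
    by (simp add: dist_norm norm_minus_commute)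
qed

lemma cutoff_bounds: "0 \<le> cutoff y R x" "cutoff y R x \<le> 1"
  by (auto simp: cutoff_def max_def intro!: power_le_one)

lemma C1c_cutoff:
  fixes y :: "real ^ 'n"
  assumes "R > 0"
  shows "C1c_with_gradient (cutoff y R) (cutoff_grad y R)"
proof -
  have 1: "((\<lambda>t. (max 0 (1 - t / R\<^sup>2))\<^sup>2) has_real_derivative 2 * max 0 (1 - t / R\<^sup>2) * (- 1 / R\<^sup>2)) (at t)" for t
    by (rule DERIV_chain2[OF has_real_derivative_pos_part_square])
       (use assms in \<open>auto intro!: derivative_eq_intros simp: field_simps\<close>)
  have "C1_with_gradient (cutoff y R)
     (\<lambda>x. (2 * max 0 (1 - (norm (x - y))\<^sup>2 / R\<^sup>2) * (- 1 / R\<^sup>2)) *\<^sub>R 2 *\<^sub>R (x - y))"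
    unfolding cutoff_def
    by (rule C1_compose[OF C1_norm_square 1]) (use assms in \<open>auto intro!: continuous_intros\<close>)
  then have "C1_with_gradient (cutoff y R) (cutoff_grad y R)"
    unfolding cutoff_grad_def by (simp add: mult_ac)
  moreover have "{x. cutoff y R x \<noteq> 0} = ball y R"
    using cutoff_nonzero_iff[OF assms] by blast
  ultimately show ?thesis
    unfolding C1c_iff by simp
qed

subsection \<open>The fundamental lemma of the calculus of variations\<close>

text \<open>The function is the pointwise limit of its truncations to the balls of radius n, which
  are integrable.\<close>

lemma locally_integrable_borel_measurable:
  fixes g :: "real ^ 'n \<Rightarrow> 'b::euclidean_space"
  assumes "locally_integrable g"
  shows "g \<in> borel_measurable lebesgue"
proof (rule borel_measurable_LIMSEQ_metric)
  show "(\<lambda>x. indicator (cball 0 (real n)) x *\<^sub>R g x) \<in> borel_measurable lebesgue" for n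
    using assms unfolding locally_integrable_def set_integrable_def
    by (auto intro!: borel_measurable_integrable)
  fix x :: "real ^ 'n"
  have "\<forall>\<^sub>F n in sequentially. norm x \<le> real n"
    using filterlim_real_sequentially filterlim_at_top by blast
  then have "\<forall>\<^sub>F n in sequentially. indicator (cball 0 (real n)) x *\<^sub>R g x = g x"
    by eventually_elim auto
  then show "(\<lambda>n. indicator (cball 0 (real n)) x *\<^sub>R g x) \<longlonglongrightarrow> g x"
    by (rule tendsto_eventually)
qed

lemma completion_ex_borel_measurable_euclidean:
  fixes g :: "'a \<Rightarrow> 'b::euclidean_space"
  assumes "g \<in> borel_measurable (completion M)"
  obtains g' where "g' \<in> borel_measurable M" "AE x in M. g x = g' x"
proof -
  have "\<exists>h\<in>borel_measurable M. AE x in M. g x \<bullet> b = h x" for b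
    using assms by (intro completion_ex_borel_measurable_real borel_measurable_inner) auto
  then obtain h where h: "\<And>b. h b \<in> borel_measurable M" "\<And>b. AE x in M. g x \<bullet> b = h b x"
    by metis
  show ?thesis
  proof
    show "(\<lambda>x. \<Sum>b\<in>Basis. h b x *\<^sub>R b) \<in> borel_measurable M"
      using h(1) by (intro borel_measurable_sum borel_measurable_scaleR) auto
    have "AE x in M. \<forall>b\<in>Basis. g x \<bullet> b = h b x"
      using h(2) by (intro AE_finite_allI) auto
    then show "AE x in M. g x = (\<Sum>b\<in>Basis. h b x *\<^sub>R b)"
    proof eventually_elim
      case (elim x)
      have "g x = (\<Sum>b\<in>Basis. (g x \<bullet> b) *\<^sub>R b)" by (rule euclidean_representation[symmetric])
      also have "\<dots> = (\<Sum>b\<in>Basis. h b x *\<^sub>R b)"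
        using elim by (intro sum.cong) auto
      finally show ?case .
    qed
  qed
qed

lemma C1c_continuous:
  assumes "C1c_with_gradient \<phi> d\<phi>"
  shows "continuous_on UNIV \<phi>" "continuous_on UNIV d\<phi>" "compact (closure {x. \<phi> x \<noteq> 0})"
  using assms C1_continuous_on[of \<phi> d\<phi> UNIV]
  by (simp_all add: C1c_iff C1_with_gradient_def compact_closure)

text \<open>Off the support the function vanishes on an open set, so uniqueness of the derivative
  forces the gradient to vanish there as well.\<close>

lemma C1c_outside:
  assumes "C1c_with_gradient \<phi> d\<phi>" "x \<notin> closure {x. \<phi> x \<noteq> 0}"
  shows "\<phi> x = 0" "d\<phi> x = 0"
proof -
  let ?K = "closure {x. \<phi> x \<noteq> 0}"
  have \<phi>0: "\<phi> x = 0" if "x \<notin> ?K" for x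
    using that closure_subset[of "{x. \<phi> x \<noteq> 0}"] by blast
  show "\<phi> x = 0" using \<phi>0[OF assms(2)] .
  have "(\<phi> has_derivative (\<lambda>h. h \<bullet> d\<phi> x)) (at x)"
    using assms by (simp add: C1c_with_gradient_def gderiv_def)
  moreover have "(\<phi> has_derivative (\<lambda>h. 0)) (at x)"
  proof (rule has_derivative_transform_within_open)
    show "((\<lambda>_. 0) has_derivative (\<lambda>h. 0)) (at x)" by simp
    show "x \<in> - ?K" using assms(2) by blast
    show "0 = \<phi> z" if "z \<in> - ?K" for z
      using \<phi>0[of z] that by (metis ComplD)
  qed (rule open_Compl[OF closed_closure])
  ultimately have "(\<lambda>h. h \<bullet> d\<phi> x) = (\<lambda>h. 0)"
    by (rule has_derivative_unique)
  then have "d\<phi> x \<bullet> d\<phi> x = 0" by (rule fun_cong)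
  then show "d\<phi> x = 0" by simp
qed

lemma C1c_norm_bounded:
  assumes \<phi>: "C1c_with_gradient \<phi> d\<phi>"
  obtains B where "\<And>x. \<bar>\<phi> x\<bar> \<le> B" "\<And>x. norm (d\<phi> x) \<le> B"
proof -
  let ?K = "closure {x. \<phi> x \<noteq> 0}"
  note cont = C1c_continuous(1,2)[OF \<phi>]
  have "bounded (\<phi> ` ?K)" "bounded (d\<phi> ` ?K)"
    by (auto intro!: compact_imp_bounded compact_continuous_image C1c_continuous(3)[OF \<phi>]
        continuous_on_subset[OF cont(1)] continuous_on_subset[OF cont(2)])
  then obtain A B where AB: "\<And>x. x \<in> ?K \<Longrightarrow> norm (\<phi> x) \<le> A" "\<And>x. x \<in> ?K \<Longrightarrow> norm (d\<phi> x) \<le> B"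
      "A > 0" "B > 0"
    unfolding bounded_pos by blast
  show ?thesis
  proof (intro that[of "max A B"])
    show "\<bar>\<phi> x\<bar> \<le> max A B" "norm (d\<phi> x) \<le> max A B" for x
      using C1c_outside[OF \<phi>, of x] AB(1,2)[of x] AB(3) by (cases "x \<in> ?K"; force)+
  qed
qed

lemma integrable_bounded_support:
  fixes \<phi> :: "real ^ 'n \<Rightarrow> real" and g :: "real ^ 'n \<Rightarrow> 'b::euclidean_space"
  assumes g: "locally_integrable g" and \<phi>: "\<phi> \<in> borel_measurable lebesgue"
    and B: "\<And>x. \<bar>\<phi> x\<bar> \<le> B" and K: "compact K" "\<And>x. x \<notin> K \<Longrightarrow> \<phi> x = 0"
  shows "integrable lebesgue (\<lambda>x. \<phi> x *\<^sub>R g x)"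
proof (rule Bochner_Integration.integrable_bound)
  show "integrable lebesgue (\<lambda>x. B *\<^sub>R indicator K x *\<^sub>R g x)"
    using g K unfolding locally_integrable_def set_integrable_def
    by (intro integrable_scaleR_right) simp
  show "(\<lambda>x. \<phi> x *\<^sub>R g x) \<in> borel_measurable lebesgue"
    using locally_integrable_borel_measurable[OF g] \<phi> by measurable
  show "AE x in lebesgue. norm (\<phi> x *\<^sub>R g x) \<le> norm (B *\<^sub>R indicator K x *\<^sub>R g x)"
    using B K by (auto simp: indicator_def intro!: mult_right_mono order_trans[OF B abs_ge_self])
qed

lemma continuous_imp_borel_measurable_lebesgue:
  fixes f :: "'a::euclidean_space \<Rightarrow> 'b::euclidean_space"
  assumes "continuous_on UNIV f"
  shows "f \<in> borel_measurable lebesgue"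
  by (rule measurable_completion) (use borel_measurable_continuous_onI[OF assms] in simp)

text \<open>With \<open>h n t = n t^2 / (1 + n t^2)\<close> the composition
  \<open>h n (\<psi> x)\<close> is again a test function, since \<open>h n 0 = 0\<close>. It stays
  in [0, 1] and tends to the indicator of the set where \<open>\<psi>\<close> is nonzero, so
  dominated convergence applies.\<close>

lemma integral_over_support_eq_0:
  fixes g :: "real ^ 'n \<Rightarrow> real ^ 'n"
  assumes g: "locally_integrable g"
    and zero: "\<And>\<phi> d\<phi>. C1c_with_gradient \<phi> d\<phi> \<Longrightarrow> (LINT x|lebesgue. \<phi> x *\<^sub>R g x) = 0"
    and \<psi>: "C1c_with_gradient \<psi> d\<psi>"
  shows "(LINT x|lebesgue. indicator {x. \<psi> x \<noteq> 0} x *\<^sub>R g x) = 0"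
proof -
  define h where "h n t = real n * t\<^sup>2 / (1 + real n * t\<^sup>2)" for n t
  define h' where "h' n t = 2 * real n * t / (1 + real n * t\<^sup>2)\<^sup>2" for n and t :: real
  have pos: "1 + real n * t\<^sup>2 > 0" for n t
    by (meson add_pos_nonneg mult_nonneg_nonneg of_nat_0_le_iff zero_le_power2 zero_less_one)
  have der: "(h n has_real_derivative h' n t) (at t)" for n t
    unfolding h_def h'_def using pos[of n t]
    by (auto intro!: derivative_eq_intros simp: field_simps power2_eq_square)
  have conth': "continuous_on A (h' n)" for A n
    unfolding h'_def using pos by (intro continuous_intros) (auto simp: less_imp_neq[THEN not_sym])
  have C1: "C1c_with_gradient (\<lambda>x. h n (\<psi> x)) (\<lambda>x. h' n (\<psi> x) *\<^sub>R d\<psi> x)" for n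
    unfolding C1c_iff
  proof
    show "bounded {x. h n (\<psi> x) \<noteq> 0}"
      by (rule bounded_subset[of "{x. \<psi> x \<noteq> 0}"]) (use \<psi> in \<open>auto simp: C1c_iff h_def\<close>)
  qed (rule C1_compose[OF _ der conth'], use \<psi> C1c_iff in auto)
  let ?K = "closure {x. \<psi> x \<noteq> 0}"
  have "(\<lambda>n. LINT x|lebesgue. h n (\<psi> x) *\<^sub>R g x) \<longlonglongrightarrow>
      (LINT x|lebesgue. indicator {x. \<psi> x \<noteq> 0} x *\<^sub>R g x)"
  proof (rule integral_dominated_convergence)
    have mg: "g \<in> borel_measurable lebesgue"
      by (rule locally_integrable_borel_measurable[OF g])
    have cont: "continuous_on UNIV \<psi>"
      using \<psi> C1_continuous_on C1c_iff by blast
    have "open {x. \<psi> x \<noteq> 0}"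
      using open_Collect_neq[OF cont continuous_on_const] .
    then have [measurable]: "{x. \<psi> x \<noteq> 0} \<in> sets lebesgue" by simp
    show "(\<lambda>x. indicator {x. \<psi> x \<noteq> 0} x *\<^sub>R g x) \<in> borel_measurable lebesgue"
      using mg by measurable
    have "(\<lambda>x. h n (\<psi> x)) \<in> borel_measurable lebesgue" for n
      using C1[of n] C1_continuous_on C1c_iff continuous_imp_borel_measurable_lebesgue by blast
    then show "(\<lambda>x. h n (\<psi> x) *\<^sub>R g x) \<in> borel_measurable lebesgue" for n
      using mg by measurable
    show "integrable lebesgue (\<lambda>x. norm (indicator ?K x *\<^sub>R g x))"
      using g \<psi> unfolding locally_integrable_def set_integrable_def C1c_with_gradient_def
      by (intro integrable_norm) auto
    have "\<bar>h n t\<bar> \<le> 1" for n t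
      using pos[of n t] by (auto simp: h_def field_simps)
    moreover have "h n (\<psi> x) = 0" if "x \<notin> ?K" for n x
      using that closure_subset by (force simp: h_def)
    ultimately show "AE x in lebesgue. norm (h n (\<psi> x) *\<^sub>R g x) \<le> norm (indicator ?K x *\<^sub>R g x)" for n
      by (auto simp: indicator_def intro!: mult_left_le_one_le)
    have "(\<lambda>n. h n t) \<longlonglongrightarrow> 1" if "t \<noteq> 0" for t
    proof -
      have "filterlim (\<lambda>n. 1 + t\<^sup>2 * real n) at_top sequentially"
        using that by (intro filterlim_tendsto_add_at_top[OF tendsto_const]
            filterlim_tendsto_pos_mult_at_top[OF tendsto_const _ filterlim_real_sequentially]) auto
      then have "(\<lambda>n. 1 - 1 / (1 + t\<^sup>2 * real n)) \<longlonglongrightarrow> 1 - 0"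
        by (intro tendsto_intros tendsto_divide_0[OF tendsto_const] filterlim_at_top_imp_at_infinity)
      moreover have "1 - 1 / (1 + t\<^sup>2 * real n) = h n t" for n
        using pos[of n t] by (simp add: h_def field_simps)
      ultimately show ?thesis by simp
    qed
    then have "(\<lambda>n. h n (\<psi> x)) \<longlonglongrightarrow> indicator {x. \<psi> x \<noteq> 0} x" for x
      by (cases "\<psi> x = 0") (auto simp: h_def)
    then show "AE x in lebesgue. (\<lambda>n. h n (\<psi> x) *\<^sub>R g x) \<longlonglongrightarrow> indicator {x. \<psi> x \<noteq> 0} x *\<^sub>R g x"
      by (auto intro!: tendsto_intros)
  qed
  then show ?thesis
    using zero[OF C1] by (simp add: LIMSEQ_const_iff)
qed

text \<open>
  These sets are closed under intersection, since the test functions form an algebra, and generate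
  the Borel sets: a Dynkin system argument then passes from test functions to all Borel sets.
\<close>

definition support_sets :: "(real ^ 'n) set set" where
  "support_sets = {{x. \<psi> x \<noteq> 0} |\<psi>. \<exists>d\<psi>. C1c_with_gradient \<psi> d\<psi>}"

text \<open>Every ball is the nonvanishing set of a cutoff, and by the Lindelof property every open
  set is a countable union of balls.\<close>

lemma borel_sets_support_sets: "sets (borel :: (real ^ 'n) measure) \<subseteq> sigma_sets UNIV support_sets"
proof -
  have ball: "ball y R \<in> sigma_sets UNIV support_sets" for y :: "real ^ 'n" and R
  proof (cases "R > 0")
    case True
    have "ball y R = {x. cutoff y R x \<noteq> 0}"
      using cutoff_nonzero_iff[OF True] by blast
    then have "ball y R \<in> support_sets"
      unfolding support_sets_def using C1c_cutoff[OF True] by blast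
    then show ?thesis by (rule sigma_sets.Basic)
  next
    case False
    then have "ball y R = {}" by simp
    then show ?thesis using sigma_sets.Empty by metis
  qed
  have "S \<in> sigma_sets UNIV support_sets" if oS: "open S" for S :: "(real ^ 'n) set"
  proof -
    let ?F = "{ball y R |y R. ball y R \<subseteq> S}"
    have "\<Union>?F = S"
    proof
      show "S \<subseteq> \<Union>?F"
      proof
        fix x assume "x \<in> S"
        then obtain e where "e > 0" "ball x e \<subseteq> S"
          using oS by (auto simp: open_contains_ball)
        then show "x \<in> \<Union>?F"
          by (metis (mono_tags, lifting) UnionI centre_in_ball mem_Collect_eq)
      qed
    qed auto
    moreover obtain F' where "F' \<subseteq> ?F" "countable F'" "\<Union>F' = \<Union>?F"
    proof (rule Lindelof[of ?F])
      show "open T" if "T \<in> ?F" for T using that by auto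
    qed blast
    ultimately show ?thesis
    proof -
      have "\<Union>F' \<in> sigma_sets UNIV support_sets"
      proof (rule sigma_sets_UNION[OF \<open>countable F'\<close>])
        fix B assume "B \<in> F'"
        then obtain y R where "B = ball y R" using \<open>F' \<subseteq> ?F\<close> by blast
        then show "B \<in> sigma_sets UNIV support_sets" using ball by simp
      qed
      then show ?thesis using \<open>\<Union>?F = S\<close> \<open>\<Union>F' = \<Union>?F\<close> by argo
    qed
  qed
  then have "sigma_sets UNIV {S. open S} \<subseteq> sigma_sets UNIV (support_sets :: (real ^ 'n) set set)"
    by (intro sigma_sets_mono) auto
  then show ?thesis
    by (simp add: borel_def)
qed

lemma Int_stable_support_sets: "Int_stable support_sets"
proof (rule Int_stableI)
  fix A B :: "(real ^ 'n) set"
  assume "A \<in> support_sets" "B \<in> support_sets"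
  then obtain f df g dg where fg: "A = {x. f x \<noteq> 0}" "B = {x. g x \<noteq> 0}"
     "C1c_with_gradient f df" "C1c_with_gradient g dg"
    unfolding support_sets_def by blast
  then have "A \<inter> B = {x. f x * g x \<noteq> 0}" by auto
  moreover have "C1c_with_gradient (\<lambda>x. f x * g x) (\<lambda>x. f x *\<^sub>R dg x + g x *\<^sub>R df x)"
    using fg by (intro C1c_mult) (auto simp: C1c_iff)
  ultimately show "A \<inter> B \<in> support_sets"
    unfolding support_sets_def by (intro CollectI exI conjI)
qed

lemma support_sets_borel: "A \<in> support_sets \<Longrightarrow> A \<in> sets borel"
proof -
  assume "A \<in> support_sets"
  then obtain \<psi> d\<psi> where "A = {x. \<psi> x \<noteq> 0}" "C1c_with_gradient \<psi> d\<psi>"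
    unfolding support_sets_def by blast
  then have "open A"
    using C1_continuous_on[of \<psi> d\<psi> UNIV] by (simp add: C1c_iff open_Collect_neq)
  then show ?thesis by simp
qed

text \<open>\<open>g\<close> is only Lebesgue measurable, whereas the Dynkin argument runs over
  Borel sets. It is therefore carried out for a Borel function \<open>g'\<close> equal to
  \<open>g\<close> a.e. and then transferred back.\<close>

theorem fundamental_lemma_calculus_of_variations:
  fixes g :: "real ^ 'n \<Rightarrow> real ^ 'n"
  assumes g: "locally_integrable g"
    and zero: "\<And>\<phi> d\<phi>. C1c_with_gradient \<phi> d\<phi> \<Longrightarrow> (LINT x|lebesgue. \<phi> x *\<^sub>R g x) = 0"
  shows "AE x in lebesgue. g x = 0"
proof -
  have mg: "g \<in> borel_measurable lebesgue"
    by (rule locally_integrable_borel_measurable[OF g])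
  obtain g' where "g' \<in> borel_measurable lborel" and "AE x in lborel. g x = g' x"
    using completion_ex_borel_measurable_euclidean[OF mg] by blast
  then have [measurable]: "g' \<in> borel_measurable borel" by simp
  from \<open>AE x in lborel. g x = g' x\<close> have gg': "AE x in lebesgue. g x = g' x"
    by (simp add: AE_completion)
  have mg': "g' \<in> borel_measurable lebesgue"
    by (rule measurable_completion) simp
  have int_eq: "(LINT x|lborel. indicator A x *\<^sub>R g' x) = (LINT x|lebesgue. indicator A x *\<^sub>R g x)"
    if [measurable]: "A \<in> sets borel" for A
  proof -
    have "(LINT x|lborel. indicator A x *\<^sub>R g' x) = (LINT x|lebesgue. indicator A x *\<^sub>R g' x)"
      by (rule integral_completion[symmetric]) measurable
    also have "\<dots> = (LINT x|lebesgue. indicator A x *\<^sub>R g x)"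
    proof (rule integral_cong_AE)
      have [measurable]: "A \<in> sets lebesgue" using that by (simp add: sets_completionI_sets)
      show "(\<lambda>x. indicator A x *\<^sub>R g' x) \<in> borel_measurable lebesgue" using mg' by measurable
      show "(\<lambda>x. indicator A x *\<^sub>R g x) \<in> borel_measurable lebesgue" using mg by measurable
      show "AE x in lebesgue. indicator A x *\<^sub>R g' x = indicator A x *\<^sub>R g x"
        using gg' by eventually_elim simp
    qed
    finally show ?thesis .
  qed
  \<comment> \<open>Truncation to a ball turns local integrability into integrability. An integrable
    function whose integral over every measurable set is 0 vanishes a.e.; the balls are exhausted
    afterwards.\<close>
  have "AE x in lborel. indicator (ball 0 R) x *\<^sub>R g' x = 0" if "R > 0" for R
  proof (rule sigma_finite_measure.density_zero[OF sigma_finite_lborel])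
    have "integrable lebesgue (\<lambda>x. indicator (ball 0 R) x *\<^sub>R g x)"
    proof (rule integrable_bounded_support[OF g, where B = 1 and K = "cball 0 R"])
      show "(\<lambda>x. indicator (ball 0 R) x :: real) \<in> borel_measurable lebesgue"
        by (rule borel_measurable_indicator) simp
    qed (auto simp: indicator_def)
    then have "integrable lebesgue (\<lambda>x. indicator (ball 0 R) x *\<^sub>R g' x)"
      using gg' mg' by (subst integrable_cong_AE[where g="\<lambda>x. indicator (ball 0 R) x *\<^sub>R g x"])
         (auto intro!: borel_measurable_scaleR mg borel_measurable_indicator)
    then show int: "integrable lborel (\<lambda>x. indicator (ball 0 R) x *\<^sub>R g' x)"
    proof (subst (asm) integrable_completion)
      show "(\<lambda>x. indicator (ball 0 R) x *\<^sub>R g' x) \<in> borel_measurable lborel"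
        by (intro borel_measurable_scaleR borel_measurable_indicator) simp_all
    qed
    have total_supp: "(LINT x:A|lborel. indicator (ball 0 R) x *\<^sub>R g' x) = 0" if "A \<in> support_sets" for A
    proof -
      obtain \<psi> d\<psi> where A: "A = {x. \<psi> x \<noteq> 0}" "C1c_with_gradient \<psi> d\<psi>"
        using \<open>A \<in> support_sets\<close> unfolding support_sets_def by blast
      \<comment> \<open>Multiplying by the cutoff intersects the nonvanishing set with the ball, so
        the truncation is absorbed into the test function.\<close>
      have "C1c_with_gradient (\<lambda>x. \<psi> x * cutoff 0 R x)
         (\<lambda>x. \<psi> x *\<^sub>R cutoff_grad 0 R x + cutoff 0 R x *\<^sub>R d\<psi> x)"
        using A C1c_cutoff[OF \<open>R > 0\<close>] by (intro C1c_mult) (auto simp: C1c_iff)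
      from integral_over_support_eq_0[OF g zero this]
      have "(LINT x|lebesgue. indicator {x. \<psi> x * cutoff 0 R x \<noteq> 0} x *\<^sub>R g x) = 0" .
      moreover have "{x. \<psi> x * cutoff 0 R x \<noteq> 0} = A \<inter> ball 0 R"
        using cutoff_nonzero_iff[OF \<open>R > 0\<close>] A by force
      ultimately have "(LINT x|lborel. indicator (A \<inter> ball 0 R) x *\<^sub>R g' x) = 0"
        using int_eq[of "A \<inter> ball 0 R"] support_sets_borel[OF that] by simp
      then show ?thesis
        by (simp add: set_lebesgue_integral_def indicator_inter_arith)
    qed
    \<comment> \<open>The ball is itself a support set, so the truncated function has total integral
      0. The complement case of the induction rests on this.\<close>
    have "ball 0 R = {x. cutoff 0 R x \<noteq> 0}"
      using cutoff_nonzero_iff[OF \<open>R > 0\<close>] by blast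
    then have "ball 0 R \<in> support_sets"
      unfolding support_sets_def using C1c_cutoff[OF \<open>R > 0\<close>] by blast
    from total_supp[OF this] have total: "(LINT x|lborel. indicator (ball 0 R) x *\<^sub>R g' x) = 0"
      by (simp add: set_lebesgue_integral_def flip: indicator_inter_arith)
    have sub: "sigma_sets UNIV support_sets \<subseteq> sets (lborel :: (real^'n) measure)"
      using support_sets_borel sets.sigma_sets_subset[of support_sets borel] by auto
    have pow: "support_sets \<subseteq> Pow (UNIV :: (real ^ 'n) set)" by simp
    fix A :: "(real ^ 'n) set" assume "A \<in> sets lborel"
    then have "A \<in> sigma_sets UNIV support_sets"
      using borel_sets_support_sets by auto
    then show "(LINT x:A|lborel. indicator (ball 0 R) x *\<^sub>R g' x) = 0"
    proof (induction A rule: sigma_sets_induct_disjoint[OF Int_stable_support_sets pow,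
          consumes 1, case_names basic empty compl union])
      case (basic A) from basic(1) show ?case by (rule total_supp)
    next
      case empty show ?case by (simp add: set_lebesgue_integral_def)
    next
      case (compl A)
      then have [measurable]: "A \<in> sets borel" using sub by auto
      have "integrable lborel (\<lambda>x. indicator A x *\<^sub>R indicator (ball 0 R) x *\<^sub>R g' x)"
        by (rule integrable_mult_indicator[OF _ int]) simp
      moreover have "indicator (UNIV - A) x *\<^sub>R indicator (ball 0 R) x *\<^sub>R g' x =
         indicator (ball 0 R) x *\<^sub>R g' x - indicator A x *\<^sub>R indicator (ball 0 R) x *\<^sub>R g' x" for x
        by (auto simp: indicator_def)
      ultimately show ?case
        using compl total int by (simp add: set_lebesgue_integral_def)
    next
      case (union A)
      have "(LINT x:(\<Union>i. A i)|lborel. indicator (ball 0 R) x *\<^sub>R g' x)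
         = (\<Sum>i. LINT x:A i|lborel. indicator (ball 0 R) x *\<^sub>R g' x)"
      proof (rule lebesgue_integral_countable_add)
        show m: "A i \<in> sets lborel" for i using union sub by auto
        show "A i \<inter> A j = {}" if "i \<noteq> j" for i j
          using union that by (auto simp: disjoint_family_on_def)
        show "set_integrable lborel (\<Union>i. A i) (\<lambda>x. indicator (ball 0 R) x *\<^sub>R g' x)"
          unfolding set_integrable_def by (rule integrable_mult_indicator[OF _ int]) (use m in auto)
      qed
      then show ?case using union by simp
    qed
  qed
  then have "AE x in lborel. \<forall>n. indicator (ball 0 (real (Suc n))) x *\<^sub>R g' x = 0"
    unfolding AE_all_countable by (metis of_nat_0_less_iff zero_less_Suc)
  then have "AE x in lborel. g' x = 0"
  proof eventually_elim
    case (elim x)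
    obtain n where "norm x < real n" using reals_Archimedean2 by blast
    then show ?case
      using elim[rule_format, of n] by (simp add: indicator_def split: if_splits)
  qed
  then have "AE x in lebesgue. g' x = 0"
    by (simp add: AE_completion)
  with gg' show ?thesis by eventually_elim simp
qed

section \<open>Almost everywhere uniqueness of weak gradients\<close>

lemma locally_integrable_lincomb:
  assumes "locally_integrable f" "locally_integrable g"
  shows "locally_integrable (\<lambda>x. a *\<^sub>R f x + b *\<^sub>R g x)"
  unfolding locally_integrable_def
proof (intro allI impI)
  fix K :: "(real ^ 'a) set" assume "compact K"
  then have "set_integrable lebesgue K f" "set_integrable lebesgue K g"
    using assms by (auto simp: locally_integrable_def)
  then show "set_integrable lebesgue K (\<lambda>x. a *\<^sub>R f x + b *\<^sub>R g x)"
    by (intro set_integral_add set_integrable_scaleR_right) auto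
qed

lemma integrable_C1c:
  assumes "locally_integrable g" "C1c_with_gradient \<phi> d\<phi>"
  shows "integrable lebesgue (\<lambda>x. \<phi> x *\<^sub>R g x)"
proof -
  obtain B where "\<And>x. \<bar>\<phi> x\<bar> \<le> B" using C1c_norm_bounded[OF assms(2)] by metis
  then show ?thesis
    using assms C1_continuous_on[of \<phi> d\<phi>]
    by (intro integrable_bounded_support[where K = "closure {x. \<phi> x \<noteq> 0}" and B = B]
        continuous_imp_borel_measurable_lebesgue)
       (use closure_subset[of "{x. \<phi> x \<noteq> 0}"] in \<open>auto simp: C1c_iff\<close>)
qed

lemma has_weak_gradient_unique:
  assumes "has_weak_gradient u g" "has_weak_gradient u h"
  shows "AE x in lebesgue. g x = h x"
proof -
  have li: "locally_integrable g" "locally_integrable h"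
    using assms by (auto simp: has_weak_gradient_def)
  have "AE x in lebesgue. 1 *\<^sub>R g x + (- 1) *\<^sub>R h x = 0"
  proof (rule fundamental_lemma_calculus_of_variations)
    fix \<phi> :: "real ^ 'a \<Rightarrow> real" and d\<phi> assume *: "C1c_with_gradient \<phi> d\<phi>"
    then have "(LINT x|lebesgue. \<phi> x *\<^sub>R g x) = (LINT x|lebesgue. \<phi> x *\<^sub>R h x)"
    proof -
      have "(LINT x|lebesgue. u x *\<^sub>R d\<phi> x) = - (LINT x|lebesgue. \<phi> x *\<^sub>R g x)"
           "(LINT x|lebesgue. u x *\<^sub>R d\<phi> x) = - (LINT x|lebesgue. \<phi> x *\<^sub>R h x)"
        using assms * unfolding has_weak_gradient_def by blast+
      then show ?thesis by simp
    qed
    then show "(LINT x|lebesgue. \<phi> x *\<^sub>R (1 *\<^sub>R g x + (- 1) *\<^sub>R h x)) = 0"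
      using integrable_C1c[OF li(1) *] integrable_C1c[OF li(2) *] by (simp add: algebra_simps)
  qed (rule locally_integrable_lincomb[OF li])
  then show ?thesis by eventually_elim simp
qed

text \<open>One known weak gradient is enough for the choice in \<open>wgrad\<close> to be
  meaningful; uniqueness then identifies the two a.e.\<close>

lemma has_weak_gradient_wgrad: "has_weak_gradient u g \<Longrightarrow> has_weak_gradient u (wgrad u)"
  unfolding wgrad_def by (rule someI[of "has_weak_gradient u"])

lemma wgrad_AE_eq:
  assumes "has_weak_gradient u g"
  shows "AE x in lebesgue. wgrad u x = g x"
  by (rule has_weak_gradient_unique[OF has_weak_gradient_wgrad[OF assms] assms])

subsection \<open>Classical gradients are weak gradients\<close>

lemma integrable_continuous_compact_support:
  fixes f :: "'a::euclidean_space \<Rightarrow> 'b::euclidean_space"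
  assumes "continuous_on UNIV f" "compact K" "\<And>x. x \<notin> K \<Longrightarrow> f x = 0"
  shows "integrable lebesgue f" "integrable lborel f"
proof -
  have "integrable lborel (\<lambda>x. indicator K x *\<^sub>R f x)"
    using assms by (intro borel_integrable_compact) (auto intro: continuous_on_subset)
  moreover have "(\<lambda>x. indicator K x *\<^sub>R f x) = f"
    using assms(3) by (auto simp: indicator_def fun_eq_iff)
  ultimately show "integrable lborel f" by simp
  then show "integrable lebesgue f"
    by (subst integrable_completion) (auto intro: borel_measurable_integrable)
qed

lemma continuous_locally_integrable:
  fixes f :: "real ^ 'n \<Rightarrow> 'b::euclidean_space"
  assumes "continuous_on UNIV f"
  shows "locally_integrable f"
  unfolding locally_integrable_def set_integrable_def
proof (intro allI impI)
  fix K :: "(real ^ 'n) set" assume "compact K"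
  then have "integrable lborel (\<lambda>x. indicator K x *\<^sub>R f x)"
    using assms by (intro borel_integrable_compact) (auto intro: continuous_on_subset)
  then show "integrable lebesgue (\<lambda>x. indicator K x *\<^sub>R f x)"
    by (subst integrable_completion) (auto intro: borel_measurable_integrable)
qed

text \<open>
  Difference quotients of an integrable function have integral \<open>0\<close> by translation invariance,
  so that Fubini's theorem is not needed.
\<close>

lemma integral_C1c_gradient:
  assumes f: "C1c_with_gradient f df"
  shows "(LINT x|lebesgue. df x) = 0"
proof -
  let ?K = "closure {x. f x \<noteq> 0}"
  have cpt: "compact ?K" and contf: "continuous_on UNIV f" and contdf: "continuous_on UNIV df"
    and der: "\<And>x. (f has_derivative (\<lambda>h. h \<bullet> df x)) (at x)"
    using C1c_continuous[OF f] f unfolding C1c_with_gradient_def gderiv_def by auto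
  have intf: "integrable lborel f"
    by (rule integrable_continuous_compact_support[OF contf cpt]) (rule C1c_outside[OF f])
  have intdf: "integrable lborel df"
    by (rule integrable_continuous_compact_support[OF contdf cpt]) (rule C1c_outside[OF f])
  obtain B where B: "\<And>x. norm (df x) \<le> B"
    using C1c_norm_bounded[OF f] by metis
  obtain R where R: "\<And>x. x \<in> ?K \<Longrightarrow> norm x \<le> R"
    using compact_imp_bounded[OF cpt] by (auto simp: bounded_iff)
  have "(LINT x|lborel. df x) \<bullet> b = 0" if b: "norm b = 1" for b
  proof -
    define D where "D n x = (f (x + (1 / real (Suc n)) *\<^sub>R b) - f x) * real (Suc n)" for n x
    have "(LINT x|lborel. D n x) = 0" for n
    proof -
      let ?c = "(1 / real (Suc n)) *\<^sub>R b"
      have *: "integrable lborel (\<lambda>x. f (?c + x))" "(LINT x|lborel. f (?c + x)) = (LINT x|lborel. f x)"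
        using intf integrable_distr_eq[of "(+) ?c" lborel borel f] integral_distr[of "(+) ?c" lborel borel f]
        by (auto simp: lborel_distr_plus)
      then show ?thesis
        unfolding D_def using intf by (simp add: add.commute del: of_nat_Suc)
    qed
    moreover have "(\<lambda>n. LINT x|lborel. D n x) \<longlonglongrightarrow> (LINT x|lborel. df x \<bullet> b)"
    proof (rule integral_dominated_convergence)
      show "(\<lambda>x. df x \<bullet> b) \<in> borel_measurable lborel"
        using contdf by (intro borel_measurable_inner) (auto intro: borel_measurable_continuous_onI)
      have [measurable]: "f \<in> borel_measurable borel"
        using contf by (rule borel_measurable_continuous_onI)
      show "D n \<in> borel_measurable lborel" for n
        unfolding D_def by measurable
      \<comment> \<open>The mean value inequality bounds every quotient by \<open>B\<close>. The
        shifts have length at most 1, so the quotients vanish outside the ball of radius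
        \<open>R + 1\<close>.\<close>
      show "integrable lborel (\<lambda>x. indicator (cball 0 (R + 1)) x *\<^sub>R B)"
        by (rule borel_integrable_compact) auto
      show "AE x in lborel. norm (D n x) \<le> indicator (cball 0 (R + 1)) x *\<^sub>R B" for n
      proof (rule AE_I2)
        fix x
        let ?c = "(1 / real (Suc n)) *\<^sub>R b"
        have nc: "norm ?c = 1 / real (Suc n)" "norm ?c \<le> 1" using b by auto
        have "norm (f (x + ?c) - f x) \<le> B * norm (x + ?c - x)"
        proof (rule differentiable_bound[of UNIV f])
          show "onorm (\<lambda>h. h \<bullet> df z) \<le> B" for z
          proof (rule onorm_le)
            show "norm (h \<bullet> df z) \<le> B * norm h" for h
              using order_trans[OF Cauchy_Schwarz_ineq2 mult_left_mono[OF B norm_ge_zero]]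
              by (simp add: mult.commute)
          qed
        qed (use der in auto)
        then have le: "norm (D n x) \<le> B"
          using nc unfolding D_def norm_mult by (simp add: field_simps del: of_nat_Suc)
        show "norm (D n x) \<le> indicator (cball 0 (R + 1)) x *\<^sub>R B"
        proof (cases "x \<in> cball 0 (R + 1)")
          case True
          then show ?thesis using le by simp
        next
          case False
          then have "norm x > R" "norm (x + ?c) > R"
            using nc(2) norm_triangle_ineq4[of "x + ?c" ?c] by (auto simp del: norm_scaleR of_nat_Suc)
          then have "f x = 0" "f (x + ?c) = 0"
            using R C1c_outside(1)[OF f] by (meson not_le)+
          then show ?thesis using False by (simp add: D_def)
        qed
      qed
      show "AE x in lborel. (\<lambda>n. D n x) \<longlonglongrightarrow> df x \<bullet> b"
      proof (rule AE_I2)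
        fix x
        have "((\<lambda>t. x + t *\<^sub>R b) has_derivative (\<lambda>t. t *\<^sub>R b)) (at 0)"
          by (auto intro!: derivative_eq_intros)
        then have "((\<lambda>t. f (x + t *\<^sub>R b)) has_derivative (\<lambda>t. (t *\<^sub>R b) \<bullet> df x)) (at 0)"
          by (rule has_derivative_compose) (simp add: der)
        then have "((\<lambda>t. f (x + t *\<^sub>R b)) has_real_derivative (df x \<bullet> b)) (at 0)"
          by (simp add: has_field_derivative_def mult_commute_abs inner_commute)
        then have "(\<lambda>h. (f (x + h *\<^sub>R b) - f x) / h) \<midarrow>0\<rightarrow> df x \<bullet> b"
          by (simp add: DERIV_def)
        moreover have "filterlim (\<lambda>n. 1 / real (Suc n)) (at 0) sequentially"
          unfolding filterlim_at using LIMSEQ_inverse_real_of_nat by (auto simp: inverse_eq_divide)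
        ultimately have "(\<lambda>n. (f (x + (1 / real (Suc n)) *\<^sub>R b) - f x) / (1 / real (Suc n))) \<longlonglongrightarrow> df x \<bullet> b"
          by (rule filterlim_compose)
        then show "(\<lambda>n. D n x) \<longlonglongrightarrow> df x \<bullet> b"
          by (simp add: D_def)
      qed
    qed
    ultimately show ?thesis
      using intdf by (simp add: LIMSEQ_const_iff)
  qed
  then have "(LINT x|lborel. df x) = 0"
    using euclidean_eqI[of "LINT x|lborel. df x" 0] by (simp add: norm_Basis)
  then show ?thesis
    by (subst integral_completion) (simp_all add: contdf borel_measurable_continuous_onI)
qed

text \<open>By the product rule, the two integrals in the weak formulation add up to the integral of
  the gradient of a compactly supported \<open>C1\<close> function, which is 0.\<close>

lemma C1_has_weak_gradient:
  fixes u :: "real ^ 'n \<Rightarrow> real"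
  assumes u: "C1_with_gradient u du"
  shows "has_weak_gradient u du"
  unfolding has_weak_gradient_def
proof (intro conjI allI impI)
  have cont: "continuous_on UNIV u" "continuous_on UNIV du"
    using u C1_continuous_on by (auto simp: C1_with_gradient_def)
  show "locally_integrable u" "locally_integrable du"
    using cont by (auto intro: continuous_locally_integrable)
  fix \<phi> :: "real ^ 'n \<Rightarrow> real" and d\<phi>
  assume \<phi>: "C1c_with_gradient \<phi> d\<phi>"
  then have cpt: "compact (closure {x. \<phi> x \<noteq> 0})" and contp: "continuous_on UNIV \<phi>" "continuous_on UNIV d\<phi>"
    using C1c_continuous by blast+
  have "integrable lebesgue (\<lambda>x. u x *\<^sub>R d\<phi> x)"
    by (rule integrable_continuous_compact_support[OF _ cpt])
       (simp_all add: C1c_outside(2)[OF \<phi>] cont contp continuous_on_scaleR)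
  moreover have "integrable lebesgue (\<lambda>x. \<phi> x *\<^sub>R du x)"
  proof (rule integrable_continuous_compact_support[OF _ cpt])
    show "\<phi> x *\<^sub>R du x = 0" if "x \<notin> closure {x. \<phi> x \<noteq> 0}" for x
      unfolding C1c_outside(1)[OF \<phi> that] by (rule scaleR_zero_left)
  qed (intro continuous_on_scaleR contp cont)
  moreover have "(LINT x|lebesgue. u x *\<^sub>R d\<phi> x + \<phi> x *\<^sub>R du x) = 0"
    by (rule integral_C1c_gradient[OF C1c_mult[OF u \<phi>]])
  ultimately show "(LINT x|lebesgue. u x *\<^sub>R d\<phi> x) = - (LINT x|lebesgue. \<phi> x *\<^sub>R du x)"
    by (simp add: eq_neg_iff_add_eq_0)
qed

section \<open>Linearity of weak gradients and tests with radial vector fields\<close>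

lemma integrable_scaleR_compact_support:
  fixes w :: "real ^ 'n \<Rightarrow> real" and F :: "real ^ 'n \<Rightarrow> 'b::euclidean_space"
  assumes w: "locally_integrable w" and F: "continuous_on UNIV F"
    and K: "compact K" "\<And>x. x \<notin> K \<Longrightarrow> F x = 0"
  shows "integrable lebesgue (\<lambda>x. w x *\<^sub>R F x)"
proof -
  have "bounded (F ` K)"
    by (intro compact_imp_bounded compact_continuous_image continuous_on_subset[OF F] K) simp
  then obtain B where B: "\<And>x. x \<in> K \<Longrightarrow> norm (F x) \<le> B"
    by (auto simp: bounded_iff)
  show ?thesis
  proof (rule Bochner_Integration.integrable_bound)
    show "integrable lebesgue (\<lambda>x. B *\<^sub>R indicator K x *\<^sub>R w x)"
      using w K(1) unfolding locally_integrable_def set_integrable_def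
      by (intro integrable_scaleR_right) simp
    show "(\<lambda>x. w x *\<^sub>R F x) \<in> borel_measurable lebesgue"
      by (intro borel_measurable_scaleR locally_integrable_borel_measurable[OF w]
          continuous_imp_borel_measurable_lebesgue[OF F])
    show "AE x in lebesgue. norm (w x *\<^sub>R F x) \<le> norm (B *\<^sub>R indicator K x *\<^sub>R w x)"
    proof (rule AE_I2)
      fix x
      show "norm (w x *\<^sub>R F x) \<le> norm (B *\<^sub>R indicator K x *\<^sub>R w x)"
      proof (cases "x \<in> K")
        case True
        have "norm (F x) * \<bar>w x\<bar> \<le> \<bar>B\<bar> * \<bar>w x\<bar>"
          using B[OF True] by (intro mult_right_mono) auto
        with True show ?thesis by (simp add: abs_mult mult.commute)
      qed (simp add: K(2))
    qed
  qed
qed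

lemma has_weak_gradient_lincomb:
  fixes u v :: "real ^ 'n \<Rightarrow> real"
  assumes u: "has_weak_gradient u g" and v: "has_weak_gradient v h"
  shows "has_weak_gradient (\<lambda>x. a * u x + b * v x) (\<lambda>x. a *\<^sub>R g x + b *\<^sub>R h x)"
  unfolding has_weak_gradient_def
proof (intro conjI allI impI)
  have li: "locally_integrable u" "locally_integrable v" "locally_integrable g" "locally_integrable h"
    using u v by (auto simp: has_weak_gradient_def)
  show "locally_integrable (\<lambda>x. a * u x + b * v x)"
    using locally_integrable_lincomb[OF li(1,2), of a b] by simp
  show "locally_integrable (\<lambda>x. a *\<^sub>R g x + b *\<^sub>R h x)"
    by (rule locally_integrable_lincomb[OF li(3,4)])
  fix \<phi> :: "real ^ 'n \<Rightarrow> real" and d\<phi>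
  assume \<phi>: "C1c_with_gradient \<phi> d\<phi>"
  have int: "integrable lebesgue (\<lambda>x. w x *\<^sub>R d\<phi> x)" if "locally_integrable w" for w
    by (rule integrable_scaleR_compact_support[OF that C1c_continuous(2,3)[OF \<phi>]])
       (rule C1c_outside(2)[OF \<phi>])
  have "(LINT x|lebesgue. (a * u x + b * v x) *\<^sub>R d\<phi> x) =
      a *\<^sub>R (LINT x|lebesgue. u x *\<^sub>R d\<phi> x) + b *\<^sub>R (LINT x|lebesgue. v x *\<^sub>R d\<phi> x)"
    using int[OF li(1)] int[OF li(2)] by (simp add: scaleR_add_left flip: scaleR_scaleR)
  also have "\<dots> = - (a *\<^sub>R (LINT x|lebesgue. \<phi> x *\<^sub>R g x) + b *\<^sub>R (LINT x|lebesgue. \<phi> x *\<^sub>R h x))"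
    using u v \<phi> by (simp add: has_weak_gradient_def)
  also have "a *\<^sub>R (LINT x|lebesgue. \<phi> x *\<^sub>R g x) + b *\<^sub>R (LINT x|lebesgue. \<phi> x *\<^sub>R h x)
      = (LINT x|lebesgue. a *\<^sub>R (\<phi> x *\<^sub>R g x) + b *\<^sub>R (\<phi> x *\<^sub>R h x))"
    using integrable_C1c[OF li(3) \<phi>] integrable_C1c[OF li(4) \<phi>]
    by (simp del: scaleR_scaleR)
  also have "(\<lambda>x. a *\<^sub>R (\<phi> x *\<^sub>R g x) + b *\<^sub>R (\<phi> x *\<^sub>R h x)) = (\<lambda>x. \<phi> x *\<^sub>R (a *\<^sub>R g x + b *\<^sub>R h x))"
    by (simp add: fun_eq_iff scaleR_add_right mult.commute)
  finally show "(LINT x|lebesgue. (a * u x + b * v x) *\<^sub>R d\<phi> x)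
      = - (LINT x|lebesgue. \<phi> x *\<^sub>R (a *\<^sub>R g x + b *\<^sub>R h x))" .
qed

text \<open>Tests the weak gradient with the components of the vector field \<open>\<lambda>x. \<eta> x *\<^sub>R (x - y)\<close>.\<close>

lemma integral_weak_divergence_radial:
  fixes u :: "real ^ 'n \<Rightarrow> real"
  assumes u: "has_weak_gradient u g" and \<eta>: "C1c_with_gradient \<eta> d\<eta>"
  shows "(LINT x|lebesgue. u x * (real CARD('n) * \<eta> x + (x - y) \<bullet> d\<eta> x))
       = - (LINT x|lebesgue. \<eta> x * ((x - y) \<bullet> g x))"
proof -
  have li: "locally_integrable u" "locally_integrable g"
    using u by (auto simp: has_weak_gradient_def)
  \<comment> \<open>\<open>?\<phi> b\<close> is the component of the field along the basis vector
    \<open>b\<close> and \<open>?d b\<close> its gradient. Summing the \<open>b\<close>-components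
    of \<open>?d b\<close> gives the divergence, in which each basis vector contributes one
    \<open>\<eta> x\<close>.\<close>
  let ?\<phi> = "\<lambda>b x. ((x - y) \<bullet> b) * \<eta> x"
  let ?d = "\<lambda>b x. ((x - y) \<bullet> b) *\<^sub>R d\<eta> x + \<eta> x *\<^sub>R b"
  have \<phi>: "C1c_with_gradient (?\<phi> b) (?d b)" for b
    by (rule C1c_mult[OF C1_inner_translate \<eta>])
  have int1: "integrable lebesgue (\<lambda>x. u x *\<^sub>R ?d b x)" for b
    by (rule integrable_scaleR_compact_support[OF li(1) C1c_continuous(2,3)[OF \<phi>]])
       (rule C1c_outside(2)[OF \<phi>])
  have int2: "integrable lebesgue (\<lambda>x. ?\<phi> b x *\<^sub>R g x)" for b
    by (rule integrable_C1c[OF li(2) \<phi>])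
  have rep: "(\<Sum>b\<in>Basis. ((x - y) \<bullet> b) * (z \<bullet> b)) = (x - y) \<bullet> z" for x z :: "real ^ 'n"
    by (rule euclidean_inner[symmetric])
  have "(LINT x|lebesgue. u x * (real CARD('n) * \<eta> x + (x - y) \<bullet> d\<eta> x))
      = (LINT x|lebesgue. (\<Sum>b\<in>Basis. (u x *\<^sub>R ?d b x) \<bullet> b))"
  proof (rule Bochner_Integration.integral_cong[OF refl])
    fix x
    have "(\<Sum>b\<in>Basis. (u x *\<^sub>R ?d b x) \<bullet> b) = u x * (\<Sum>b\<in>Basis. ?d b x \<bullet> b)"
      by (simp add: sum_distrib_left)
    also have "(\<Sum>b\<in>Basis. ?d b x \<bullet> b) = (\<Sum>b\<in>(Basis :: (real^'n) set). ((x - y) \<bullet> b) * (d\<eta> x \<bullet> b) + \<eta> x)"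
      by (intro sum.cong) (auto simp: inner_add_left inner_Basis)
    also have "\<dots> = (x - y) \<bullet> d\<eta> x + real CARD('n) * \<eta> x"
      by (simp add: sum.distrib rep)
    finally show "u x * (real CARD('n) * \<eta> x + (x - y) \<bullet> d\<eta> x) = (\<Sum>b\<in>Basis. (u x *\<^sub>R ?d b x) \<bullet> b)"
      by (simp add: add.commute)
  qed
  also have "\<dots> = (\<Sum>b\<in>Basis. (LINT x|lebesgue. u x *\<^sub>R ?d b x) \<bullet> b)"
    using int1 by (subst Bochner_Integration.integral_sum) (simp_all del: inner_scaleR_left)
  also have "\<dots> = (\<Sum>b\<in>Basis. (- (LINT x|lebesgue. ?\<phi> b x *\<^sub>R g x)) \<bullet> b)"
    using u \<phi> unfolding has_weak_gradient_def by (intro sum.cong refl arg_cong2[where f = inner]) blast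
  also have "\<dots> = - (\<Sum>b\<in>Basis. (LINT x|lebesgue. ?\<phi> b x *\<^sub>R g x) \<bullet> b)"
    by (simp add: sum_negf)
  also have "(\<Sum>b\<in>Basis. (LINT x|lebesgue. ?\<phi> b x *\<^sub>R g x) \<bullet> b)
      = (LINT x|lebesgue. (\<Sum>b\<in>Basis. (?\<phi> b x *\<^sub>R g x) \<bullet> b))"
    using int2 by (subst Bochner_Integration.integral_sum) (simp_all del: inner_scaleR_left)
  also have "\<dots> = (LINT x|lebesgue. \<eta> x * ((x - y) \<bullet> g x))"
  proof (rule Bochner_Integration.integral_cong[OF refl])
    fix x
    have "(\<Sum>b\<in>Basis. (?\<phi> b x *\<^sub>R g x) \<bullet> b) = \<eta> x * (\<Sum>b\<in>Basis. ((x - y) \<bullet> b) * (g x \<bullet> b))"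
      by (simp add: sum_distrib_left mult_ac)
    then show "(\<Sum>b\<in>Basis. (?\<phi> b x *\<^sub>R g x) \<bullet> b) = \<eta> x * ((x - y) \<bullet> g x)"
      using rep by simp
  qed
  finally show ?thesis .
qed

subsection \<open>Integrability of power decay\<close>

text \<open>Comparison with a sum over dyadic balls replaces polar coordinates: the volume grows by
  a factor \<open>2 ^ N\<close> per step and the bound decays by
  \<open>2 powr (- (s * q))\<close>.\<close>

lemma integrable_power_decay:
  fixes y :: "real ^ 'n"
  assumes a: "a > 0" and q: "q > 0" and s: "s * q > real CARD('n)"
  shows "integrable lebesgue (\<lambda>x. (a + norm (x - y) powr q) powr (- s))"
proof -
  let ?f = "\<lambda>x. (a + norm (x - y) powr q) powr (- s)"
  let ?N = "CARD('n)"
  have "s > 0"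
    using order_le_less_trans[OF of_nat_0_le_iff s] q by (simp add: zero_less_mult_iff)
  \<comment> \<open>\<open>c 0\<close> is the bound valid everywhere, and for positive k the number
    \<open>c k\<close> bounds the function at distance at least \<open>2 ^ (k - 1)\<close> from
    \<open>y\<close>. A point is charged to the smallest dyadic ball containing it, so the
    subtraction is used only for positive k.\<close>
  define c where "c k = (if k = 0 then a powr (- s) else (2 ^ (k - 1)) powr (- (s * q)))" for k :: nat
  have c0: "c k \<ge> 0" for k by (simp add: c_def)
  have dom: "ennreal (?f x) \<le> (\<Sum>k. ennreal (c k) * indicator (ball y (2 ^ k)) x)" for x
  proof -
    have "\<exists>k. ?f x \<le> c k \<and> x \<in> ball y (2 ^ k)"
    proof (cases "norm (x - y) < 1")
      case True
      have "?f x \<le> a powr (- s)"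
        using a \<open>s > 0\<close> by (intro powr_mono2') auto
      then show ?thesis
        using True by (intro exI[of _ 0]) (simp add: c_def dist_norm norm_minus_commute)
    next
      case False
      obtain n0 where n0: "norm (x - y) < 2 ^ n0"
        using real_arch_pow[of 2 "norm (x - y)"] by auto
      define n where "n = (LEAST n. norm (x - y) < 2 ^ n)"
      have n: "norm (x - y) < 2 ^ n"
        unfolding n_def by (rule LeastI[of _ n0]) (rule n0)
      have "n \<noteq> 0" using n False by (metis power_0)
      then have "\<not> norm (x - y) < 2 ^ (n - 1)"
        unfolding n_def by (intro not_less_Least) (simp add: n_def[symmetric])
      then have ge: "2 ^ (n - 1) \<le> norm (x - y)" by simp
      have "?f x \<le> (norm (x - y) powr q) powr (- s)"
        using a \<open>s > 0\<close> False by (intro powr_mono2') auto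
      also have "\<dots> = norm (x - y) powr (- (s * q))"
        by (simp add: powr_powr mult.commute)
      also have "\<dots> \<le> (2 ^ (n - 1)) powr (- (s * q))"
        using ge \<open>s > 0\<close> q by (intro powr_mono2') auto
      finally show ?thesis
        using n \<open>n \<noteq> 0\<close> by (intro exI[of _ n]) (simp add: c_def dist_norm norm_minus_commute)
    qed
    then obtain k where k: "?f x \<le> c k" "x \<in> ball y (2 ^ k)" by blast
    have "ennreal (?f x) \<le> ennreal (c k) * indicator (ball y (2 ^ k)) x"
      using k by (simp add: ennreal_leI)
    also have "\<dots> = (\<Sum>i\<in>{k}. ennreal (c i) * indicator (ball y (2 ^ i)) x)"
      by (simp only: sum.insert finite.emptyI empty_iff not_False_eq_True sum.empty add_0_right)
    also have "\<dots> \<le> (\<Sum>k. ennreal (c k) * indicator (ball y (2 ^ k)) x)"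
      by (rule sum_le_suminf) auto
    finally show ?thesis .
  qed
  have "(\<integral>\<^sup>+x. ennreal (?f x) \<partial>lborel) \<le> (\<integral>\<^sup>+x. (\<Sum>k. ennreal (c k) * indicator (ball y (2 ^ k)) x) \<partial>lborel)"
    by (rule nn_integral_mono) (rule dom)
  also have "\<dots> = (\<Sum>k. \<integral>\<^sup>+x. ennreal (c k) * indicator (ball y (2 ^ k)) x \<partial>lborel)"
    by (intro nn_integral_suminf borel_measurable_times_ennreal borel_measurable_indicator) auto
  also have "\<dots> = (\<Sum>k. ennreal (c k * (unit_ball_vol (real ?N) * (2 ^ k) ^ ?N)))"
    using c0 by (subst nn_integral_cmult_indicator) (simp_all add: emeasure_ball ennreal_mult)
  also have "\<dots> < \<infinity>"
  proof -
    \<comment> \<open>The ratio is below 1 precisely because \<open>s * q > N\<close>; the first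
      term of the original series is dropped and restored afterwards.\<close>
    have "summable (\<lambda>k. (2 powr (real ?N - s * q)) ^ k)"
      using s by (intro summable_geometric) (simp add: powr_less_one)
    then have "summable (\<lambda>k. (unit_ball_vol (real ?N) * 2 ^ ?N) * (2 powr (real ?N - s * q)) ^ k)"
      by (rule summable_mult)
    moreover have "(unit_ball_vol (real ?N) * 2 ^ ?N) * (2 powr (real ?N - s * q)) ^ k
        = c (Suc k) * (unit_ball_vol (real ?N) * (2 ^ Suc k) ^ ?N)" for k
    proof -
      have "c (Suc k) = 2 powr (- (s * q) * real k)"
        by (simp add: c_def powr_powr mult.commute flip: powr_realpow)
      moreover have "(2 ^ Suc k :: real) ^ ?N = 2 ^ ?N * 2 powr (real ?N * real k)"
        by (simp add: power_mult_distrib powr_realpow power_mult[symmetric] mult.commute flip: of_nat_mult)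
      moreover have "(2 powr (real ?N - s * q)) ^ k = 2 powr (- (s * q) * real k) * 2 powr (real ?N * real k)"
        by (simp add: powr_powr powr_add[symmetric] algebra_simps flip: powr_realpow)
      ultimately show ?thesis by simp
    qed
    ultimately have "summable (\<lambda>k. c (Suc k) * (unit_ball_vol (real ?N) * (2 ^ Suc k) ^ ?N))"
      by simp
    then have "summable (\<lambda>k. c k * (unit_ball_vol (real ?N) * (2 ^ k) ^ ?N))"
      by (rule summable_Suc_iff[THEN iffD1])
    then have "(\<Sum>k. ennreal (c k * (unit_ball_vol (real ?N) * (2 ^ k) ^ ?N))) \<noteq> top"
      using c0 by (intro ennreal_suminf_neq_top) auto
    then show ?thesis by (simp add: less_top)
  qed
  finally have "integrable lborel ?f"
    by (intro integrableI_nonneg) auto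
  then show ?thesis
    by (subst integrable_completion) auto
qed

subsection \<open>Powers of the norm\<close>

text \<open>At \<open>r = 0\<close> both sides are 0 whatever the exponent, because
  \<open>0 powr a = 0\<close>. The singular weight \<open>r powr (q - 2)\<close> with
  \<open>q < 2\<close> therefore needs no separate treatment.\<close>

lemma powr_diff_two_mult:
  fixes r :: real
  assumes "r \<ge> 0"
  shows "r powr (q - 2) * r = r powr (q - 1)" "r powr (q - 2) * r\<^sup>2 = r powr q"
proof -
  have "r powr (q - 1) = r powr (q - 2) * r" "r powr q = r powr (q - 2) * r\<^sup>2" if "r > 0"
  proof -
    have "r powr (q - 2) * r powr 1 = r powr (q - 1)" "r powr (q - 2) * r powr 2 = r powr q"
      unfolding powr_add[symmetric] by simp_all
    then show "r powr (q - 1) = r powr (q - 2) * r" "r powr q = r powr (q - 2) * r\<^sup>2"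
      using that by (simp_all add: powr_numeral)
  qed
  with assms show "r powr (q - 2) * r = r powr (q - 1)" "r powr (q - 2) * r\<^sup>2 = r powr q"
    by (cases "r = 0"; simp)+
qed

lemma tendsto_norm_powr_zero:
  fixes c :: real
  assumes "c > 0"
  shows "((\<lambda>z. norm z powr c) \<longlongrightarrow> 0) (at (0 :: 'a::real_normed_vector))"
proof -
  have "((\<lambda>z::'a. norm z powr c) \<longlongrightarrow> 0 powr c) (at 0)"
    using assms by (intro tendsto_powr' tendsto_norm_zero tendsto_const tendsto_ident_at) auto
  then show ?thesis by simp
qed

text \<open>Away from 0 this is the chain rule. At 0 the factor \<open>z\<close> makes the formula
  give 0, and the difference quotient \<open>norm h powr (q - 1)\<close> tends to 0 since
  \<open>q > 1\<close>.\<close>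

lemma GDERIV_norm_powr:
  fixes z :: "'a::real_inner"
  assumes q: "q > 1"
  shows "GDERIV (\<lambda>z. norm z powr q) z :> (q * norm z powr (q - 2)) *\<^sub>R z"
proof (cases "z = 0")
  case True
  have "((\<lambda>z::'a. norm z powr q) has_derivative (\<lambda>h. 0)) (at 0)"
    unfolding has_derivative_at
  proof (intro conjI bounded_linear_zero)
    have eq: "norm (norm (0 + h) powr q - norm (0::'a) powr q - 0) / norm h = norm h powr (q - 1)" for h :: 'a
      by (cases "h = 0") (simp_all add: powr_diff)
    show "(\<lambda>h::'a. norm (norm (0 + h) powr q - norm (0::'a) powr q - 0) / norm h) \<midarrow>0\<rightarrow> 0"
      unfolding eq using q by (intro tendsto_norm_powr_zero) simp
  qed
  then show ?thesis
    using True by (simp add: gderiv_def)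
next
  case False
  then have "GDERIV (\<lambda>z. norm z powr q) z :> (q * norm z powr (q - 1)) *\<^sub>R sgn z"
    by (intro GDERIV_DERIV_compose GDERIV_norm has_real_derivative_powr) auto
  moreover have "(q * norm z powr (q - 1)) *\<^sub>R sgn z = (q * norm z powr (q - 2)) *\<^sub>R z"
    using False powr_diff_two_mult(1)[of "norm z" q, symmetric] by (simp add: sgn_div_norm)
  ultimately show ?thesis by simp
qed

text \<open>The vector has norm \<open>norm (f x) powr (q - 1)\<close>, which controls it near the
  zeros of \<open>f\<close> even when \<open>q < 2\<close>.\<close>

lemma continuous_on_norm_powr_scaleR:
  fixes f :: "'b::topological_space \<Rightarrow> 'a::real_normed_vector"
  assumes q: "q > 1" and f: "continuous_on S f"
  shows "continuous_on S (\<lambda>x. norm (f x) powr (q - 2) *\<^sub>R f x)"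
proof -
  have "isCont (\<lambda>z::'a. norm z powr (q - 2) *\<^sub>R z) z" for z
  proof (cases "z = 0")
    case True
    have "(\<lambda>z::'a. norm z powr (q - 2) *\<^sub>R z) \<midarrow>0\<rightarrow> 0"
      by (rule Lim_null_comparison[OF _ tendsto_norm_powr_zero[of "q - 1"]])
         (use q in \<open>auto simp: powr_diff_two_mult\<close>)
    with True show ?thesis by (simp add: isCont_def)
  next
    case False
    then show ?thesis
      unfolding isCont_def
      by (intro tendsto_scaleR tendsto_powr tendsto_norm tendsto_ident_at tendsto_const) auto
  qed
  then have "continuous_on UNIV (\<lambda>z::'a. norm z powr (q - 2) *\<^sub>R z)"
    by (simp add: continuous_at_imp_continuous_on)
  from continuous_on_compose2[OF this f] show ?thesis by simp
qed

text \<open>Replacing the smaller base by the larger one gives a crude form of Young's inequality,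
  which is enough for integrability.\<close>

lemma powr_mult_le_add:
  fixes a b :: real
  assumes "a \<ge> 0" "b \<ge> 0" "\<theta> \<ge> 0" "\<eta> \<ge> 0"
  shows "a powr \<theta> * b powr \<eta> \<le> a powr (\<theta> + \<eta>) + b powr (\<theta> + \<eta>)"
proof (cases "a \<le> b")
  case True
  then have "a powr \<theta> * b powr \<eta> \<le> b powr \<theta> * b powr \<eta>"
    using assms by (intro mult_right_mono powr_mono2) auto
  then show ?thesis by (simp add: powr_add add_increasing)
next
  case False
  then have "a powr \<theta> * b powr \<eta> \<le> a powr \<theta> * a powr \<eta>"
    using assms by (intro mult_left_mono powr_mono2) auto
  then show ?thesis by (simp add: powr_add add_increasing2)
qed

lemma integrable_powr_mult:
  fixes f g :: "'a \<Rightarrow> real"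
  assumes [measurable]: "f \<in> borel_measurable M" "g \<in> borel_measurable M"
    and "integrable M (\<lambda>x. \<bar>f x\<bar> powr m)" "integrable M (\<lambda>x. \<bar>g x\<bar> powr m)"
    and "\<theta> \<ge> 0" "\<eta> \<ge> 0" "\<theta> + \<eta> = m"
  shows "integrable M (\<lambda>x. \<bar>f x\<bar> powr \<theta> * \<bar>g x\<bar> powr \<eta>)"
proof (rule Bochner_Integration.integrable_bound)
  show "integrable M (\<lambda>x. \<bar>f x\<bar> powr m + \<bar>g x\<bar> powr m)"
    using assms by simp
  show "AE x in M. norm (\<bar>f x\<bar> powr \<theta> * \<bar>g x\<bar> powr \<eta>) \<le> norm (\<bar>f x\<bar> powr m + \<bar>g x\<bar> powr m)"
    using powr_mult_le_add[of "\<bar>f _\<bar>" "\<bar>g _\<bar>" \<theta> \<eta>] assms(5-7) by (simp add: abs_mult)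
qed simp

subsection \<open>Radial profiles\<close>

text \<open>One family covers all radial functions needed: up to constants the bubble has
  \<open>s = (N - p) / p\<close>, its flux coefficient has \<open>s = N / q\<close>, and the
  divergence of the flux has \<open>s = N / q + 1\<close>.\<close>

definition profile :: "real \<Rightarrow> real \<Rightarrow> real \<Rightarrow> real ^ 'n \<Rightarrow> real ^ 'n \<Rightarrow> real" where
  "profile a q s y x = (a + norm (x - y) powr q) powr (- s)"

definition profile_grad :: "real \<Rightarrow> real \<Rightarrow> real \<Rightarrow> real ^ 'n \<Rightarrow> real ^ 'n \<Rightarrow> real ^ 'n" where
  "profile_grad a q s y x = - (s * q * profile a q (s + 1) y x * norm (x - y) powr (q - 2)) *\<^sub>R (x - y)"

lemma profile_base_pos: "a > 0 \<Longrightarrow> a + norm (x - y) powr q > 0"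
  by (simp add: add_pos_nonneg)

lemma profile_pos: "a > 0 \<Longrightarrow> profile a q s y x > 0"
  using profile_base_pos[of a x y q] by (simp add: profile_def)

lemma C1_profile:
  assumes a: "a > 0" and q: "q > 1"
  shows "C1_with_gradient (profile a q s y) (profile_grad a q s y)"
proof -
  let ?r = "\<lambda>x. norm (x - y) powr q"
  let ?d = "\<lambda>x. (q * norm (x - y) powr (q - 2)) *\<^sub>R (x - y)"
  have r: "C1_with_gradient ?r ?d"
    unfolding C1_with_gradient_def
  proof
    show "\<forall>x. GDERIV ?r x :> ?d x"
    proof
      fix x
      have "((\<lambda>z. norm z powr q) has_derivative (\<lambda>h. h \<bullet> ?d x)) (at (x - y))"
        using GDERIV_norm_powr[OF q, of "x - y"] unfolding gderiv_def .
      then show "GDERIV ?r x :> ?d x"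
        unfolding gderiv_def
        using has_derivative_compose[of "\<lambda>x. x - y" "\<lambda>h. h" x UNIV "\<lambda>z. norm z powr q"]
          has_derivative_diff[OF has_derivative_ident has_derivative_const[of y]] by simp
    qed
    show "continuous_on UNIV ?d"
      using continuous_on_scaleR[OF continuous_on_const continuous_on_norm_powr_scaleR[OF q], of UNIV "\<lambda>x. x - y" q]
      by (simp add: continuous_on_diff continuous_on_id)
  qed
  have "C1_with_gradient (\<lambda>x. (a + ?r x) powr (- s)) (\<lambda>x. (- s * (a + ?r x) powr (- s - 1)) *\<^sub>R ?d x)"
  proof (rule C1_compose[OF r])
    show "((\<lambda>t. (a + t) powr - s) has_real_derivative - s * (a + ?r x) powr (- s - 1)) (at (?r x))" for x
      using profile_base_pos[OF a, of x y q] by (auto intro!: derivative_eq_intros)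
    show "continuous_on (range ?r) (\<lambda>t. - s * (a + t) powr (- s - 1))"
      using profile_base_pos[OF a, of _ y q] by (auto intro!: continuous_intros simp: less_imp_neq[THEN not_sym])
  qed
  moreover have "(- s * (a + ?r x) powr (- s - 1)) *\<^sub>R ?d x = profile_grad a q s y x" for x
  proof -
    have e: "- (s + 1) = - s - 1" by simp
    show ?thesis unfolding profile_grad_def profile_def e by (simp add: mult_ac)
  qed
  ultimately show ?thesis
    by (simp add: profile_def[abs_def])
qed

lemma profile_grad_radial: "(x - y) \<bullet> profile_grad a q s y x = - (s * q * profile a q (s + 1) y x * norm (x - y) powr q)"
  using powr_diff_two_mult(2)[of "norm (x - y)" q]
  by (simp add: profile_grad_def flip: power2_norm_eq_inner)

lemma norm_profile_grad:
  assumes "s \<ge> 0" "q \<ge> 0"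
  shows "norm (profile_grad a q s y x) = s * q * profile a q (s + 1) y x * norm (x - y) powr (q - 1)"
  using powr_diff_two_mult(1)[of "norm (x - y)" q] assms
  by (simp add: profile_grad_def abs_mult profile_def)

lemma profile_powr: "profile a q s y x powr t = profile a q (s * t) y x"
  by (simp add: profile_def powr_powr)

lemma profile_mult_base:
  assumes "a > 0"
  shows "profile a q (s + 1) y x * (a + norm (x - y) powr q) = profile a q s y x"
proof -
  have "profile a q (s + 1) y x * (a + norm (x - y) powr q) powr 1 = profile a q s y x"
    unfolding profile_def powr_add[symmetric] by simp
  then show ?thesis using profile_base_pos[OF assms, of x y q] by simp
qed

text \<open>Both bounds come from dropping one summand of the base: a factor
  \<open>norm (x - y) powr q\<close> or \<open>a\<close> is traded for one unit of the
  exponent.\<close>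

lemma profile_mult_norm_powr_le:
  assumes "a > 0"
  shows "profile a q (s + 1) y x * norm (x - y) powr q \<le> profile a q s y x"
    "profile a q (s + 1) y x * a \<le> profile a q s y x"
  using profile_mult_base[OF assms, of q s y x] profile_pos[OF assms, of q "s + 1" y x]
  by (auto simp flip: profile_mult_base[OF assms, of q s y x] intro!: mult_left_mono)
     (use assms in auto)

lemma profile_measurable:
  assumes "a > 0" "q > 1"
  shows "profile a q s y \<in> borel_measurable lebesgue"
  by (rule continuous_imp_borel_measurable_lebesgue, rule C1_continuous_on, rule C1_profile[OF assms])

lemma integrable_profile:
  fixes y :: "real ^ 'n"
  assumes "a > 0" "q > 0" "s * q > real CARD('n)"
  shows "integrable lebesgue (profile a q s y)"
  using integrable_power_decay[OF assms, of y] by (simp add: profile_def[abs_def])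

text \<open>The gradient has size of order 1 / R on a ball of radius R, so its radial component is
  bounded independently of R. This makes domination possible as R tends to infinity.\<close>

lemma cutoff_grad_radial:
  assumes "R > 0"
  shows "\<bar>(x - y) \<bullet> cutoff_grad y R x\<bar> \<le> 4"
proof -
  have "norm (x - y) ^ 2 / R ^ 2 * max 0 (1 - norm (x - y) ^ 2 / R ^ 2) \<le> 1"
  proof (cases "norm (x - y) ^ 2 / R ^ 2 \<le> 1")
    case True
    then show ?thesis by (intro mult_le_one) auto
  next
    case False
    then show ?thesis by (simp add: max_def)
  qed
  moreover have "\<bar>(x - y) \<bullet> cutoff_grad y R x\<bar> = 4 * (norm (x - y) ^ 2 / R ^ 2 * max 0 (1 - norm (x - y) ^ 2 / R ^ 2))"
    by (simp add: cutoff_grad_def abs_mult mult_ac flip: power2_norm_eq_inner)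
  ultimately show ?thesis by linarith
qed

lemma cutoff_tendsto:
  shows "(\<lambda>n. cutoff y (real (Suc n)) x) \<longlonglongrightarrow> 1"
    and "(\<lambda>n. (x - y) \<bullet> cutoff_grad y (real (Suc n)) x) \<longlonglongrightarrow> 0"
proof -
  have inv: "(\<lambda>n. inverse (real (Suc n))) \<longlonglongrightarrow> 0"
    by (rule LIMSEQ_inverse_real_of_nat)
  have lim: "(\<lambda>n. max 0 (1 - (norm (x - y))\<^sup>2 * (inverse (real (Suc n)))\<^sup>2)) \<longlonglongrightarrow> max 0 (1 - (norm (x - y))\<^sup>2 * 0\<^sup>2)"
    by (intro tendsto_intros inv)
  from tendsto_power[OF lim, of 2] show "(\<lambda>n. cutoff y (real (Suc n)) x) \<longlonglongrightarrow> 1"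
    by (simp add: cutoff_def divide_inverse power_inverse del: of_nat_Suc)
  have "(\<lambda>n. (- 4 * (inverse (real (Suc n)))\<^sup>2 * max 0 (1 - (norm (x - y))\<^sup>2 * (inverse (real (Suc n)))\<^sup>2)) * ((x - y) \<bullet> (x - y)))
      \<longlonglongrightarrow> (- 4 * 0\<^sup>2 * max 0 (1 - (norm (x - y))\<^sup>2 * 0\<^sup>2)) * ((x - y) \<bullet> (x - y))"
    by (intro tendsto_intros inv lim)
  then show "(\<lambda>n. (x - y) \<bullet> cutoff_grad y (real (Suc n)) x) \<longlonglongrightarrow> 0"
    by (simp add: cutoff_grad_def divide_inverse power_inverse del: of_nat_Suc)
qed

text \<open>The field \<open>profile a q (N / q) y x *\<^sub>R (x - y)\<close> is cut off by
  \<open>?\<chi> n\<close> and the radius tends to infinity. Both sides converge by domination, the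
  left through the integrability of \<open>u\<close> and the right through that of
  \<open>g\<close>.\<close>

lemma profile_weak_divergence:
  fixes y :: "real ^ 'n" and u :: "real ^ 'n \<Rightarrow> real"
  defines "N \<equiv> real CARD('n)"
  assumes a: "a > 0" and p: "p > 1" "p < N" and q: "q = p / (p - 1)" and ps: "ps > 1"
    and u: "has_weak_gradient u g" "in_Lp ps u" "in_Lp p (\<lambda>x. norm (g x))"
  shows "(LINT x|lebesgue. u x * (N * a * profile a q (N / q + 1) y x))
       = - (LINT x|lebesgue. profile a q (N / q) y x * ((x - y) \<bullet> g x))"
proof -
  have N: "N > 1" using p by simp
  have q1: "q > 1" using p by (simp add: q)
  have q2: "(N - 1) * q > N" using p by (simp add: q field_simps)
  let ?w = "profile a q (N / q) y"
  let ?\<chi> = "\<lambda>n. cutoff y (real (Suc n))"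
  let ?d\<chi> = "\<lambda>n. cutoff_grad y (real (Suc n))"
  have w: "?w x > 0" for x using profile_pos[OF a] .
  have mw [measurable]: "?w \<in> borel_measurable lebesgue" using profile_measurable[OF a q1] .
  have mu [measurable]: "u \<in> borel_measurable lebesgue" using u(2) by (simp add: in_Lp_def)
  have mg [measurable]: "g \<in> borel_measurable lebesgue"
    using u(1) by (auto simp: has_weak_gradient_def intro: locally_integrable_borel_measurable)
  have mid [measurable]: "(\<lambda>x. x - y) \<in> borel_measurable lebesgue"
    by (intro continuous_imp_borel_measurable_lebesgue continuous_intros)
  have C1c: "C1c_with_gradient (?\<chi> n) (?d\<chi> n)" for n by (rule C1c_cutoff) simp
  have m\<chi> [measurable]: "?\<chi> n \<in> borel_measurable lebesgue" "?d\<chi> n \<in> borel_measurable lebesgue" for n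
    using C1c_continuous(1,2)[OF C1c] by (auto intro: continuous_imp_borel_measurable_lebesgue)
  \<comment> \<open>The exponent \<open>N / q\<close> is chosen so that the terms with
    \<open>norm (x - y) powr q\<close> cancel in the divergence; only the part carrying
    \<open>a\<close> survives.\<close>
  have key: "N * ?w x + (x - y) \<bullet> profile_grad a q (N / q) y x = N * a * profile a q (N / q + 1) y x" for x
    using q1 unfolding profile_grad_radial profile_mult_base[OF a, of q "N / q" y x, symmetric]
    by (simp add: algebra_simps)
  have id: "(LINT x|lebesgue. u x * (?\<chi> n x * (N * a * profile a q (N / q + 1) y x) + ?w x * ((x - y) \<bullet> ?d\<chi> n x)))
      = - (LINT x|lebesgue. ?w x * ?\<chi> n x * ((x - y) \<bullet> g x))" for n
  proof -
    have "(LINT x|lebesgue. u x * (N * (?w x * ?\<chi> n x) + (x - y) \<bullet> (?w x *\<^sub>R ?d\<chi> n x + ?\<chi> n x *\<^sub>R profile_grad a q (N / q) y x)))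
        = - (LINT x|lebesgue. ?w x * ?\<chi> n x * ((x - y) \<bullet> g x))"
      unfolding N_def
      by (rule integral_weak_divergence_radial[OF u(1) C1c_mult[OF C1_profile[OF a q1] C1c]])
    moreover have "N * (?w x * ?\<chi> n x) + (x - y) \<bullet> (?w x *\<^sub>R ?d\<chi> n x + ?\<chi> n x *\<^sub>R profile_grad a q (N / q) y x)
        = ?\<chi> n x * (N * a * profile a q (N / q + 1) y x) + ?w x * ((x - y) \<bullet> ?d\<chi> n x)" for x
      unfolding key[symmetric] by (simp add: inner_add_right algebra_simps)
    ultimately show ?thesis by simp
  qed
  \<comment> \<open>The root \<open>?W\<close> of \<open>?w\<close> satisfies
    \<open>?w = ?W powr (ps - 1)\<close> and lies in the same Lebesgue space as \<open>u\<close>,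
    because it decays with \<open>N * ps / (ps - 1) > N\<close> after raising to the power
    \<open>ps\<close>.\<close>
  have uw: "integrable lebesgue (\<lambda>x. \<bar>u x\<bar> * ?w x)"
  proof -
    let ?W = "profile a q (N / q / (ps - 1)) y"
    have "integrable lebesgue (profile a q (N / q / (ps - 1) * ps) y)"
    proof (rule integrable_profile[OF a])
      show "real CARD('n) < N / q / (ps - 1) * ps * q"
        using ps q1 N unfolding N_def[symmetric] by (simp add: field_simps)
    qed (use q1 in simp)
    then have "integrable lebesgue (\<lambda>x. \<bar>?W x\<bar> powr ps)"
      by (simp add: profile_powr abs_of_pos[OF profile_pos[OF a]])
    then have "integrable lebesgue (\<lambda>x. \<bar>u x\<bar> powr 1 * \<bar>?W x\<bar> powr (ps - 1))"
      using u(2) ps profile_measurable[OF a q1]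
      by (intro integrable_powr_mult[where m = ps]) (auto simp: in_Lp_def)
    then show ?thesis
      using ps by (simp add: profile_powr abs_of_pos[OF profile_pos[OF a]])
  qed
  \<comment> \<open>The same device: \<open>?w x * norm (x - y) = ?V x powr (p - 1)\<close>, and
    \<open>?V powr p\<close> is at most the profile of exponent \<open>N - 1\<close>, integrable
    since \<open>p < N\<close> gives \<open>(N - 1) * q > N\<close>.\<close>
  have wg: "integrable lebesgue (\<lambda>x. ?w x * norm (x - y) * norm (g x))"
  proof -
    let ?V = "\<lambda>x. (?w x * norm (x - y)) powr (1 / (p - 1))"
    have V: "?V x powr p = profile a q N y x * norm (x - y) powr q" for x
    proof -
      have "?V x powr p = (?w x * norm (x - y)) powr q"
        by (simp add: powr_powr q)
      also have "\<dots> = ?w x powr q * norm (x - y) powr q"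
        by (rule powr_mult)
      finally show ?thesis using q1 by (simp add: profile_powr)
    qed
    have "integrable lebesgue (\<lambda>x. \<bar>?V x\<bar> powr p)"
    proof (rule Bochner_Integration.integrable_bound)
      show "integrable lebesgue (profile a q (N - 1) y)"
        by (rule integrable_profile[OF a]) (use q1 q2 in \<open>auto simp: N_def\<close>)
      show "(\<lambda>x. \<bar>?V x\<bar> powr p) \<in> borel_measurable lebesgue" by measurable
      show "AE x in lebesgue. norm (\<bar>?V x\<bar> powr p) \<le> norm (profile a q (N - 1) y x)"
        using profile_mult_norm_powr_le(1)[OF a, of q "N - 1" y] profile_pos[OF a, of q "N - 1" y]
        by (simp add: V abs_mult abs_of_pos[OF profile_pos[OF a]])
    qed
    then have "integrable lebesgue (\<lambda>x. \<bar>?V x\<bar> powr (p - 1) * \<bar>norm (g x)\<bar> powr 1)"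
      using u(3) p by (intro integrable_powr_mult[where m = p]) (auto simp: in_Lp_def)
    moreover have "\<bar>?V x\<bar> powr (p - 1) * \<bar>norm (g x)\<bar> powr 1 = ?w x * norm (x - y) * norm (g x)" for x
      using p w[of x] by (simp add: powr_powr)
    ultimately show ?thesis by (simp only:)
  qed
  have "(\<lambda>n. LINT x|lebesgue. u x * (?\<chi> n x * (N * a * profile a q (N / q + 1) y x) + ?w x * ((x - y) \<bullet> ?d\<chi> n x)))
     \<longlonglongrightarrow> (LINT x|lebesgue. u x * (1 * (N * a * profile a q (N / q + 1) y x) + ?w x * 0))"
  proof (rule integral_dominated_convergence)
    have [measurable]: "profile a q (N / q + 1) y \<in> borel_measurable lebesgue" using profile_measurable[OF a q1] .
    show "(\<lambda>x. u x * (1 * (N * a * profile a q (N / q + 1) y x) + ?w x * 0)) \<in> borel_measurable lebesgue"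
      by measurable
    show "(\<lambda>x. u x * (?\<chi> n x * (N * a * profile a q (N / q + 1) y x) + ?w x * ((x - y) \<bullet> ?d\<chi> n x))) \<in> borel_measurable lebesgue" for n
      by measurable
    \<comment> \<open>\<open>N\<close> accounts for the divergence of the field and 4 for the
      uniform bound on the radial derivative of the cutoff.\<close>
    show "integrable lebesgue (\<lambda>x. (N + 4) * (\<bar>u x\<bar> * ?w x))"
      using uw by simp
    show "AE x in lebesgue. (\<lambda>n. u x * (?\<chi> n x * (N * a * profile a q (N / q + 1) y x) + ?w x * ((x - y) \<bullet> ?d\<chi> n x)))
        \<longlonglongrightarrow> u x * (1 * (N * a * profile a q (N / q + 1) y x) + ?w x * 0)"
      by (intro AE_I2 tendsto_intros cutoff_tendsto)
    show "AE x in lebesgue. norm (u x * (?\<chi> n x * (N * a * profile a q (N / q + 1) y x) + ?w x * ((x - y) \<bullet> ?d\<chi> n x)))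
        \<le> (N + 4) * (\<bar>u x\<bar> * ?w x)" for n
    proof (rule AE_I2)
      fix x
      let ?A = "N * a * profile a q (N / q + 1) y x"
      have A: "0 \<le> ?A" "?A \<le> N * ?w x"
        using profile_mult_norm_powr_le(2)[OF a, of q "N / q" y x] profile_pos[OF a, of q "N / q + 1" y x] a N
        by (auto simp: mult_ac)
      have "\<bar>?\<chi> n x * ?A\<bar> \<le> 1 * (N * ?w x)"
      proof -
        have "\<bar>c * t\<bar> \<le> 1 * b" if "0 \<le> c" "c \<le> 1" "0 \<le> t" "t \<le> b" for c t b :: real
          using mult_mono[OF that(2,4)] that by simp
        from this[OF cutoff_bounds A] show ?thesis .
      qed
      moreover have "\<bar>?w x * ((x - y) \<bullet> ?d\<chi> n x)\<bar> \<le> ?w x * 4"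
        unfolding abs_mult using w[of x] cutoff_grad_radial[of "real (Suc n)" x y] by (intro mult_mono) auto
      ultimately have "\<bar>?\<chi> n x * ?A + ?w x * ((x - y) \<bullet> ?d\<chi> n x)\<bar> \<le> (N + 4) * ?w x"
        by (simp add: algebra_simps)
      then have "\<bar>u x\<bar> * \<bar>?\<chi> n x * ?A + ?w x * ((x - y) \<bullet> ?d\<chi> n x)\<bar> \<le> \<bar>u x\<bar> * ((N + 4) * ?w x)"
        by (rule mult_left_mono) simp
      then show "norm (u x * (?\<chi> n x * ?A + ?w x * ((x - y) \<bullet> ?d\<chi> n x))) \<le> (N + 4) * (\<bar>u x\<bar> * ?w x)"
        by (simp add: abs_mult mult_ac)
    qed
  qed
  moreover have "(\<lambda>n. - (LINT x|lebesgue. ?w x * ?\<chi> n x * ((x - y) \<bullet> g x))) \<longlonglongrightarrow>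
      - (LINT x|lebesgue. ?w x * 1 * ((x - y) \<bullet> g x))"
  proof (intro tendsto_minus integral_dominated_convergence)
    show "(\<lambda>x. ?w x * 1 * ((x - y) \<bullet> g x)) \<in> borel_measurable lebesgue" by measurable
    show "(\<lambda>x. ?w x * ?\<chi> n x * ((x - y) \<bullet> g x)) \<in> borel_measurable lebesgue" for n by measurable
    show "integrable lebesgue (\<lambda>x. ?w x * norm (x - y) * norm (g x))" by (rule wg)
    show "AE x in lebesgue. (\<lambda>n. ?w x * ?\<chi> n x * ((x - y) \<bullet> g x)) \<longlonglongrightarrow> ?w x * 1 * ((x - y) \<bullet> g x)"
      by (intro AE_I2 tendsto_intros cutoff_tendsto)
    show "AE x in lebesgue. norm (?w x * ?\<chi> n x * ((x - y) \<bullet> g x)) \<le> ?w x * norm (x - y) * norm (g x)" for n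
    proof (rule AE_I2)
      fix x
      have "\<bar>?w x * ?\<chi> n x\<bar> * \<bar>(x - y) \<bullet> g x\<bar> \<le> ?w x * (norm (x - y) * norm (g x))"
      proof (intro mult_mono Cauchy_Schwarz_ineq2)
        show "\<bar>?w x * ?\<chi> n x\<bar> \<le> ?w x"
          using cutoff_bounds[of y "real (Suc n)" x] w[of x] by (simp add: abs_mult mult_left_le)
      qed (use w[of x] in auto)
      then show "norm (?w x * ?\<chi> n x * ((x - y) \<bullet> g x)) \<le> ?w x * norm (x - y) * norm (g x)"
        by (simp add: abs_mult mult_ac)
    qed
  qed
  ultimately show ?thesis
    unfolding id by (auto dest: LIMSEQ_unique)
qed

subsection \<open>The bubble\<close>

text \<open>These are the factors of the bubble that do not depend on x: the normalising constant
  and the power of \<open>\<epsilon>\<close> from the numerator.\<close>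

definition bubble_const :: "real \<Rightarrow> real \<Rightarrow> real \<Rightarrow> real" where
  "bubble_const N p \<epsilon> =
     (N * ((N - p) / (p - 1)) powr (p - 1)) powr ((N - p) / p\<^sup>2) * \<epsilon> powr ((N - p) / (p * (p - 1)))"

definition bubble_grad :: "real \<Rightarrow> real \<Rightarrow> real ^ 'n \<Rightarrow> real ^ 'n \<Rightarrow> real ^ 'n" where
  "bubble_grad p \<epsilon> y x = bubble_const (real CARD('n)) p \<epsilon> *\<^sub>R
     profile_grad (\<epsilon> powr (p / (p - 1))) (p / (p - 1)) ((real CARD('n) - p) / p) y x"

context
  fixes p \<epsilon> :: real and y :: "real ^ 'n" and N ps q s a K :: real
  assumes p: "1 < p" "p < N" and \<epsilon>: "\<epsilon> > 0"
    and N: "N = real CARD('n)" and ps: "ps = crit_exp N p"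
    and q: "q = p / (p - 1)" and s: "s = (N - p) / p" and a: "a = \<epsilon> powr q"
    and K: "K = bubble_const N p \<epsilon>"
begin

private lemma parameters: "a > 0" "q > 1" "s > 0" "K > 0" "ps > p" "N > 1" "(N - 1) * q > N" "N * q > N"
proof -
  show "a > 0" using \<epsilon> by (simp add: a)
  show "q > 1" "s > 0" using p by (auto simp: q s)
  then show "N * q > N" using p by simp
  show "K > 0" using p \<epsilon> by (simp add: K bubble_const_def)
  show "ps > p" "(N - 1) * q > N" "N > 1"
    using p by (auto simp: ps crit_exp_def q field_simps)
qed

lemma bubble_eq_profile: "bubble p \<epsilon> y x = K * profile a q s y x"
proof -
  have "(\<epsilon> powr (1 / (p - 1)) / (\<epsilon> powr q + norm (x - y) powr q)) powr s
      = (\<epsilon> powr (1 / (p - 1))) powr s / (\<epsilon> powr q + norm (x - y) powr q) powr s"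
    by (rule powr_divide)
  also have "(\<epsilon> powr (1 / (p - 1))) powr s = \<epsilon> powr ((N - p) / (p * (p - 1)))"
    using p by (simp add: powr_powr s field_simps)
  finally show ?thesis
    by (simp add: bubble_def Let_def profile_def powr_minus_divide a K bubble_const_def flip: q s N)
qed

lemma bubble_grad_eq_profile: "bubble_grad p \<epsilon> y x = K *\<^sub>R profile_grad a q s y x"
  by (simp add: bubble_grad_def a K flip: q s N)

lemma bubble_pos: "bubble p \<epsilon> y x > 0"
  using parameters profile_pos[of a q s y x] by (simp add: bubble_eq_profile)

lemma C1_bubble: "C1_with_gradient (bubble p \<epsilon> y) (bubble_grad p \<epsilon> y)"
proof -
  have "C1_with_gradient (\<lambda>x. K * profile a q s y x) (\<lambda>x. K *\<^sub>R profile_grad a q s y x)"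
    by (rule C1_compose[OF C1_profile]) (use parameters in \<open>auto intro!: derivative_eq_intros\<close>)
  then show ?thesis
    by (simp add: bubble_eq_profile[abs_def] bubble_grad_eq_profile[abs_def])
qed

lemma bubble_in_Lp: "in_Lp ps (bubble p \<epsilon> y)"
  unfolding in_Lp_def
proof
  have "s * ps = N" using p by (simp add: s ps crit_exp_def)
  then have "\<bar>bubble p \<epsilon> y x\<bar> powr ps = K powr ps * profile a q N y x" for x
    using parameters profile_pos[of a q s y x] by (simp add: bubble_eq_profile powr_mult profile_powr)
  moreover have "integrable lebesgue (profile a q N y)"
    by (rule integrable_profile) (use parameters N in auto)
  ultimately show "integrable lebesgue (\<lambda>x. \<bar>bubble p \<epsilon> y x\<bar> powr ps)"
    by simp
qed (rule continuous_imp_borel_measurable_lebesgue, rule C1_continuous_on, rule C1_bubble)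

lemma norm_bubble_grad: "norm (bubble_grad p \<epsilon> y x) = K * s * q * profile a q (s + 1) y x * norm (x - y) powr (q - 1)"
  using parameters by (simp add: bubble_grad_eq_profile norm_profile_grad)

text \<open>Since \<open>(s + 1) * p = N\<close> and \<open>(q - 1) * p = q\<close>, the p-th power
  of the gradient is a multiple of the profile of exponent \<open>N\<close> times
  \<open>norm (x - y) powr q\<close>, hence bounded by a multiple of the profile of exponent
  \<open>N - 1\<close>.\<close>

lemma bubble_grad_in_Lp: "in_Lp p (\<lambda>x. norm (bubble_grad p \<epsilon> y x))"
  unfolding in_Lp_def
proof
  have cont: "continuous_on UNIV (bubble_grad p \<epsilon> y)"
    using C1_bubble by (simp add: C1_with_gradient_def)
  then show m: "(\<lambda>x. norm (bubble_grad p \<epsilon> y x)) \<in> borel_measurable lebesgue"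
    by (intro continuous_imp_borel_measurable_lebesgue continuous_on_norm)
  have e: "(s + 1) * p = N" "(q - 1) * p = q"
    using p by (auto simp: s q field_simps)
  have eq: "\<bar>norm (bubble_grad p \<epsilon> y x)\<bar> powr p = (K * s * q) powr p * (profile a q N y x * norm (x - y) powr q)" for x
  proof -
    have "\<bar>norm (bubble_grad p \<epsilon> y x)\<bar> powr p = (K * s * q * profile a q (s + 1) y x * norm (x - y) powr (q - 1)) powr p"
      by (subst norm_bubble_grad[symmetric]) (simp only: abs_norm_cancel)
    also have "\<dots> = (K * s * q) powr p * profile a q (s + 1) y x powr p * (norm (x - y) powr (q - 1)) powr p"
      by (simp only: powr_mult)
    finally show ?thesis
      by (simp only: profile_powr powr_powr e mult.assoc)
  qed
  show "integrable lebesgue (\<lambda>x. \<bar>norm (bubble_grad p \<epsilon> y x)\<bar> powr p)"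
  proof (rule Bochner_Integration.integrable_bound)
    show "integrable lebesgue (\<lambda>x. (K * s * q) powr p * profile a q (N - 1) y x)"
      by (intro integrable_mult_right integrable_profile) (use parameters N in auto)
    show "(\<lambda>x. \<bar>norm (bubble_grad p \<epsilon> y x)\<bar> powr p) \<in> borel_measurable lebesgue"
      using m by measurable
    show "AE x in lebesgue. norm (\<bar>norm (bubble_grad p \<epsilon> y x)\<bar> powr p)
        \<le> norm ((K * s * q) powr p * profile a q (N - 1) y x)"
    proof (rule AE_I2)
      fix x
      have "profile a q N y x * norm (x - y) powr q \<le> profile a q (N - 1) y x"
        using profile_mult_norm_powr_le(1)[of a q "N - 1" y x] parameters by simp
      then show "norm (\<bar>norm (bubble_grad p \<epsilon> y x)\<bar> powr p)
        \<le> norm ((K * s * q) powr p * profile a q (N - 1) y x)"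
        unfolding eq using profile_pos[of a q "N - 1" y x] profile_pos[of a q N y x] parameters
        by (simp add: abs_mult mult_left_mono)
    qed
  qed
qed

lemma bubble_has_weak_gradient: "has_weak_gradient (bubble p \<epsilon> y) (bubble_grad p \<epsilon> y)"
  by (rule C1_has_weak_gradient[OF C1_bubble])

lemma bubble_D1p: "bubble p \<epsilon> y \<in> D1p p"
  unfolding D1p_def N[symmetric] ps[symmetric]
  using bubble_in_Lp bubble_grad_in_Lp bubble_has_weak_gradient by blast

text \<open>The exponent of \<open>norm (x - y)\<close> in the flux cancels, which makes the flux continuously differentiable.\<close>

lemma bubble_flux:
  "norm (bubble_grad p \<epsilon> y x) powr (p - 2) *\<^sub>R bubble_grad p \<epsilon> y x
     = - ((K * s * q) powr (p - 1) * profile a q (N / q) y x) *\<^sub>R (x - y)"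
proof (cases "x = y")
  case False
  define r where "r = norm (x - y)"
  have r: "r > 0" using False by (simp add: r_def)
  let ?P = "profile a q (s + 1) y x" and ?c = "K * s * q"
  have P: "?P > 0" and c: "?c > 0" using parameters profile_pos[of a q "s + 1" y x] by auto
  \<comment> \<open>The second identity is the cancellation of the distance; it amounts to
    \<open>(q - 1) * (p - 1) = 1\<close> for conjugate exponents.\<close>
  have e: "(s + 1) * (p - 1) = N / q" "(q - 1) * (p - 2) + (q - 2) = 0"
    using p by (auto simp: s q field_simps power2_eq_square)
  have "norm (bubble_grad p \<epsilon> y x) powr (p - 2) * (?c * ?P * r powr (q - 2))
      = (?c powr (p - 2) * ?c powr 1) * (?P powr (p - 2) * ?P powr 1) * ((r powr (q - 1)) powr (p - 2) * r powr (q - 2))"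
    using P c by (simp add: norm_bubble_grad powr_mult r_def mult_ac)
  also have "\<dots> = ?c powr (p - 1) * ?P powr (p - 1) * r powr 0"
    unfolding powr_powr powr_add[symmetric] e(2) by simp
  also have "\<dots> = ?c powr (p - 1) * profile a q (N / q) y x"
    using r by (simp add: profile_powr e(1))
  finally show ?thesis
    by (simp add: bubble_grad_eq_profile[of x] profile_grad_def mult_ac flip: r_def)
qed (simp add: bubble_grad_eq_profile profile_grad_def)

text \<open>The normalisation of the bubble is made for this: the coefficient from the divergence of
  the flux agrees with that of \<open>U powr (ps - 1)\<close>. Dividing by
  \<open>K powr (p - 1)\<close> leaves
  \<open>K powr (ps - p) = N * (s * q) powr (p - 1) * a\<close>, where the power of
  \<open>\<epsilon>\<close> in \<open>K\<close> produces \<open>a\<close>.\<close>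

lemma bubble_const_identity: "(K * s * q) powr (p - 1) * (N * a) = K powr (ps - 1)"
proof -
  have e: "(N - p) / p\<^sup>2 * (ps - p) = 1" "(N - p) / (p * (p - 1)) * (ps - p) = q" "s * q = (N - p) / (p - 1)"
  proof -
    have d: "ps - p = p\<^sup>2 / (N - p)"
      using p by (simp add: ps crit_exp_def field_simps power2_eq_square)
    show "(N - p) / p\<^sup>2 * (ps - p) = 1"
      unfolding d using p by simp
    have "(N - p) / (p * (p - 1)) * (p\<^sup>2 / (N - p)) = p * p / (p * (p - 1))"
      using p by (simp add: power2_eq_square)
    then show "(N - p) / (p * (p - 1)) * (ps - p) = q"
      unfolding d using p by (simp add: q)
    show "s * q = (N - p) / (p - 1)"
      using p by (simp add: s q)
  qed
  have "K powr (ps - p) = ((N * ((N - p) / (p - 1)) powr (p - 1)) powr ((N - p) / p\<^sup>2)) powr (ps - p)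
      * (\<epsilon> powr ((N - p) / (p * (p - 1)))) powr (ps - p)"
    by (simp only: K bubble_const_def powr_mult)
  also have "\<dots> = N * (s * q) powr (p - 1) * a"
    unfolding powr_powr e using p by (simp add: a)
  finally have "K powr (p - 1) * K powr (ps - p) = (K * (s * q)) powr (p - 1) * (N * a)"
    by (simp add: powr_mult)
  moreover have "K powr (p - 1) * K powr (ps - p) = K powr (ps - 1)"
    by (simp flip: powr_add)
  ultimately show ?thesis by (simp add: mult.assoc)
qed

text \<open>The relation \<open>s * (ps - 1) = N / q + 1\<close> is where criticality of the
  exponent enters: the nonlinearity has the decay of the divergence of the flux.\<close>

lemma bubble_powr: "bubble p \<epsilon> y x powr (ps - 1) = K powr (ps - 1) * profile a q (N / q + 1) y x"
proof -
  have "s * (ps - 1) = N / q + 1"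
    using p by (simp add: s ps crit_exp_def q field_simps)
  then show ?thesis
    by (simp add: bubble_eq_profile powr_mult profile_powr)
qed

lemma bubble_weak_equation:
  assumes u: "has_weak_gradient u g" "in_Lp ps u" "in_Lp p (\<lambda>x. norm (g x))"
  shows "(LINT x|lebesgue. norm (bubble_grad p \<epsilon> y x) powr (p - 2) * (bubble_grad p \<epsilon> y x \<bullet> g x))
       = (LINT x|lebesgue. bubble p \<epsilon> y x powr (ps - 1) * u x)"
proof -
  let ?c = "(K * s * q) powr (p - 1)"
  have "(LINT x|lebesgue. norm (bubble_grad p \<epsilon> y x) powr (p - 2) * (bubble_grad p \<epsilon> y x \<bullet> g x))
      = (LINT x|lebesgue. - ?c * (profile a q (N / q) y x * ((x - y) \<bullet> g x)))"
  proof (rule Bochner_Integration.integral_cong[OF refl])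
    fix x
    have "norm (bubble_grad p \<epsilon> y x) powr (p - 2) * (bubble_grad p \<epsilon> y x \<bullet> g x)
        = (norm (bubble_grad p \<epsilon> y x) powr (p - 2) *\<^sub>R bubble_grad p \<epsilon> y x) \<bullet> g x" by simp
    also have "\<dots> = - ?c * (profile a q (N / q) y x * ((x - y) \<bullet> g x))"
      unfolding bubble_flux by simp
    finally show "norm (bubble_grad p \<epsilon> y x) powr (p - 2) * (bubble_grad p \<epsilon> y x \<bullet> g x)
        = - ?c * (profile a q (N / q) y x * ((x - y) \<bullet> g x))" .
  qed
  also have "\<dots> = ?c * - (LINT x|lebesgue. profile a q (N / q) y x * ((x - y) \<bullet> g x))"
    by simp
  also have "\<dots> = ?c * (LINT x|lebesgue. u x * (N * a * profile a q (N / q + 1) y x))"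
    unfolding N
    by (subst profile_weak_divergence[symmetric, where ps = ps and p = p])
       (use parameters p u q in \<open>simp_all flip: N\<close>)
  also have "\<dots> = (LINT x|lebesgue. ?c * (u x * (N * a * profile a q (N / q + 1) y x)))"
    by simp
  also have "\<dots> = (LINT x|lebesgue. bubble p \<epsilon> y x powr (ps - 1) * u x)"
    by (rule Bochner_Integration.integral_cong[OF refl])
       (simp add: bubble_powr mult_ac flip: bubble_const_identity)
  finally show ?thesis .
qed

end

subsection \<open>Weak solutions are critical points\<close>

text \<open>The mean value inequality turns the bound on \<open>F'\<close> into a bound on all
  difference quotients with step at most 1, to which dominated convergence applies along
  sequences.\<close>

lemma DERIV_integral_dominated:
  fixes F F' :: "real \<Rightarrow> 'a \<Rightarrow> real"
  assumes int: "\<And>t. integrable M (F t)"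
    and der: "\<And>t x. \<bar>t\<bar> \<le> 1 \<Longrightarrow> ((\<lambda>t. F t x) has_real_derivative F' t x) (at t)"
    and bound: "\<And>t x. \<bar>t\<bar> \<le> 1 \<Longrightarrow> \<bar>F' t x\<bar> \<le> B x" and B: "integrable M B"
  shows "((\<lambda>t. LINT x|M. F t x) has_real_derivative (LINT x|M. F' 0 x)) (at 0)"
proof -
  have lip: "\<bar>(F h x - F 0 x) / h\<bar> \<le> B x" if "\<bar>h\<bar> \<le> 1" "h \<noteq> 0" for h x
  proof -
    have "norm (F h x - F 0 x) \<le> B x * norm (h - 0)"
    proof (rule field_differentiable_bound[of "{-1..1}"])
      show "((\<lambda>t. F t x) has_field_derivative F' t x) (at t within {-1..1})" if "t \<in> {-1..1}" for t
        by (rule has_field_derivative_at_within, rule der) (use that in auto)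
      show "norm (F' t x) \<le> B x" if "t \<in> {-1..1}" for t
        using bound[of t x] that by auto
    qed (use that in auto)
    then show ?thesis
      using that by (simp add: field_simps)
  qed
  have lim: "(\<lambda>i. (F (X i) x - F 0 x) / X i) \<longlonglongrightarrow> F' 0 x"
    if "X \<longlonglongrightarrow> 0" "\<And>i. X i \<noteq> 0" for X :: "nat \<Rightarrow> real" and x
  proof -
    have "(\<lambda>h. (F (0 + h) x - F 0 x) / h) \<midarrow>0\<rightarrow> F' 0 x"
      using der[of 0 x] by (simp add: DERIV_def)
    moreover have "filterlim X (at 0) sequentially"
      using that by (simp add: filterlim_at)
    ultimately show ?thesis
      by (auto dest: filterlim_compose)
  qed
  \<comment> \<open>Measurability of \<open>F' 0\<close> is not assumed; it follows because
    \<open>F' 0\<close> is a limit of measurable difference quotients.\<close>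
  have meas: "F' 0 \<in> borel_measurable M"
  proof (rule borel_measurable_LIMSEQ_real)
    show "(\<lambda>i. (F (inverse (real (Suc i))) x - F 0 x) / inverse (real (Suc i))) \<longlonglongrightarrow> F' 0 x" for x
      by (rule lim[OF LIMSEQ_inverse_real_of_nat]) simp
    show "(\<lambda>x. (F (inverse (real (Suc i))) x - F 0 x) / inverse (real (Suc i))) \<in> borel_measurable M" for i
      using int by (intro borel_measurable_divide borel_measurable_diff borel_measurable_integrable) auto
  qed
  have "(\<lambda>h. ((LINT x|M. F h x) - (LINT x|M. F 0 x)) / h) \<midarrow>0\<rightarrow> (LINT x|M. F' 0 x)"
    unfolding tendsto_at_iff_sequentially
  proof (intro allI impI)
    fix X :: "nat \<Rightarrow> real" assume "\<forall>i. X i \<in> UNIV - {0}" and X0: "X \<longlonglongrightarrow> 0"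
    then have Xn: "\<And>i. X i \<noteq> 0" by auto
    have "\<forall>\<^sub>F i in sequentially. \<bar>X i\<bar> < 1"
      using tendsto_rabs_zero[OF X0] by (rule order_tendstoD) simp
    \<comment> \<open>Discarding the first k terms ensures that every step lies in the range where
      the derivative bound holds.\<close>
    then obtain k where k: "\<And>i. i \<ge> k \<Longrightarrow> \<bar>X i\<bar> < 1"
      by (auto simp: eventually_sequentially)
    have "(\<lambda>i. LINT x|M. (F (X (i + k)) x - F 0 x) / X (i + k)) \<longlonglongrightarrow> (LINT x|M. F' 0 x)"
    proof (rule integral_dominated_convergence[OF meas _ B])
      show "(\<lambda>x. (F (X (i + k)) x - F 0 x) / X (i + k)) \<in> borel_measurable M" for i
        using int by (intro borel_measurable_divide borel_measurable_diff borel_measurable_integrable) auto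
      show "AE x in M. (\<lambda>i. (F (X (i + k)) x - F 0 x) / X (i + k)) \<longlonglongrightarrow> F' 0 x"
        using lim[OF LIMSEQ_ignore_initial_segment[OF X0, of k]] Xn by auto
      show "AE x in M. norm ((F (X (i + k)) x - F 0 x) / X (i + k)) \<le> B x" for i
        using lip[of "X (i + k)"] k[of "i + k"] Xn by auto
    qed
    moreover have "(LINT x|M. (F (X (i + k)) x - F 0 x) / X (i + k))
        = ((LINT x|M. F (X (i + k)) x) - (LINT x|M. F 0 x)) / X (i + k)" for i
      using int by simp
    ultimately have "(\<lambda>i. ((LINT x|M. F (X (i + k)) x) - (LINT x|M. F 0 x)) / X (i + k)) \<longlonglongrightarrow> (LINT x|M. F' 0 x)"
      by (simp only:)
    then have "(\<lambda>i. ((LINT x|M. F (X i) x) - (LINT x|M. F 0 x)) / X i) \<longlonglongrightarrow> (LINT x|M. F' 0 x)"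
      by (rule LIMSEQ_offset)
    then show "((\<lambda>h. ((LINT x|M. F h x) - (LINT x|M. F 0 x)) / h) \<circ> X) \<longlonglongrightarrow> (LINT x|M. F' 0 x)"
      by (simp add: comp_def)
  qed
  then show ?thesis by (simp add: DERIV_def)
qed

lemma DERIV_norm_powr_line:
  fixes G H :: "'a::real_inner"
  assumes "m > 1"
  shows "((\<lambda>t. norm (G + t *\<^sub>R H) powr m) has_real_derivative
     m * norm (G + t *\<^sub>R H) powr (m - 2) * ((G + t *\<^sub>R H) \<bullet> H)) (at t)"
proof -
  have "((\<lambda>t. G + t *\<^sub>R H) has_derivative (\<lambda>h. h *\<^sub>R H)) (at t)"
    by (auto intro!: derivative_eq_intros)
  then have "((\<lambda>t. norm (G + t *\<^sub>R H) powr m) has_derivative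
      (\<lambda>h. (h *\<^sub>R H) \<bullet> ((m * norm (G + t *\<^sub>R H) powr (m - 2)) *\<^sub>R (G + t *\<^sub>R H)))) (at t)"
    by (rule has_derivative_compose) (rule GDERIV_norm_powr[OF assms, unfolded gderiv_def])
  moreover have "(\<lambda>h. (h *\<^sub>R H) \<bullet> ((m * norm (G + t *\<^sub>R H) powr (m - 2)) *\<^sub>R (G + t *\<^sub>R H)))
      = (*) (m * norm (G + t *\<^sub>R H) powr (m - 2) * ((G + t *\<^sub>R H) \<bullet> H))"
    by (auto simp: fun_eq_iff inner_commute)
  ultimately show ?thesis
    by (simp add: has_field_derivative_def)
qed

text \<open>The bounds are independent of t and have the homogeneity of the integrand, so they serve
  as dominating functions.\<close>

lemma norm_powr_line_bound:
  fixes G H :: "'a::real_inner"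
  assumes m: "m > 1" and t: "\<bar>t\<bar> \<le> 1"
  shows "\<bar>norm (G + t *\<^sub>R H) powr (m - 2) * ((G + t *\<^sub>R H) \<bullet> H)\<bar> \<le> (norm G + norm H) powr m"
    and "norm (G + t *\<^sub>R H) powr m \<le> (norm G + norm H) powr m"
proof -
  let ?Z = "G + t *\<^sub>R H" and ?A = "norm G + norm H"
  have Z: "norm ?Z \<le> ?A"
    using norm_triangle_ineq[of G "t *\<^sub>R H"] mult_right_mono[OF t norm_ge_zero[of H]] by simp
  show "norm ?Z powr m \<le> ?A powr m"
    using Z m by (intro powr_mono2) auto
  have "\<bar>norm ?Z powr (m - 2) * (?Z \<bullet> H)\<bar> \<le> norm ?Z powr (m - 2) * (norm ?Z * norm H)"
    unfolding abs_mult using Cauchy_Schwarz_ineq2[of ?Z H] by (auto intro!: mult_mono)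
  also have "\<dots> = norm ?Z powr (m - 1) * norm H"
    using powr_diff_two_mult(1)[of "norm ?Z" m] by (simp flip: mult.assoc)
  also have "\<dots> \<le> ?A powr (m - 1) * ?A"
    using Z m by (intro mult_mono powr_mono2) auto
  also have "\<dots> = ?A powr m"
    by (cases "?A = 0") (auto simp: powr_diff add_nonneg_eq_0_iff)
  finally show "\<bar>norm ?Z powr (m - 2) * (?Z \<bullet> H)\<bar> \<le> ?A powr m" .
qed

lemma integrable_powr_add:
  fixes f g :: "'a \<Rightarrow> real"
  assumes [measurable]: "f \<in> borel_measurable M" "g \<in> borel_measurable M"
    and "integrable M (\<lambda>x. \<bar>f x\<bar> powr m)" "integrable M (\<lambda>x. \<bar>g x\<bar> powr m)" and m: "m > 0"
  shows "integrable M (\<lambda>x. (\<bar>f x\<bar> + \<bar>g x\<bar>) powr m)"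
proof (rule Bochner_Integration.integrable_bound)
  show "integrable M (\<lambda>x. 2 powr m * (\<bar>f x\<bar> powr m + \<bar>g x\<bar> powr m))"
    using assms by simp
  show "AE x in M. norm ((\<bar>f x\<bar> + \<bar>g x\<bar>) powr m) \<le> norm (2 powr m * (\<bar>f x\<bar> powr m + \<bar>g x\<bar> powr m))"
  proof (rule AE_I2)
    fix x
    have "(\<bar>f x\<bar> + \<bar>g x\<bar>) powr m \<le> (2 * max \<bar>f x\<bar> \<bar>g x\<bar>) powr m"
      using m by (intro powr_mono2) auto
    also have "\<dots> = 2 powr m * max \<bar>f x\<bar> \<bar>g x\<bar> powr m"
      by (rule powr_mult)
    also have "\<dots> \<le> 2 powr m * (\<bar>f x\<bar> powr m + \<bar>g x\<bar> powr m)"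
      by (intro mult_left_mono) (auto simp: max_def)
    finally show "norm ((\<bar>f x\<bar> + \<bar>g x\<bar>) powr m) \<le> norm (2 powr m * (\<bar>f x\<bar> powr m + \<bar>g x\<bar> powr m))"
      by simp
  qed
qed simp

text \<open>Vector values are allowed so that one statement serves both the gradient terms of the
  energy and, with real values, its pure power terms.\<close>

lemma DERIV_integral_norm_powr:
  fixes G H :: "'a \<Rightarrow> 'b::euclidean_space"
  assumes [measurable]: "G \<in> borel_measurable M" "H \<in> borel_measurable M"
    and G: "integrable M (\<lambda>x. norm (G x) powr m)" and H: "integrable M (\<lambda>x. norm (H x) powr m)" and m: "m > 1"
  shows "((\<lambda>t. LINT x|M. norm (G x + t *\<^sub>R H x) powr m) has_real_derivative
       m * (LINT x|M. norm (G x) powr (m - 2) * (G x \<bullet> H x))) (at 0)"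
    and "integrable M (\<lambda>x. norm (G x + t *\<^sub>R H x) powr m)"
    and "integrable M (\<lambda>x. norm (G x) powr (m - 2) * (G x \<bullet> H x))"
proof -
  have A: "integrable M (\<lambda>x. (norm (G x) + norm (H x)) powr m)"
    using integrable_powr_add[of "\<lambda>x. norm (G x)" M "\<lambda>x. norm (H x)" m] G H m by simp
  have int: "integrable M (\<lambda>x. norm (G x + t *\<^sub>R H x) powr m)" for t
  proof (rule Bochner_Integration.integrable_bound)
    have "integrable M (\<lambda>x. norm (t *\<^sub>R H x) powr m)"
      using H by (simp add: powr_mult)
    then show "integrable M (\<lambda>x. (norm (G x) + norm (t *\<^sub>R H x)) powr m)"
      using integrable_powr_add[of "\<lambda>x. norm (G x)" M "\<lambda>x. norm (t *\<^sub>R H x)" m] G m by simp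
    show "AE x in M. norm (norm (G x + t *\<^sub>R H x) powr m) \<le> norm ((norm (G x) + norm (t *\<^sub>R H x)) powr m)"
      using norm_powr_line_bound(2)[OF m, of 1 "G _" "t *\<^sub>R H _"] by simp
  qed simp
  then show "integrable M (\<lambda>x. norm (G x + t *\<^sub>R H x) powr m)" .
  have "((\<lambda>t. LINT x|M. norm (G x + t *\<^sub>R H x) powr m) has_real_derivative
       (LINT x|M. m * norm (G x + 0 *\<^sub>R H x) powr (m - 2) * ((G x + 0 *\<^sub>R H x) \<bullet> H x))) (at 0)"
  proof (rule DERIV_integral_dominated[OF int DERIV_norm_powr_line[OF m]])
    show "\<bar>m * norm (G x + t *\<^sub>R H x) powr (m - 2) * ((G x + t *\<^sub>R H x) \<bullet> H x)\<bar> \<le> m * (norm (G x) + norm (H x)) powr m"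
      if "\<bar>t\<bar> \<le> 1" for t x
      using mult_left_mono[OF norm_powr_line_bound(1)[OF m that, of "G x" "H x"], of m] m
      by (simp add: abs_mult mult.assoc)
    show "integrable M (\<lambda>x. m * (norm (G x) + norm (H x)) powr m)"
      using A by simp
  qed
  then show "((\<lambda>t. LINT x|M. norm (G x + t *\<^sub>R H x) powr m) has_real_derivative
       m * (LINT x|M. norm (G x) powr (m - 2) * (G x \<bullet> H x))) (at 0)"
    by (simp add: mult.assoc)
  show "integrable M (\<lambda>x. norm (G x) powr (m - 2) * (G x \<bullet> H x))"
  proof (rule Bochner_Integration.integrable_bound[OF A])
    show "AE x in M. norm (norm (G x) powr (m - 2) * (G x \<bullet> H x)) \<le> norm ((norm (G x) + norm (H x)) powr m)"
      using norm_powr_line_bound(1)[OF m, of 0 "G _" "H _"] by simp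
  qed measurable
qed

lemma coupling_derivative_bound:
  fixes u v \<phi> t :: real
  assumes \<alpha>: "\<alpha> > 1" and \<beta>: "\<beta> > 1" and t: "\<bar>t\<bar> \<le> 1"
  shows "\<bar>\<bar>u + t * \<phi>\<bar> powr (\<alpha> - 2) * (u + t * \<phi>) * \<phi> * \<bar>v + t * \<psi>\<bar> powr \<beta>\<bar>
      \<le> (\<bar>u\<bar> + \<bar>\<phi>\<bar>) powr \<alpha> * (\<bar>v\<bar> + \<bar>\<psi>\<bar>) powr \<beta>"
proof -
  have 1: "\<bar>\<bar>u + t * \<phi>\<bar> powr (\<alpha> - 2) * (u + t * \<phi>) * \<phi>\<bar> \<le> (\<bar>u\<bar> + \<bar>\<phi>\<bar>) powr \<alpha>"
    using norm_powr_line_bound(1)[OF \<alpha> t, of u \<phi>] by (simp add: mult.assoc)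
  have 2: "\<bar>v + t * \<psi>\<bar> powr \<beta> \<le> (\<bar>v\<bar> + \<bar>\<psi>\<bar>) powr \<beta>"
    using norm_powr_line_bound(2)[OF \<beta> t, of v \<psi>] by simp
  show ?thesis
    using mult_mono[OF 1 2] by (simp add: abs_mult)
qed

text \<open>Both partial derivatives of the integrand are dominated by one product with exponents
  \<open>\<alpha>\<close> and \<open>\<beta>\<close>; because these add up to m, the product is
  integrable.\<close>

lemma DERIV_integral_coupling:
  fixes u v \<phi> \<psi> :: "'a \<Rightarrow> real"
  assumes [measurable]: "u \<in> borel_measurable M" "v \<in> borel_measurable M"
      "\<phi> \<in> borel_measurable M" "\<psi> \<in> borel_measurable M"
    and int: "integrable M (\<lambda>x. \<bar>u x\<bar> powr m)" "integrable M (\<lambda>x. \<bar>v x\<bar> powr m)"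
      "integrable M (\<lambda>x. \<bar>\<phi> x\<bar> powr m)" "integrable M (\<lambda>x. \<bar>\<psi> x\<bar> powr m)"
    and \<alpha>: "\<alpha> > 1" and \<beta>: "\<beta> > 1" and m: "\<alpha> + \<beta> = m"
  shows "((\<lambda>t. LINT x|M. \<bar>u x + t * \<phi> x\<bar> powr \<alpha> * \<bar>v x + t * \<psi> x\<bar> powr \<beta>) has_real_derivative
       \<alpha> * (LINT x|M. \<bar>u x\<bar> powr (\<alpha> - 2) * u x * \<phi> x * \<bar>v x\<bar> powr \<beta>)
       + \<beta> * (LINT x|M. \<bar>v x\<bar> powr (\<beta> - 2) * v x * \<psi> x * \<bar>u x\<bar> powr \<alpha>)) (at 0)"
    and "integrable M (\<lambda>x. \<bar>u x + t * \<phi> x\<bar> powr \<alpha> * \<bar>v x + t * \<psi> x\<bar> powr \<beta>)"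
    and "integrable M (\<lambda>x. \<bar>u x\<bar> powr (\<alpha> - 2) * u x * \<phi> x * \<bar>v x\<bar> powr \<beta>)"
    and "integrable M (\<lambda>x. \<bar>v x\<bar> powr (\<beta> - 2) * v x * \<psi> x * \<bar>u x\<bar> powr \<alpha>)"
proof -
  let ?A = "\<lambda>x. \<bar>u x\<bar> + \<bar>\<phi> x\<bar>" and ?C = "\<lambda>x. \<bar>v x\<bar> + \<bar>\<psi> x\<bar>"
  have AC: "integrable M (\<lambda>x. ?A x powr \<alpha> * ?C x powr \<beta>)"
    using integrable_powr_mult[of ?A M ?C m \<alpha> \<beta>] integrable_powr_add[of u M \<phi> m] integrable_powr_add[of v M \<psi> m]
      int \<alpha> \<beta> m by simp
  have line: "integrable M (\<lambda>x. \<bar>w x + t * \<omega> x\<bar> powr m)"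
    if "w \<in> borel_measurable M" "\<omega> \<in> borel_measurable M" "integrable M (\<lambda>x. \<bar>w x\<bar> powr m)" "integrable M (\<lambda>x. \<bar>\<omega> x\<bar> powr m)"
    for w \<omega> :: "'a \<Rightarrow> real" and t
    using DERIV_integral_norm_powr(2)[of w M \<omega> m t] that \<alpha> \<beta> m by simp
  have int_t: "integrable M (\<lambda>x. \<bar>u x + t * \<phi> x\<bar> powr \<alpha> * \<bar>v x + t * \<psi> x\<bar> powr \<beta>)" for t
    by (rule integrable_powr_mult[where m = m]) (use int \<alpha> \<beta> m line in auto)
  then show "integrable M (\<lambda>x. \<bar>u x + t * \<phi> x\<bar> powr \<alpha> * \<bar>v x + t * \<psi> x\<bar> powr \<beta>)" .
  show i1: "integrable M (\<lambda>x. \<bar>u x\<bar> powr (\<alpha> - 2) * u x * \<phi> x * \<bar>v x\<bar> powr \<beta>)"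
  proof (rule Bochner_Integration.integrable_bound[OF AC])
    show "AE x in M. norm (\<bar>u x\<bar> powr (\<alpha> - 2) * u x * \<phi> x * \<bar>v x\<bar> powr \<beta>) \<le> norm (?A x powr \<alpha> * ?C x powr \<beta>)"
      using coupling_derivative_bound[OF \<alpha> \<beta>, of 0 "u _" "\<phi> _" "v _" "\<psi> _"] by simp
  qed measurable
  show i2: "integrable M (\<lambda>x. \<bar>v x\<bar> powr (\<beta> - 2) * v x * \<psi> x * \<bar>u x\<bar> powr \<alpha>)"
  proof (rule Bochner_Integration.integrable_bound[OF AC])
    show "AE x in M. norm (\<bar>v x\<bar> powr (\<beta> - 2) * v x * \<psi> x * \<bar>u x\<bar> powr \<alpha>) \<le> norm (?A x powr \<alpha> * ?C x powr \<beta>)"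
      using coupling_derivative_bound[OF \<beta> \<alpha>, of 0 "v _" "\<psi> _" "u _" "\<phi> _"] by (simp add: mult.commute)
  qed measurable
  let ?F' = "\<lambda>t x. \<alpha> * (\<bar>u x + t * \<phi> x\<bar> powr (\<alpha> - 2) * (u x + t * \<phi> x) * \<phi> x * \<bar>v x + t * \<psi> x\<bar> powr \<beta>)
      + \<beta> * (\<bar>v x + t * \<psi> x\<bar> powr (\<beta> - 2) * (v x + t * \<psi> x) * \<psi> x * \<bar>u x + t * \<phi> x\<bar> powr \<alpha>)"
  have "((\<lambda>t. LINT x|M. \<bar>u x + t * \<phi> x\<bar> powr \<alpha> * \<bar>v x + t * \<psi> x\<bar> powr \<beta>) has_real_derivative
       (LINT x|M. ?F' 0 x)) (at 0)"
  proof (rule DERIV_integral_dominated[OF int_t])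
    show "((\<lambda>t. \<bar>u x + t * \<phi> x\<bar> powr \<alpha> * \<bar>v x + t * \<psi> x\<bar> powr \<beta>) has_real_derivative ?F' t x) (at t)" for t x
      using DERIV_mult[OF DERIV_norm_powr_line[OF \<alpha>, of "u x" "\<phi> x" t] DERIV_norm_powr_line[OF \<beta>, of "v x" "\<psi> x" t]]
      by (simp add: mult_ac)
    show "\<bar>?F' t x\<bar> \<le> (\<alpha> + \<beta>) * (?A x powr \<alpha> * ?C x powr \<beta>)" if t: "\<bar>t\<bar> \<le> 1" for t x
    proof -
      let ?B = "?A x powr \<alpha> * ?C x powr \<beta>"
      have "\<bar>\<alpha> * a + \<beta> * b\<bar> \<le> (\<alpha> + \<beta>) * B" if "\<bar>a\<bar> \<le> B" "\<bar>b\<bar> \<le> B" for a b B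
      proof -
        have "\<bar>\<alpha> * a\<bar> \<le> \<alpha> * B" "\<bar>\<beta> * b\<bar> \<le> \<beta> * B"
          using that \<alpha> \<beta> by (simp_all add: abs_mult)
        then show ?thesis by (simp add: algebra_simps)
      qed
      moreover have "\<bar>\<bar>v x + t * \<psi> x\<bar> powr (\<beta> - 2) * (v x + t * \<psi> x) * \<psi> x * \<bar>u x + t * \<phi> x\<bar> powr \<alpha>\<bar> \<le> ?B"
        using coupling_derivative_bound[OF \<beta> \<alpha> t, of "v x" "\<psi> x" "u x" "\<phi> x"] by (simp add: mult.commute)
      ultimately show ?thesis
        using coupling_derivative_bound[OF \<alpha> \<beta> t] by blast
    qed
    show "integrable M (\<lambda>x. (\<alpha> + \<beta>) * (?A x powr \<alpha> * ?C x powr \<beta>))"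
      using AC by simp
  qed
  also have "(LINT x|M. ?F' 0 x) = \<alpha> * (LINT x|M. \<bar>u x\<bar> powr (\<alpha> - 2) * u x * \<phi> x * \<bar>v x\<bar> powr \<beta>)
       + \<beta> * (LINT x|M. \<bar>v x\<bar> powr (\<beta> - 2) * v x * \<psi> x * \<bar>u x\<bar> powr \<alpha>)"
    using i1 i2 by simp
  finally show "((\<lambda>t. LINT x|M. \<bar>u x + t * \<phi> x\<bar> powr \<alpha> * \<bar>v x + t * \<psi> x\<bar> powr \<beta>) has_real_derivative
       \<alpha> * (LINT x|M. \<bar>u x\<bar> powr (\<alpha> - 2) * u x * \<phi> x * \<bar>v x\<bar> powr \<beta>)
       + \<beta> * (LINT x|M. \<bar>v x\<bar> powr (\<beta> - 2) * v x * \<psi> x * \<bar>u x\<bar> powr \<alpha>)) (at 0)" .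
qed

text \<open>Membership in \<open>D1p p\<close> only provides some weak gradient with finite norm;
  a.e. uniqueness transfers its integrability to the chosen \<open>wgrad u\<close>.\<close>

lemma D1pD:
  fixes u :: "real ^ 'n \<Rightarrow> real"
  assumes "u \<in> D1p p"
  shows "has_weak_gradient u (wgrad u)"
    and "in_Lp (crit_exp (real CARD('n)) p) u"
    and "in_Lp p (\<lambda>x. norm (wgrad u x))"
    and "u \<in> borel_measurable lebesgue" "wgrad u \<in> borel_measurable lebesgue"
    and "integrable lebesgue (\<lambda>x. \<bar>u x\<bar> powr crit_exp (real CARD('n)) p)"
    and "integrable lebesgue (\<lambda>x. norm (wgrad u x) powr p)"
proof -
  obtain g where g: "has_weak_gradient u g" "in_Lp p (\<lambda>x. norm (g x))"
    using assms unfolding D1p_def by blast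
  show wg: "has_weak_gradient u (wgrad u)" by (rule has_weak_gradient_wgrad[OF g(1)])
  show Lu: "in_Lp (crit_exp (real CARD('n)) p) u" using assms by (simp add: D1p_def)
  then show "u \<in> borel_measurable lebesgue" "integrable lebesgue (\<lambda>x. \<bar>u x\<bar> powr crit_exp (real CARD('n)) p)"
    by (auto simp: in_Lp_def)
  show m: "wgrad u \<in> borel_measurable lebesgue"
    using wg locally_integrable_borel_measurable unfolding has_weak_gradient_def by blast
  have mg: "g \<in> borel_measurable lebesgue"
    using g(1) locally_integrable_borel_measurable unfolding has_weak_gradient_def by blast
  have "AE x in lebesgue. norm (g x) powr p = norm (wgrad u x) powr p"
    using wgrad_AE_eq[OF g(1)] by eventually_elim simp
  then show int: "integrable lebesgue (\<lambda>x. norm (wgrad u x) powr p)"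
    using g(2) m mg by (subst integrable_cong_AE[where g = "\<lambda>x. norm (g x) powr p"]) (auto simp: in_Lp_def)
  show "in_Lp p (\<lambda>x. norm (wgrad u x))"
    using m int by (simp add: in_Lp_def)
qed

lemma weak_solution_imp_critical_point:
  fixes u v :: "real ^ 'n \<Rightarrow> real"
  assumes p: "p > 1" and \<alpha>: "\<alpha> > 1" and \<beta>: "\<beta> > 1" and ps: "\<alpha> + \<beta> = crit_exp (real CARD('n)) p"
    and sol: "weak_solution p \<alpha> \<beta> \<mu>\<^sub>1 \<mu>\<^sub>2 \<gamma> u v"
  shows "critical_point p \<alpha> \<beta> \<mu>\<^sub>1 \<mu>\<^sub>2 \<gamma> u v"
  unfolding critical_point_def
proof (intro conjI ballI)
  define s where "s = crit_exp (real CARD('n)) p"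
  have s: "s > 1" "\<alpha> + \<beta> = s" using \<alpha> \<beta> ps by (auto simp: s_def)
  show u: "u \<in> D1p p" and v: "v \<in> D1p p"
    using sol by (auto simp: weak_solution_def Let_def)
  fix \<phi> \<psi> :: "real ^ 'n \<Rightarrow> real" assume \<phi>: "\<phi> \<in> D1p p" and \<psi>: "\<psi> \<in> D1p p"
  note mm [measurable] = D1pD(4,5)[OF u] D1pD(4,5)[OF v] D1pD(4,5)[OF \<phi>] D1pD(4,5)[OF \<psi>]
  note Ls = D1pD(6)[OF u, folded s_def] D1pD(6)[OF v, folded s_def] D1pD(6)[OF \<phi>, folded s_def] D1pD(6)[OF \<psi>, folded s_def]
  note Dgu = DERIV_integral_norm_powr[OF mm(2) mm(6) D1pD(7)[OF u] D1pD(7)[OF \<phi>] p]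
  note Dgv = DERIV_integral_norm_powr[OF mm(4) mm(8) D1pD(7)[OF v] D1pD(7)[OF \<psi>] p]
  have Du: "((\<lambda>t. LINT x|lebesgue. \<bar>u x + t * \<phi> x\<bar> powr s) has_real_derivative
       s * (LINT x|lebesgue. \<bar>u x\<bar> powr (s - 2) * (u x * \<phi> x))) (at 0)"
     "\<And>t. integrable lebesgue (\<lambda>x. \<bar>u x + t * \<phi> x\<bar> powr s)"
     "integrable lebesgue (\<lambda>x. \<bar>u x\<bar> powr (s - 2) * (u x * \<phi> x))"
    using DERIV_integral_norm_powr[OF mm(1) mm(5), of s] Ls s by simp_all
  have Dv: "((\<lambda>t. LINT x|lebesgue. \<bar>v x + t * \<psi> x\<bar> powr s) has_real_derivative
       s * (LINT x|lebesgue. \<bar>v x\<bar> powr (s - 2) * (v x * \<psi> x))) (at 0)"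
     "\<And>t. integrable lebesgue (\<lambda>x. \<bar>v x + t * \<psi> x\<bar> powr s)"
     "integrable lebesgue (\<lambda>x. \<bar>v x\<bar> powr (s - 2) * (v x * \<psi> x))"
    using DERIV_integral_norm_powr[OF mm(3) mm(7), of s] Ls s by simp_all
  note Dc = DERIV_integral_coupling[OF mm(1) mm(3) mm(5) mm(7) Ls \<alpha> \<beta> s(2)]
  define E where "E t = 1 / p * ((LINT x|lebesgue. norm (wgrad u x + t *\<^sub>R wgrad \<phi> x) powr p)
        + (LINT x|lebesgue. norm (wgrad v x + t *\<^sub>R wgrad \<psi> x) powr p))
      - 1 / s * (\<mu>\<^sub>1 * (LINT x|lebesgue. \<bar>u x + t * \<phi> x\<bar> powr s) + \<mu>\<^sub>2 * (LINT x|lebesgue. \<bar>v x + t * \<psi> x\<bar> powr s)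
        + \<gamma> * (LINT x|lebesgue. \<bar>u x + t * \<phi> x\<bar> powr \<alpha> * \<bar>v x + t * \<psi> x\<bar> powr \<beta>))" for t
  \<comment> \<open>Linearity of \<open>wgrad\<close> holds only a.e., since it is a choice for each
    function separately; under the integral this is enough.\<close>
  have grad: "(LINT x|lebesgue. norm (wgrad (\<lambda>x. u x + t * \<phi> x) x) powr p + norm (wgrad (\<lambda>x. v x + t * \<psi> x) x) powr p)
      = (LINT x|lebesgue. norm (wgrad u x + t *\<^sub>R wgrad \<phi> x) powr p + norm (wgrad v x + t *\<^sub>R wgrad \<psi> x) powr p)" for t
  proof (rule integral_cong_AE)
    have wu: "has_weak_gradient (\<lambda>x. u x + t * \<phi> x) (\<lambda>x. wgrad u x + t *\<^sub>R wgrad \<phi> x)"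
      using has_weak_gradient_lincomb[OF D1pD(1)[OF u] D1pD(1)[OF \<phi>], of 1 t] by simp
    have wv: "has_weak_gradient (\<lambda>x. v x + t * \<psi> x) (\<lambda>x. wgrad v x + t *\<^sub>R wgrad \<psi> x)"
      using has_weak_gradient_lincomb[OF D1pD(1)[OF v] D1pD(1)[OF \<psi>], of 1 t] by simp
    have [measurable]: "wgrad (\<lambda>x. u x + t * \<phi> x) \<in> borel_measurable lebesgue" "wgrad (\<lambda>x. v x + t * \<psi> x) \<in> borel_measurable lebesgue"
      using has_weak_gradient_wgrad[OF wu] has_weak_gradient_wgrad[OF wv]
      using locally_integrable_borel_measurable unfolding has_weak_gradient_def by blast+
    show "(\<lambda>x. norm (wgrad (\<lambda>x. u x + t * \<phi> x) x) powr p + norm (wgrad (\<lambda>x. v x + t * \<psi> x) x) powr p) \<in> borel_measurable lebesgue"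
      by measurable
    show "(\<lambda>x. norm (wgrad u x + t *\<^sub>R wgrad \<phi> x) powr p + norm (wgrad v x + t *\<^sub>R wgrad \<psi> x) powr p) \<in> borel_measurable lebesgue"
      by measurable
    show "AE x in lebesgue. norm (wgrad (\<lambda>x. u x + t * \<phi> x) x) powr p + norm (wgrad (\<lambda>x. v x + t * \<psi> x) x) powr p
        = norm (wgrad u x + t *\<^sub>R wgrad \<phi> x) powr p + norm (wgrad v x + t *\<^sub>R wgrad \<psi> x) powr p"
      using wgrad_AE_eq[OF wu] wgrad_AE_eq[OF wv] by eventually_elim simp
  qed
  have "energy p \<alpha> \<beta> \<mu>\<^sub>1 \<mu>\<^sub>2 \<gamma> (\<lambda>x. u x + t * \<phi> x) (\<lambda>x. v x + t * \<psi> x) = E t" for t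
    unfolding energy_def Let_def s_def[symmetric] grad E_def
    using Dgu(2)[of t] Dgv(2)[of t] Du(2)[of t] Dv(2)[of t] Dc(2)[of t]
    by (simp add: mult.assoc)
  moreover have "(E has_real_derivative 0) (at 0)"
  proof -
    have e1: "(LINT x|lebesgue. norm (wgrad u x) powr (p - 2) * (wgrad u x \<bullet> wgrad \<phi> x)) =
          \<mu>\<^sub>1 * (LINT x|lebesgue. \<bar>u x\<bar> powr (s - 2) * (u x * \<phi> x))
          + \<alpha> * \<gamma> / s * (LINT x|lebesgue. \<bar>u x\<bar> powr (\<alpha> - 2) * u x * \<phi> x * \<bar>v x\<bar> powr \<beta>)"
    proof -
      have "(LINT x|lebesgue. norm (wgrad u x) powr (p - 2) * (wgrad u x \<bullet> wgrad \<phi> x)) =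
          (LINT x|lebesgue. \<mu>\<^sub>1 * (\<bar>u x\<bar> powr (s - 2) * (u x * \<phi> x))
          + \<alpha> * \<gamma> / s * (\<bar>u x\<bar> powr (\<alpha> - 2) * u x * \<phi> x * \<bar>v x\<bar> powr \<beta>))"
        using sol \<phi> unfolding weak_solution_def Let_def s_def[symmetric] by (simp add: algebra_simps)
      then show ?thesis using Du(3) Dc(3) by simp
    qed
    have e2: "(LINT x|lebesgue. norm (wgrad v x) powr (p - 2) * (wgrad v x \<bullet> wgrad \<psi> x)) =
          \<mu>\<^sub>2 * (LINT x|lebesgue. \<bar>v x\<bar> powr (s - 2) * (v x * \<psi> x))
          + \<beta> * \<gamma> / s * (LINT x|lebesgue. \<bar>v x\<bar> powr (\<beta> - 2) * v x * \<psi> x * \<bar>u x\<bar> powr \<alpha>)"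
    proof -
      have "(LINT x|lebesgue. norm (wgrad v x) powr (p - 2) * (wgrad v x \<bullet> wgrad \<psi> x)) =
          (LINT x|lebesgue. \<mu>\<^sub>2 * (\<bar>v x\<bar> powr (s - 2) * (v x * \<psi> x))
          + \<beta> * \<gamma> / s * (\<bar>v x\<bar> powr (\<beta> - 2) * v x * \<psi> x * \<bar>u x\<bar> powr \<alpha>))"
        using sol \<psi> unfolding weak_solution_def Let_def s_def[symmetric] by (simp add: algebra_simps)
      then show ?thesis using Dv(3) Dc(4) by simp
    qed
    \<comment> \<open>Differentiation produces the factors p and s, which cancel the prefactors of
      the energy; the remainder is the sum of the two weak equations tested with
      \<open>\<phi>\<close> and \<open>\<psi>\<close>.\<close>
    have cancel: "1 / p * (p * I\<^sub>1 + p * I\<^sub>2) - 1 / s * (\<mu>\<^sub>1 * (s * J\<^sub>1) + \<mu>\<^sub>2 * (s * J\<^sub>2) + \<gamma> * (\<alpha> * K\<^sub>1 + \<beta> * K\<^sub>2)) = 0"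
      if "I\<^sub>1 = \<mu>\<^sub>1 * J\<^sub>1 + \<alpha> * \<gamma> / s * K\<^sub>1" "I\<^sub>2 = \<mu>\<^sub>2 * J\<^sub>2 + \<beta> * \<gamma> / s * K\<^sub>2"
      for I\<^sub>1 I\<^sub>2 J\<^sub>1 J\<^sub>2 K\<^sub>1 K\<^sub>2
      using p s(1) by (simp add: that field_simps)
    show ?thesis
      unfolding E_def[abs_def]
      by (rule DERIV_cong[OF _ cancel[OF e1 e2]]) (intro DERIV_diff DERIV_add DERIV_cmult Dgu(1) Dgv(1) Du(1) Dv(1) Dc(1))
  qed
  ultimately show "((\<lambda>t. energy p \<alpha> \<beta> \<mu>\<^sub>1 \<mu>\<^sub>2 \<gamma> (\<lambda>x. u x + t * \<phi> x) (\<lambda>x. v x + t * \<psi> x))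
      has_real_derivative 0) (at 0)"
    by simp
qed

subsection \<open>The algebraic system\<close>

text \<open>Writing the critical exponent as \<open>\<alpha> + \<beta>\<close> keeps the algebraic
  part free of the space dimension.\<close>

definition coupling_system :: "real \<Rightarrow> real \<Rightarrow> real \<Rightarrow> real \<Rightarrow> real \<Rightarrow> real \<Rightarrow> real \<Rightarrow> real \<Rightarrow> bool" where
  "coupling_system p \<alpha> \<beta> \<mu>\<^sub>1 \<mu>\<^sub>2 \<gamma> k l \<longleftrightarrow> (let ps = \<alpha> + \<beta> in k > 0 \<and> l > 0 \<and>
     \<mu>\<^sub>1 * k powr ((ps - p) / p) + \<alpha> * \<gamma> / ps * k powr ((\<alpha> - p) / p) * l powr (\<beta> / p) = 1 \<and>
     \<mu>\<^sub>2 * l powr ((ps - p) / p) + \<beta> * \<gamma> / ps * k powr (\<alpha> / p) * l powr ((\<beta> - p) / p) = 1)"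

text \<open>In terms of the quotient \<open>\<tau> = l / k\<close> the system becomes one equation for \<open>\<tau>\<close>, and \<open>k\<close> is then explicit.\<close>

lemma coupling_system_of_quotient:
  fixes p \<alpha> \<beta> \<mu>\<^sub>1 \<mu>\<^sub>2 \<gamma> \<tau> :: real
  assumes p: "p > 0" and \<alpha>: "\<alpha> > 0" and \<beta>: "\<beta> > 0" "\<alpha> + \<beta> > p"
    and \<mu>\<^sub>1: "\<mu>\<^sub>1 > 0" and \<gamma>: "\<gamma> > 0" and \<tau>: "\<tau> > 0"
    and root: "\<mu>\<^sub>2 * \<tau> powr ((\<alpha> + \<beta> - p) / p) + \<beta> * \<gamma> / (\<alpha> + \<beta>) * \<tau> powr ((\<beta> - p) / p)
       = \<mu>\<^sub>1 + \<alpha> * \<gamma> / (\<alpha> + \<beta>) * \<tau> powr (\<beta> / p)"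
  defines "k \<equiv> (\<mu>\<^sub>1 + \<alpha> * \<gamma> / (\<alpha> + \<beta>) * \<tau> powr (\<beta> / p)) powr (- p / (\<alpha> + \<beta> - p))"
  shows "coupling_system p \<alpha> \<beta> \<mu>\<^sub>1 \<mu>\<^sub>2 \<gamma> k (\<tau> * k)"
proof -
  let ?D = "\<mu>\<^sub>1 + \<alpha> * \<gamma> / (\<alpha> + \<beta>) * \<tau> powr (\<beta> / p)"
  let ?s = "(\<alpha> + \<beta> - p) / p"
  have "?D > 0" using \<mu>\<^sub>1 \<alpha> \<beta> \<gamma> by (intro add_pos_nonneg) auto
  then have k: "k > 0" by (simp add: k_def)
  have "\<alpha> + \<beta> - p \<noteq> 0" using \<beta> by simp
  then have e: "- p / (\<alpha> + \<beta> - p) * ?s = -1" using p by simp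
  have "k powr ?s = ?D powr (- 1)"
    by (simp only: k_def powr_powr e)
  then have ks: "k powr ?s * ?D = 1"
    using \<open>?D > 0\<close> by (simp add: powr_neg_one del: divide_minus_left)
  \<comment> \<open>Once \<open>l = \<tau> * k\<close>, the coupling terms have the same total power
    of k as the pure powers, so \<open>k powr ?s\<close> factors out of both equations.\<close>
  have e1: "k powr ((\<alpha> - p) / p) * k powr (\<beta> / p) = k powr ?s"
    and e2: "k powr (\<alpha> / p) * k powr ((\<beta> - p) / p) = k powr ?s"
    unfolding powr_add[symmetric] by (simp_all add: add_divide_distrib diff_divide_distrib algebra_simps)
  have "\<mu>\<^sub>1 * k powr ?s + \<alpha> * \<gamma> / (\<alpha> + \<beta>) * k powr ((\<alpha> - p) / p) * (\<tau> * k) powr (\<beta> / p)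
     = \<mu>\<^sub>1 * k powr ?s + \<alpha> * \<gamma> / (\<alpha> + \<beta>) * \<tau> powr (\<beta> / p) * (k powr ((\<alpha> - p) / p) * k powr (\<beta> / p))"
    by (simp add: powr_mult)
  also have "\<dots> = k powr ?s * ?D"
    unfolding e1 by (simp add: algebra_simps)
  finally have 1: "\<mu>\<^sub>1 * k powr ?s + \<alpha> * \<gamma> / (\<alpha> + \<beta>) * k powr ((\<alpha> - p) / p) * (\<tau> * k) powr (\<beta> / p) = 1"
    using ks by simp
  have "\<mu>\<^sub>2 * (\<tau> * k) powr ?s + \<beta> * \<gamma> / (\<alpha> + \<beta>) * k powr (\<alpha> / p) * (\<tau> * k) powr ((\<beta> - p) / p)
     = \<mu>\<^sub>2 * \<tau> powr ?s * k powr ?s + \<beta> * \<gamma> / (\<alpha> + \<beta>) * \<tau> powr ((\<beta> - p) / p) * (k powr (\<alpha> / p) * k powr ((\<beta> - p) / p))"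
    by (simp add: powr_mult)
  also have "\<dots> = k powr ?s * (\<mu>\<^sub>2 * \<tau> powr ?s + \<beta> * \<gamma> / (\<alpha> + \<beta>) * \<tau> powr ((\<beta> - p) / p))"
    unfolding e2 by (simp add: algebra_simps)
  finally have 2: "\<mu>\<^sub>2 * (\<tau> * k) powr ?s + \<beta> * \<gamma> / (\<alpha> + \<beta>) * k powr (\<alpha> / p) * (\<tau> * k) powr ((\<beta> - p) / p) = 1"
    unfolding root ks .
  show ?thesis
    using 1 2 k \<tau> by (simp add: coupling_system_def Let_def)
qed

text \<open>As \<open>\<gamma>\<close> tends to 0 the quotient equation tends to
  \<open>\<mu>\<^sub>2 * \<tau> powr s = \<mu>\<^sub>1\<close>, whose root persists. For every
  positive \<open>\<gamma>\<close> the term with the negative exponent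
  \<open>(\<beta> - p) / p\<close> blows up at 0, creating a further sign change near 0. Both values
  of k are close to one limit when \<open>\<gamma>\<close> is small, so the larger quotient has the
  larger sum.\<close>

lemma two_coupling_solutions:
  fixes p \<alpha> \<beta> \<mu>\<^sub>1 \<mu>\<^sub>2 :: real
  assumes p: "p > 0" and \<alpha>: "\<alpha> > 0" and \<beta>: "\<beta> > 0" "\<beta> < p" and sum: "\<alpha> + \<beta> > p"
    and \<mu>\<^sub>1: "\<mu>\<^sub>1 > 0" and \<mu>\<^sub>2: "\<mu>\<^sub>2 > 0"
  shows "\<exists>\<delta>>0. \<forall>\<gamma>. 0 < \<gamma> \<and> \<gamma> < \<delta> \<longrightarrow> (\<exists>k l k' l'.
     coupling_system p \<alpha> \<beta> \<mu>\<^sub>1 \<mu>\<^sub>2 \<gamma> k l \<and> coupling_system p \<alpha> \<beta> \<mu>\<^sub>1 \<mu>\<^sub>2 \<gamma> k' l' \<and> k' + l' < k + l)"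
proof -
  define s where "s = (\<alpha> + \<beta> - p) / p"
  have s: "s > 0" using sum p by (simp add: s_def)
  define h where "h \<gamma> \<tau> = \<mu>\<^sub>2 * \<tau> powr s + \<beta> * \<gamma> / (\<alpha> + \<beta>) * \<tau> powr ((\<beta> - p) / p)
       - (\<mu>\<^sub>1 + \<alpha> * \<gamma> / (\<alpha> + \<beta>) * \<tau> powr (\<beta> / p))" for \<gamma> \<tau>
  \<comment> \<open>The factors 1/2 and 2 put \<open>t\<^sub>1\<close> and \<open>t\<^sub>2\<close>
    on either side of the limiting root: there the limit of \<open>h\<close> equals
    \<open>- \<mu>\<^sub>1 / 2\<close> and \<open>\<mu>\<^sub>1\<close>.\<close>
  define t\<^sub>1 where "t\<^sub>1 = (\<mu>\<^sub>1 / (2 * \<mu>\<^sub>2)) powr (1 / s)"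
  define t\<^sub>2 where "t\<^sub>2 = (2 * \<mu>\<^sub>1 / \<mu>\<^sub>2) powr (1 / s)"
  \<comment> \<open>Any number strictly between 0 and \<open>t\<^sub>1\<close> would do. The gap
    below \<open>t\<^sub>1\<close> keeps the two roots apart and makes the comparison of sums
    strict.\<close>
  define t\<^sub>0 where "t\<^sub>0 = t\<^sub>1 / 2"
  have t1: "t\<^sub>1 > 0" "t\<^sub>1 powr s = \<mu>\<^sub>1 / (2 * \<mu>\<^sub>2)" and t2: "t\<^sub>2 > 0" "t\<^sub>2 powr s = 2 * \<mu>\<^sub>1 / \<mu>\<^sub>2"
    using \<mu>\<^sub>1 \<mu>\<^sub>2 s by (simp_all add: t\<^sub>1_def t\<^sub>2_def powr_powr)
  have t0: "t\<^sub>0 > 0" "t\<^sub>0 < t\<^sub>1" using t1 by (auto simp: t\<^sub>0_def)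
  then have t0s: "t\<^sub>0 powr s < \<mu>\<^sub>1 / (2 * \<mu>\<^sub>2)"
    unfolding t1(2)[symmetric] using s by (intro powr_less_mono2) auto
  have "t\<^sub>1 < t\<^sub>2"
    unfolding t\<^sub>1_def t\<^sub>2_def using \<mu>\<^sub>1 \<mu>\<^sub>2 s by (intro powr_less_mono2) (auto simp: field_simps)
  define P where "P \<tau> \<gamma> = (\<mu>\<^sub>1 + \<alpha> * \<gamma> / (\<alpha> + \<beta>) * \<tau> powr (\<beta> / p)) powr (- p / (\<alpha> + \<beta> - p))" for \<tau> \<gamma>
  have h_lim: "((\<lambda>\<gamma>. h \<gamma> \<tau>) \<longlongrightarrow> \<mu>\<^sub>2 * \<tau> powr s - \<mu>\<^sub>1) (at_right 0)" for \<tau>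
  proof -
    have "((\<lambda>\<gamma>. h \<gamma> \<tau>) \<longlongrightarrow> h 0 \<tau>) (at_right 0)"
      unfolding h_def using \<alpha> \<beta> by (intro tendsto_intros) auto
    then show ?thesis by (simp add: h_def)
  qed
  have P_lim: "((\<lambda>\<gamma>. (1 + t\<^sub>1) * P t\<^sub>2 \<gamma>) \<longlongrightarrow> (1 + t\<^sub>1) * P t\<^sub>2 0) (at_right 0)"
    unfolding P_def using \<alpha> \<beta> \<mu>\<^sub>1 by (intro tendsto_intros) auto
  \<comment> \<open>At \<open>\<gamma> = 0\<close> the value of k no longer depends on the quotient;
    \<open>P t\<^sub>2 0\<close> below is just a name for this common limit.\<close>
  have P0: "P \<tau> 0 = \<mu>\<^sub>1 powr (- p / (\<alpha> + \<beta> - p))" for \<tau>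
    by (simp add: P_def)
  have "\<forall>\<^sub>F \<gamma> in at_right 0. h \<gamma> t\<^sub>0 < 0 \<and> h \<gamma> t\<^sub>1 < 0 \<and> h \<gamma> t\<^sub>2 > 0 \<and>
      (1 + t\<^sub>0) * P t\<^sub>2 0 < (1 + t\<^sub>1) * P t\<^sub>2 \<gamma>"
  proof (intro eventually_conj)
    show "\<forall>\<^sub>F \<gamma> in at_right 0. h \<gamma> t\<^sub>0 < 0"
      by (rule order_tendstoD(2)[OF h_lim]) (use t0s \<mu>\<^sub>1 \<mu>\<^sub>2 in \<open>simp add: field_simps\<close>)
    show "\<forall>\<^sub>F \<gamma> in at_right 0. h \<gamma> t\<^sub>1 < 0"
      by (rule order_tendstoD(2)[OF h_lim]) (use t1 \<mu>\<^sub>1 \<mu>\<^sub>2 in \<open>simp add: field_simps\<close>)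
    show "\<forall>\<^sub>F \<gamma> in at_right 0. h \<gamma> t\<^sub>2 > 0"
      by (rule order_tendstoD(1)[OF h_lim]) (use t2 \<mu>\<^sub>1 \<mu>\<^sub>2 in \<open>simp add: field_simps\<close>)
    show "\<forall>\<^sub>F \<gamma> in at_right 0. (1 + t\<^sub>0) * P t\<^sub>2 0 < (1 + t\<^sub>1) * P t\<^sub>2 \<gamma>"
      by (rule order_tendstoD(1)[OF P_lim]) (use t0 \<mu>\<^sub>1 in \<open>simp add: P0\<close>)
  qed
  then obtain \<delta> where \<delta>: "\<delta> > 0" and small: "\<And>\<gamma>. 0 < \<gamma> \<Longrightarrow> \<gamma> < \<delta> \<Longrightarrow>
      h \<gamma> t\<^sub>0 < 0 \<and> h \<gamma> t\<^sub>1 < 0 \<and> h \<gamma> t\<^sub>2 > 0 \<and> (1 + t\<^sub>0) * P t\<^sub>2 0 < (1 + t\<^sub>1) * P t\<^sub>2 \<gamma>"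
    unfolding eventually_at_right_field by auto
  have main: "\<exists>k l k' l'. coupling_system p \<alpha> \<beta> \<mu>\<^sub>1 \<mu>\<^sub>2 \<gamma> k l \<and> coupling_system p \<alpha> \<beta> \<mu>\<^sub>1 \<mu>\<^sub>2 \<gamma> k' l' \<and> k' + l' < k + l"
    if \<gamma>: "0 < \<gamma>" "\<gamma> < \<delta>" for \<gamma>
  proof -
    note sm = small[OF \<gamma>]
    have cont: "continuous_on {u..v} (h \<gamma>)" if "u > 0" for u v
      unfolding h_def using that \<alpha> \<beta> by (intro continuous_intros) auto
    have "\<exists>\<tau>\<ge>t\<^sub>1. \<tau> \<le> t\<^sub>2 \<and> h \<gamma> \<tau> = 0"
      by (rule IVT') (use sm \<open>t\<^sub>1 < t\<^sub>2\<close> cont t1 in auto)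
    then obtain \<tau> where \<tau>: "t\<^sub>1 \<le> \<tau>" "\<tau> \<le> t\<^sub>2" "h \<gamma> \<tau> = 0" by blast
    define c where "c = \<beta> * \<gamma> / (\<alpha> + \<beta>)"
    define D where "D = \<mu>\<^sub>1 + \<alpha> * \<gamma> / (\<alpha> + \<beta>) * t\<^sub>0 powr (\<beta> / p)"
    have c: "c > 0" using \<alpha> \<beta> \<gamma> by (simp add: c_def)
    have D: "D > 0" unfolding D_def using \<alpha> \<beta> \<gamma> \<mu>\<^sub>1 by (intro add_pos_nonneg) auto
    \<comment> \<open>\<open>D\<close> bounds the negative part of \<open>h\<close> on the interval
      up to \<open>t\<^sub>0\<close>, and at \<open>x\<close> the singular term alone equals
      \<open>D\<close>. Hence \<open>h\<close> is nonnegative at every point below both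
      \<open>x\<close> and \<open>t\<^sub>0\<close>.\<close>
    define x where "x = (D / c) powr (p / (\<beta> - p))"
    have x: "x > 0" "c * x powr ((\<beta> - p) / p) = D"
      using c D p \<beta> by (simp_all add: x_def powr_powr)
    define t\<^sub>3 where "t\<^sub>3 = min x t\<^sub>0"
    have t3: "0 < t\<^sub>3" "t\<^sub>3 \<le> t\<^sub>0" "t\<^sub>3 \<le> x" using x t0 by (auto simp: t\<^sub>3_def)
    have "D \<le> c * t\<^sub>3 powr ((\<beta> - p) / p)"
      unfolding x(2)[symmetric] using c t3 p \<beta> by (intro mult_left_mono powr_mono2') (auto simp: field_simps)
    moreover have "\<mu>\<^sub>1 + \<alpha> * \<gamma> / (\<alpha> + \<beta>) * t\<^sub>3 powr (\<beta> / p) \<le> D"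
      unfolding D_def using t3 p \<alpha> \<beta> \<gamma> by (intro add_left_mono mult_left_mono powr_mono2) auto
    moreover have "\<mu>\<^sub>2 * t\<^sub>3 powr s > 0" using t3 \<mu>\<^sub>2 by simp
    ultimately have "h \<gamma> t\<^sub>3 \<ge> 0" by (simp add: h_def c_def)
    then have "\<exists>\<sigma>\<ge>t\<^sub>3. \<sigma> \<le> t\<^sub>0 \<and> h \<gamma> \<sigma> = 0"
      by (intro IVT2') (use sm cont t3 in auto)
    then obtain \<sigma> where \<sigma>: "t\<^sub>3 \<le> \<sigma>" "\<sigma> \<le> t\<^sub>0" "h \<gamma> \<sigma> = 0" by blast
    have pos: "\<tau> > 0" "\<sigma> > 0" using \<tau> \<sigma> t1 t3 by auto
    have sys: "coupling_system p \<alpha> \<beta> \<mu>\<^sub>1 \<mu>\<^sub>2 \<gamma> (P t \<gamma>) (t * P t \<gamma>)" if "h \<gamma> t = 0" "t > 0" for t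
      unfolding P_def using that by (intro coupling_system_of_quotient) (use assms \<gamma> in \<open>auto simp: h_def s_def\<close>)
    have neg: "- p / (\<alpha> + \<beta> - p) \<le> 0" using p sum by simp
    \<comment> \<open>\<open>P\<close> decreases in both arguments, so the small root is compared
      with the limit value at \<open>\<gamma> = 0\<close> and the large root with the value at
      \<open>t\<^sub>2\<close>; the choice of \<open>\<delta>\<close> closes the gap between
      them.\<close>
    have "(1 + \<sigma>) * P \<sigma> \<gamma> \<le> (1 + t\<^sub>0) * P t\<^sub>2 0"
    proof (rule mult_mono)
      show "P \<sigma> \<gamma> \<le> P t\<^sub>2 0"
        unfolding P0 unfolding P_def using neg \<mu>\<^sub>1 \<alpha> \<beta> \<gamma> by (intro powr_mono2') auto
    qed (use \<sigma> pos in \<open>auto simp: P_def\<close>)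
    also have "\<dots> < (1 + t\<^sub>1) * P t\<^sub>2 \<gamma>" using sm by blast
    also have "\<dots> \<le> (1 + \<tau>) * P \<tau> \<gamma>"
    proof (rule mult_mono)
      show "P t\<^sub>2 \<gamma> \<le> P \<tau> \<gamma>"
        unfolding P_def
      proof (rule powr_mono2'[OF neg])
        show "0 < \<mu>\<^sub>1 + \<alpha> * \<gamma> / (\<alpha> + \<beta>) * \<tau> powr (\<beta> / p)"
          using \<alpha> \<beta> \<gamma> \<mu>\<^sub>1 by (intro add_pos_nonneg) auto
        show "\<mu>\<^sub>1 + \<alpha> * \<gamma> / (\<alpha> + \<beta>) * \<tau> powr (\<beta> / p) \<le> \<mu>\<^sub>1 + \<alpha> * \<gamma> / (\<alpha> + \<beta>) * t\<^sub>2 powr (\<beta> / p)"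
          using \<tau> pos p \<alpha> \<beta> \<gamma> by (intro add_left_mono mult_left_mono powr_mono2) auto
      qed
    qed (use \<tau> pos in \<open>auto simp: P_def\<close>)
    finally have "P \<sigma> \<gamma> + \<sigma> * P \<sigma> \<gamma> < P \<tau> \<gamma> + \<tau> * P \<tau> \<gamma>"
      by (simp add: algebra_simps)
    with sys[OF \<tau>(3) pos(1)] sys[OF \<sigma>(3) pos(2)] show ?thesis by blast
  qed
  with \<delta> show ?thesis by blast
qed

subsection \<open>The energy on the Nehari set\<close>

lemma has_weak_gradient_cong_AE:
  fixes u u' :: "real ^ 'n \<Rightarrow> real"
  assumes u: "has_weak_gradient u g" and m: "u' \<in> borel_measurable lebesgue"
    and eq: "AE x in lebesgue. u x = u' x"
  shows "has_weak_gradient u' g"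
  unfolding has_weak_gradient_def
proof (intro conjI allI impI)
  have li: "locally_integrable u" "locally_integrable g"
    using u by (auto simp: has_weak_gradient_def)
  show "locally_integrable g" by (rule li(2))
  have mu: "u \<in> borel_measurable lebesgue" by (rule locally_integrable_borel_measurable[OF li(1)])
  show "locally_integrable u'"
    unfolding locally_integrable_def set_integrable_def
  proof (intro allI impI)
    fix K :: "(real ^ 'n) set" assume K: "compact K"
    then have mK: "(\<lambda>x. indicator K x :: real) \<in> borel_measurable lebesgue"
      by (intro borel_measurable_indicator) (simp add: borel_compact sets_completionI_sets)
    have "AE x in lebesgue. indicator K x *\<^sub>R u x = indicator K x *\<^sub>R u' x"
      using eq by eventually_elim simp
    moreover have "integrable lebesgue (\<lambda>x. indicator K x *\<^sub>R u x)"
      using li(1) K by (simp add: locally_integrable_def set_integrable_def)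
    ultimately show "integrable lebesgue (\<lambda>x. indicator K x *\<^sub>R u' x)"
      using integrable_cong_AE[of "\<lambda>x. indicator K x *\<^sub>R u x" lebesgue "\<lambda>x. indicator K x *\<^sub>R u' x"]
        borel_measurable_scaleR[OF mK mu] borel_measurable_scaleR[OF mK m] by blast
  qed
  fix \<phi> :: "real ^ 'n \<Rightarrow> real" and d\<phi>
  assume \<phi>: "C1c_with_gradient \<phi> d\<phi>"
  have md: "d\<phi> \<in> borel_measurable lebesgue"
    by (rule continuous_imp_borel_measurable_lebesgue[OF C1c_continuous(2)[OF \<phi>]])
  have "(LINT x|lebesgue. u' x *\<^sub>R d\<phi> x) = (LINT x|lebesgue. u x *\<^sub>R d\<phi> x)"
  proof (rule integral_cong_AE)
    show "AE x in lebesgue. u' x *\<^sub>R d\<phi> x = u x *\<^sub>R d\<phi> x"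
      using eq by eventually_elim simp
  qed (intro borel_measurable_scaleR md m mu)+
  also have "\<dots> = - (LINT x|lebesgue. \<phi> x *\<^sub>R g x)"
    using u \<phi> unfolding has_weak_gradient_def by blast
  finally show "(LINT x|lebesgue. u' x *\<^sub>R d\<phi> x) = - (LINT x|lebesgue. \<phi> x *\<^sub>R g x)" .
qed

lemma wgrad_cong_AE:
  assumes "u \<in> D1p p" "u' \<in> D1p p" "AE x in lebesgue. u x = u' x"
  shows "AE x in lebesgue. wgrad u x = wgrad u' x"
proof (rule wgrad_AE_eq)
  have "AE x in lebesgue. u' x = u x"
    using assms(3) by eventually_elim simp
  then show "has_weak_gradient u (wgrad u')"
    by (rule has_weak_gradient_cong_AE[OF D1pD(1)[OF assms(2)] D1pD(4)[OF assms(1)]])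
qed

text \<open>This separates solutions: pairs with different energies cannot agree a.e. in both
  components.\<close>

lemma energy_cong_AE:
  assumes u: "u \<in> D1p p" "u' \<in> D1p p" "AE x in lebesgue. u x = u' x"
    and v: "v \<in> D1p p" "v' \<in> D1p p" "AE x in lebesgue. v x = v' x"
  shows "energy p \<alpha> \<beta> \<mu>\<^sub>1 \<mu>\<^sub>2 \<gamma> u v = energy p \<alpha> \<beta> \<mu>\<^sub>1 \<mu>\<^sub>2 \<gamma> u' v'"
proof -
  note [measurable] = D1pD(4,5)[OF u(1)] D1pD(4,5)[OF u(2)] D1pD(4,5)[OF v(1)] D1pD(4,5)[OF v(2)]
  let ?ps = "crit_exp (real CARD('a)) p"
  have 1: "(LINT x|lebesgue. norm (wgrad u x) powr p + norm (wgrad v x) powr p)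
      = (LINT x|lebesgue. norm (wgrad u' x) powr p + norm (wgrad v' x) powr p)"
  proof (rule integral_cong_AE)
    show "AE x in lebesgue. norm (wgrad u x) powr p + norm (wgrad v x) powr p
        = norm (wgrad u' x) powr p + norm (wgrad v' x) powr p"
      using wgrad_cong_AE[OF u] wgrad_cong_AE[OF v] by eventually_elim simp
  qed measurable
  have 2: "(LINT x|lebesgue. \<mu>\<^sub>1 * \<bar>u x\<bar> powr ?ps + \<mu>\<^sub>2 * \<bar>v x\<bar> powr ?ps + \<gamma> * \<bar>u x\<bar> powr \<alpha> * \<bar>v x\<bar> powr \<beta>)
      = (LINT x|lebesgue. \<mu>\<^sub>1 * \<bar>u' x\<bar> powr ?ps + \<mu>\<^sub>2 * \<bar>v' x\<bar> powr ?ps + \<gamma> * \<bar>u' x\<bar> powr \<alpha> * \<bar>v' x\<bar> powr \<beta>)"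
  proof (rule integral_cong_AE)
    show "AE x in lebesgue. \<mu>\<^sub>1 * \<bar>u x\<bar> powr ?ps + \<mu>\<^sub>2 * \<bar>v x\<bar> powr ?ps + \<gamma> * \<bar>u x\<bar> powr \<alpha> * \<bar>v x\<bar> powr \<beta>
        = \<mu>\<^sub>1 * \<bar>u' x\<bar> powr ?ps + \<mu>\<^sub>2 * \<bar>v' x\<bar> powr ?ps + \<gamma> * \<bar>u' x\<bar> powr \<alpha> * \<bar>v' x\<bar> powr \<beta>"
      using u(3) v(3) by eventually_elim simp
  qed measurable
  show ?thesis unfolding energy_def Let_def 1 2 ..
qed

text \<open>Adding the two Nehari identities recovers the whole potential term, because the coupling
  weights satisfy \<open>(\<alpha> + \<beta>) / ps = 1\<close>.\<close>

lemma energy_on_nehari: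
  fixes u v :: "real ^ 'n \<Rightarrow> real"
  assumes uv: "(u, v) \<in> nehari p \<alpha> \<beta> \<mu>\<^sub>1 \<mu>\<^sub>2 \<gamma>"
    and \<alpha>\<beta>: "\<alpha> > 0" "\<beta> > 0" "\<alpha> + \<beta> = crit_exp (real CARD('n)) p"
  shows "energy p \<alpha> \<beta> \<mu>\<^sub>1 \<mu>\<^sub>2 \<gamma> u v = (1 / p - 1 / (\<alpha> + \<beta>)) *
     ((LINT x|lebesgue. norm (wgrad u x) powr p) + (LINT x|lebesgue. norm (wgrad v x) powr p))"
proof -
  define s where "s = crit_exp (real CARD('n)) p"
  have u: "u \<in> D1p p" and v: "v \<in> D1p p" using uv by (auto simp: nehari_def Let_def)
  let ?Gu = "LINT x|lebesgue. norm (wgrad u x) powr p" and ?Gv = "LINT x|lebesgue. norm (wgrad v x) powr p"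
  let ?c = "\<lambda>x. \<bar>u x\<bar> powr \<alpha> * \<bar>v x\<bar> powr \<beta>"
  have iu: "integrable lebesgue (\<lambda>x. \<bar>u x\<bar> powr s)" and iv: "integrable lebesgue (\<lambda>x. \<bar>v x\<bar> powr s)"
    using D1pD(6)[OF u] D1pD(6)[OF v] by (simp_all add: s_def)
  have ic: "integrable lebesgue ?c"
    by (rule integrable_powr_mult[OF D1pD(4)[OF u] D1pD(4)[OF v] iu iv]) (use \<alpha>\<beta> in \<open>auto simp: s_def\<close>)
  have s: "s > 0" "\<alpha> + \<beta> = s" using \<alpha>\<beta> by (auto simp: s_def)
  have Gu: "?Gu = \<mu>\<^sub>1 * (LINT x|lebesgue. \<bar>u x\<bar> powr s) + \<alpha> * \<gamma> / s * integral\<^sup>L lebesgue ?c"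
  proof -
    have "?Gu = (LINT x|lebesgue. \<mu>\<^sub>1 * \<bar>u x\<bar> powr s + \<alpha> * \<gamma> / s * ?c x)"
      using uv unfolding nehari_def Let_def s_def[symmetric] by (simp add: mult.assoc)
    then show ?thesis using iu ic by simp
  qed
  have Gv: "?Gv = \<mu>\<^sub>2 * (LINT x|lebesgue. \<bar>v x\<bar> powr s) + \<beta> * \<gamma> / s * integral\<^sup>L lebesgue ?c"
  proof -
    have "?Gv = (LINT x|lebesgue. \<mu>\<^sub>2 * \<bar>v x\<bar> powr s + \<beta> * \<gamma> / s * ?c x)"
      using uv unfolding nehari_def Let_def s_def[symmetric] by (simp add: mult.assoc)
    then show ?thesis using iv ic by simp
  qed
  have "(LINT x|lebesgue. \<mu>\<^sub>1 * \<bar>u x\<bar> powr s + \<mu>\<^sub>2 * \<bar>v x\<bar> powr s + \<gamma> * \<bar>u x\<bar> powr \<alpha> * \<bar>v x\<bar> powr \<beta>)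
      = (LINT x|lebesgue. \<mu>\<^sub>1 * \<bar>u x\<bar> powr s + \<mu>\<^sub>2 * \<bar>v x\<bar> powr s + \<gamma> * ?c x)"
    by (simp add: mult.assoc)
  also have "\<dots> = \<mu>\<^sub>1 * (LINT x|lebesgue. \<bar>u x\<bar> powr s) + \<mu>\<^sub>2 * (LINT x|lebesgue. \<bar>v x\<bar> powr s) + \<gamma> * integral\<^sup>L lebesgue ?c"
    using iu iv ic by simp
  also have "\<gamma> * integral\<^sup>L lebesgue ?c = \<alpha> * \<gamma> / s * integral\<^sup>L lebesgue ?c + \<beta> * \<gamma> / s * integral\<^sup>L lebesgue ?c"
    unfolding distrib_right[symmetric] add_divide_distrib[symmetric] s(2)[symmetric] using \<alpha>\<beta> by (simp add: field_simps)
  finally have "(LINT x|lebesgue. \<mu>\<^sub>1 * \<bar>u x\<bar> powr s + \<mu>\<^sub>2 * \<bar>v x\<bar> powr s + \<gamma> * \<bar>u x\<bar> powr \<alpha> * \<bar>v x\<bar> powr \<beta>) = ?Gu + ?Gv"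
    unfolding Gu Gv by simp
  moreover have "(LINT x|lebesgue. norm (wgrad u x) powr p + norm (wgrad v x) powr p) = ?Gu + ?Gv"
    using D1pD(7)[OF u] D1pD(7)[OF v] by simp
  ultimately show ?thesis
    unfolding energy_def Let_def s_def[symmetric] s(2) by (simp add: left_diff_distrib)
qed

lemma least_energy_le:
  fixes u v :: "real ^ 'n \<Rightarrow> real"
  assumes uv: "(u, v) \<in> nehari p \<alpha> \<beta> \<mu>\<^sub>1 \<mu>\<^sub>2 \<gamma>"
    and \<alpha>\<beta>: "\<alpha> > 0" "\<beta> > 0" "\<alpha> + \<beta> = crit_exp (real CARD('n)) p" and p: "p > 0" "\<alpha> + \<beta> > p"
  shows "least_energy TYPE('n) p \<alpha> \<beta> \<mu>\<^sub>1 \<mu>\<^sub>2 \<gamma> \<le> energy p \<alpha> \<beta> \<mu>\<^sub>1 \<mu>\<^sub>2 \<gamma> u v"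
proof -
  let ?E = "\<lambda>(u :: real ^ 'n \<Rightarrow> real, v). energy p \<alpha> \<beta> \<mu>\<^sub>1 \<mu>\<^sub>2 \<gamma> u v"
  have "bdd_below (?E ` nehari p \<alpha> \<beta> \<mu>\<^sub>1 \<mu>\<^sub>2 \<gamma>)"
  proof (rule bdd_belowI2)
    fix z :: "(real ^ 'n \<Rightarrow> real) \<times> (real ^ 'n \<Rightarrow> real)"
    assume z: "z \<in> nehari p \<alpha> \<beta> \<mu>\<^sub>1 \<mu>\<^sub>2 \<gamma>"
    have "1 / (\<alpha> + \<beta>) \<le> 1 / p" using p by (intro divide_left_mono) auto
    then show "0 \<le> ?E z"
      using z energy_on_nehari[of "fst z" "snd z"] \<alpha>\<beta>
      by (cases z) (auto intro!: mult_nonneg_nonneg add_nonneg_nonneg Bochner_Integration.integral_nonneg)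
  qed
  then have "Inf (?E ` nehari p \<alpha> \<beta> \<mu>\<^sub>1 \<mu>\<^sub>2 \<gamma>) \<le> ?E (u, v)"
    by (rule cINF_lower) (rule uv)
  then show ?thesis by (simp add: least_energy_def)
qed

text \<open>The Nehari identities are the weak equations tested with \<open>u\<close> and with
  \<open>v\<close>.\<close>

lemma weak_solution_in_nehari:
  fixes u v :: "real ^ 'n \<Rightarrow> real"
  assumes sol: "weak_solution p \<alpha> \<beta> \<mu>\<^sub>1 \<mu>\<^sub>2 \<gamma> u v"
    and "\<not> (AE x in lebesgue. u x = 0)" "\<not> (AE x in lebesgue. v x = 0)"
  shows "(u, v) \<in> nehari p \<alpha> \<beta> \<mu>\<^sub>1 \<mu>\<^sub>2 \<gamma>"
proof -
  define s where "s = crit_exp (real CARD('n)) p"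
  have u: "u \<in> D1p p" and v: "v \<in> D1p p" using sol by (auto simp: weak_solution_def Let_def)
  have sq: "norm z powr (m - 2) * (z \<bullet> z) = norm z powr m" for m and z :: "'b::real_inner"
    using powr_diff_two_mult(2)[of "norm z" m] by (simp add: power2_norm_eq_inner)
  have sqr: "\<bar>r\<bar> powr (m - 2) * r * r = \<bar>r\<bar> powr m" for m r :: real
    using sq[of r m] by (simp add: mult.assoc)
  have "(LINT x|lebesgue. norm (wgrad u x) powr (p - 2) * (wgrad u x \<bullet> wgrad u x)) =
          (LINT x|lebesgue. (\<mu>\<^sub>1 * \<bar>u x\<bar> powr (s - 2) * u x
              + \<alpha> * \<gamma> / s * \<bar>u x\<bar> powr (\<alpha> - 2) * u x * \<bar>v x\<bar> powr \<beta>) * u x)"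
    using sol u unfolding weak_solution_def Let_def s_def[symmetric] by blast
  also have "\<dots> = (LINT x|lebesgue. \<mu>\<^sub>1 * (\<bar>u x\<bar> powr (s - 2) * u x * u x)
              + \<alpha> * \<gamma> / s * (\<bar>u x\<bar> powr (\<alpha> - 2) * u x * u x) * \<bar>v x\<bar> powr \<beta>)"
    by (simp add: algebra_simps)
  finally have 1: "(LINT x|lebesgue. norm (wgrad u x) powr p) = (LINT x|lebesgue. \<mu>\<^sub>1 * \<bar>u x\<bar> powr s
              + \<alpha> * \<gamma> / s * \<bar>u x\<bar> powr \<alpha> * \<bar>v x\<bar> powr \<beta>)"
    unfolding sq sqr .
  have "(LINT x|lebesgue. norm (wgrad v x) powr (p - 2) * (wgrad v x \<bullet> wgrad v x)) =
          (LINT x|lebesgue. (\<mu>\<^sub>2 * \<bar>v x\<bar> powr (s - 2) * v x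
              + \<beta> * \<gamma> / s * \<bar>u x\<bar> powr \<alpha> * \<bar>v x\<bar> powr (\<beta> - 2) * v x) * v x)"
    using sol v unfolding weak_solution_def Let_def s_def[symmetric] by blast
  also have "\<dots> = (LINT x|lebesgue. \<mu>\<^sub>2 * (\<bar>v x\<bar> powr (s - 2) * v x * v x)
              + \<beta> * \<gamma> / s * \<bar>u x\<bar> powr \<alpha> * (\<bar>v x\<bar> powr (\<beta> - 2) * v x * v x))"
    by (simp add: algebra_simps)
  finally have 2: "(LINT x|lebesgue. norm (wgrad v x) powr p) = (LINT x|lebesgue. \<mu>\<^sub>2 * \<bar>v x\<bar> powr s
              + \<beta> * \<gamma> / s * \<bar>u x\<bar> powr \<alpha> * \<bar>v x\<bar> powr \<beta>)"
    unfolding sq sqr .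
  show ?thesis
    using u v assms(2,3) 1 2 by (simp add: nehari_def Let_def s_def)
qed

subsection \<open>Multiples of a bubble as solutions of the system\<close>

lemma not_AE_lebesgue_False: "\<not> (AE x in (lebesgue :: (real ^ 'n) measure). False)"
proof
  assume "AE x in (lebesgue :: (real ^ 'n) measure). False"
  then have "emeasure (lebesgue :: (real ^ 'n) measure) UNIV = 0"
    by (simp add: AE_iff_null null_sets_def)
  then show False by simp
qed

lemma D1p_scale:
  fixes u :: "real ^ 'n \<Rightarrow> real"
  assumes u: "u \<in> D1p p"
  shows "(\<lambda>x. c * u x) \<in> D1p p"
proof -
  note [measurable] = D1pD(4,5)[OF u]
  have "has_weak_gradient (\<lambda>x. c * u x) (\<lambda>x. c *\<^sub>R wgrad u x)"
    using has_weak_gradient_lincomb[OF D1pD(1)[OF u] D1pD(1)[OF u], of c 0] by simp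
  moreover have "in_Lp p (\<lambda>x. norm (c *\<^sub>R wgrad u x))"
    using D1pD(7)[OF u] by (simp add: in_Lp_def powr_mult abs_mult)
  moreover have "in_Lp (crit_exp (real CARD('n)) p) (\<lambda>x. c * u x)"
    using D1pD(6)[OF u] by (simp add: in_Lp_def powr_mult abs_mult)
  ultimately show ?thesis
    unfolding D1p_def by blast
qed

context
  fixes p \<epsilon> :: real and y :: "real ^ 'n" and ps :: real
  assumes p: "1 < p" "p < real CARD('n)" and \<epsilon>: "\<epsilon> > 0"
    and ps: "ps = crit_exp (real CARD('n)) p"
begin

text \<open>Each \<open>refl\<close> instantiates one of the abbreviations \<open>N\<close>,
  \<open>q\<close>, \<open>s\<close>, \<open>a\<close>, \<open>K\<close> of the earlier context by
  its defining term.\<close>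

private lemmas bubble_facts = p \<epsilon> refl ps refl refl refl refl

lemma wgrad_scaled_bubble:
  "AE x in lebesgue. wgrad (\<lambda>x. c * bubble p \<epsilon> y x) x = c *\<^sub>R bubble_grad p \<epsilon> y x"
proof (rule wgrad_AE_eq)
  show "has_weak_gradient (\<lambda>x. c * bubble p \<epsilon> y x) (\<lambda>x. c *\<^sub>R bubble_grad p \<epsilon> y x)"
    using has_weak_gradient_lincomb[of "bubble p \<epsilon> y" "bubble_grad p \<epsilon> y" "bubble p \<epsilon> y" "bubble_grad p \<epsilon> y" c 0]
      bubble_has_weak_gradient[OF bubble_facts, of y] by simp
qed

lemma scaled_bubble_D1p: "(\<lambda>x. c * bubble p \<epsilon> y x) \<in> D1p p"
  by (rule D1p_scale) (rule bubble_D1p[OF bubble_facts])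

lemma bubble_grad_measurable: "bubble_grad p \<epsilon> y \<in> borel_measurable lebesgue"
  using C1_bubble[OF bubble_facts, of y]
  by (auto simp: C1_with_gradient_def intro: continuous_imp_borel_measurable_lebesgue)

lemma integral_scaled_bubble_grad:
  assumes "k > 0"
  shows "(LINT x|lebesgue. norm (wgrad (\<lambda>x. k powr (1 / p) * bubble p \<epsilon> y x) x) powr p)
     = k * (LINT x|lebesgue. norm (bubble_grad p \<epsilon> y x) powr p)"
proof -
  note [measurable] = bubble_grad_measurable D1pD(5)[OF scaled_bubble_D1p]
  have "(LINT x|lebesgue. norm (wgrad (\<lambda>x. k powr (1 / p) * bubble p \<epsilon> y x) x) powr p)
      = (LINT x|lebesgue. k * norm (bubble_grad p \<epsilon> y x) powr p)"
  proof (rule integral_cong_AE)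
    show "AE x in lebesgue. norm (wgrad (\<lambda>x. k powr (1 / p) * bubble p \<epsilon> y x) x) powr p
        = k * norm (bubble_grad p \<epsilon> y x) powr p"
      using wgrad_scaled_bubble[of "k powr (1 / p)"]
      by eventually_elim (use p assms in \<open>simp add: powr_mult powr_powr\<close>)
  qed measurable
  then show ?thesis by simp
qed

text \<open>Testing the equation of the bubble with the bubble itself turns the gradient integral
  into the integral of \<open>bubble powr ps\<close>, whose integrand is positive
  everywhere.\<close>

lemma integral_bubble_grad_pos: "(LINT x|lebesgue. norm (bubble_grad p \<epsilon> y x) powr p) > 0"
proof -
  have U: "bubble p \<epsilon> y x > 0" for x by (rule bubble_pos[OF bubble_facts])
  have int: "integrable lebesgue (\<lambda>x. bubble p \<epsilon> y x powr ps)"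
    using bubble_in_Lp[OF bubble_facts, of y] U by (simp add: in_Lp_def abs_of_pos)
  have "(LINT x|lebesgue. norm (bubble_grad p \<epsilon> y x) powr p)
      = (LINT x|lebesgue. norm (bubble_grad p \<epsilon> y x) powr (p - 2) * (bubble_grad p \<epsilon> y x \<bullet> bubble_grad p \<epsilon> y x))"
    by (simp add: powr_diff_two_mult flip: power2_norm_eq_inner)
  also have "\<dots> = (LINT x|lebesgue. bubble p \<epsilon> y x powr (ps - 1) * bubble p \<epsilon> y x)"
    by (rule bubble_weak_equation[OF bubble_facts bubble_has_weak_gradient[OF bubble_facts]
          bubble_in_Lp[OF bubble_facts] bubble_grad_in_Lp[OF bubble_facts]])
  also have "\<dots> = (LINT x|lebesgue. bubble p \<epsilon> y x powr ps)"
    by (rule Bochner_Integration.integral_cong[OF refl]) (simp add: powr_diff abs_of_pos[OF U] less_imp_neq[OF U, symmetric])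
  finally have eq: "(LINT x|lebesgue. norm (bubble_grad p \<epsilon> y x) powr p) = (LINT x|lebesgue. bubble p \<epsilon> y x powr ps)" .
  have "(LINT x|lebesgue. bubble p \<epsilon> y x powr ps) \<noteq> 0"
  proof
    assume "(LINT x|lebesgue. bubble p \<epsilon> y x powr ps) = 0"
    then have "AE x in lebesgue. bubble p \<epsilon> y x powr ps = 0"
      using integral_nonneg_eq_0_iff_AE[OF int] by simp
    then have "AE x in (lebesgue :: (real ^ 'n) measure). False"
      by eventually_elim (use U in \<open>simp add: less_imp_neq[THEN not_sym]\<close>)
    then show False using not_AE_lebesgue_False by blast
  qed
  moreover have "(LINT x|lebesgue. bubble p \<epsilon> y x powr ps) \<ge> 0"
    by (rule Bochner_Integration.integral_nonneg) simp
  ultimately show ?thesis unfolding eq less_le by metis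
qed

text \<open>Stated for one equation with free coefficients \<open>\<mu>\<close> and
  \<open>d\<close>, so that the second equation of the system follows by exchanging the roles of the
  components.\<close>

lemma scaled_bubble_equation:
  assumes k: "k > 0" and l: "l > 0" and sum: "\<alpha> + \<beta> = ps"
    and sys: "\<mu> * k powr ((ps - p) / p) + d * k powr ((\<alpha> - p) / p) * l powr (\<beta> / p) = 1"
    and \<phi>: "\<phi> \<in> D1p p"
  defines "u \<equiv> \<lambda>x. k powr (1 / p) * bubble p \<epsilon> y x" and "v \<equiv> \<lambda>x. l powr (1 / p) * bubble p \<epsilon> y x"
  shows "(LINT x|lebesgue. norm (wgrad u x) powr (p - 2) * (wgrad u x \<bullet> wgrad \<phi> x)) =
    (LINT x|lebesgue. (\<mu> * (\<bar>u x\<bar> powr (ps - 2) * u x) + d * (\<bar>u x\<bar> powr (\<alpha> - 2) * u x) * \<bar>v x\<bar> powr \<beta>) * \<phi> x)"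
proof -
  have U: "bubble p \<epsilon> y x > 0" for x by (rule bubble_pos[OF bubble_facts])
  let ?c = "k powr (1 / p)"
  note [measurable] = bubble_grad_measurable D1pD(5)[OF scaled_bubble_D1p] D1pD(4,5)[OF \<phi>]
  have "(LINT x|lebesgue. norm (wgrad u x) powr (p - 2) * (wgrad u x \<bullet> wgrad \<phi> x))
      = (LINT x|lebesgue. ?c powr (p - 1) * (norm (bubble_grad p \<epsilon> y x) powr (p - 2) * (bubble_grad p \<epsilon> y x \<bullet> wgrad \<phi> x)))"
  proof (rule integral_cong_AE)
    show "AE x in lebesgue. norm (wgrad u x) powr (p - 2) * (wgrad u x \<bullet> wgrad \<phi> x)
       = ?c powr (p - 1) * (norm (bubble_grad p \<epsilon> y x) powr (p - 2) * (bubble_grad p \<epsilon> y x \<bullet> wgrad \<phi> x))"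
      using wgrad_scaled_bubble[of ?c] unfolding u_def
    proof eventually_elim
      case (elim x)
      have "norm (?c *\<^sub>R bubble_grad p \<epsilon> y x) powr (p - 2) = ?c powr (p - 2) * norm (bubble_grad p \<epsilon> y x) powr (p - 2)"
        by (simp add: powr_mult)
      then show ?case
        unfolding elim using powr_diff_two_mult(1)[of ?c p, symmetric] by (simp add: mult_ac)
    qed
  qed (unfold u_def, measurable)
  also have "\<dots> = ?c powr (p - 1) * (LINT x|lebesgue. bubble p \<epsilon> y x powr (ps - 1) * \<phi> x)"
    using bubble_weak_equation[OF bubble_facts, of \<phi> "wgrad \<phi>" y] D1pD(1-3)[OF \<phi>] by (simp add: ps)
  also have "\<dots> = (LINT x|lebesgue. ?c powr (p - 1) * bubble p \<epsilon> y x powr (ps - 1) * \<phi> x)"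
    by (simp add: mult.assoc)
  also have "\<dots> = (LINT x|lebesgue. (\<mu> * (\<bar>u x\<bar> powr (ps - 2) * u x) + d * (\<bar>u x\<bar> powr (\<alpha> - 2) * u x) * \<bar>v x\<bar> powr \<beta>) * \<phi> x)"
  proof (rule Bochner_Integration.integral_cong[OF refl])
    fix x
    let ?U = "bubble p \<epsilon> y x"
    have pos: "u x \<ge> 0" "v x \<ge> 0" using U[of x] by (auto simp: u_def v_def)
    have pw: "\<bar>u x\<bar> powr (m - 2) * u x = k powr ((m - 1) / p) * ?U powr (m - 1)" for m
    proof -
      have "\<bar>u x\<bar> powr (m - 2) * u x = u x powr (m - 1)"
        using pos powr_diff_two_mult(1)[of "u x" m] by simp
      then show ?thesis by (simp add: u_def powr_mult powr_powr)
    qed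
    have pv: "\<bar>v x\<bar> powr \<beta> = l powr (\<beta> / p) * ?U powr \<beta>"
      using pos by (simp add: v_def powr_mult powr_powr)
    \<comment> \<open>The left side carries \<open>?c powr (p - 1)\<close>; splitting off this
      factor on the right leaves exactly the exponents of the algebraic system.\<close>
    have e: "k powr ((ps - 1) / p) = ?c powr (p - 1) * k powr ((ps - p) / p)"
        "k powr ((\<alpha> - 1) / p) = ?c powr (p - 1) * k powr ((\<alpha> - p) / p)"
      unfolding powr_powr powr_add[symmetric] by (simp_all add: diff_divide_distrib)
    have eU: "?U powr (ps - 1) = ?U powr (\<alpha> - 1) * ?U powr \<beta>"
      unfolding powr_add[symmetric] using sum by (simp add: algebra_simps)
    have "\<mu> * (\<bar>u x\<bar> powr (ps - 2) * u x) + d * (\<bar>u x\<bar> powr (\<alpha> - 2) * u x) * \<bar>v x\<bar> powr \<beta>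
       = ?c powr (p - 1) * ?U powr (ps - 1) * (\<mu> * k powr ((ps - p) / p) + d * k powr ((\<alpha> - p) / p) * l powr (\<beta> / p))"
      unfolding pw pv e eU by (simp add: algebra_simps)
    then show "?c powr (p - 1) * ?U powr (ps - 1) * \<phi> x
       = (\<mu> * (\<bar>u x\<bar> powr (ps - 2) * u x) + d * (\<bar>u x\<bar> powr (\<alpha> - 2) * u x) * \<bar>v x\<bar> powr \<beta>) * \<phi> x"
      unfolding sys by simp
  qed
  finally show ?thesis .
qed

lemma scaled_bubble_solution:
  assumes sum: "\<alpha> + \<beta> = ps" and \<alpha>: "\<alpha> > 1" and \<beta>: "\<beta> > 1"
    and sys: "coupling_system p \<alpha> \<beta> \<mu>\<^sub>1 \<mu>\<^sub>2 \<gamma> k l"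
  defines "u \<equiv> \<lambda>x. k powr (1 / p) * bubble p \<epsilon> y x" and "v \<equiv> \<lambda>x. l powr (1 / p) * bubble p \<epsilon> y x"
  shows "positive_solution p \<alpha> \<beta> \<mu>\<^sub>1 \<mu>\<^sub>2 \<gamma> u v"
    and "(u, v) \<in> nehari p \<alpha> \<beta> \<mu>\<^sub>1 \<mu>\<^sub>2 \<gamma>"
    and "energy p \<alpha> \<beta> \<mu>\<^sub>1 \<mu>\<^sub>2 \<gamma> u v =
      (1 / p - 1 / ps) * (k + l) * (LINT x|lebesgue. norm (bubble_grad p \<epsilon> y x) powr p)"
proof -
  have k: "k > 0" and l: "l > 0" using sys by (auto simp: coupling_system_def Let_def)
  \<comment> \<open>The factors of the second equation are reordered so that exchanging k,
    \<open>\<alpha>\<close> with l, \<open>\<beta>\<close> gives the form of the first.\<close>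
  have s1: "\<mu>\<^sub>1 * k powr ((ps - p) / p) + \<alpha> * \<gamma> / ps * k powr ((\<alpha> - p) / p) * l powr (\<beta> / p) = 1"
   and s2: "\<mu>\<^sub>2 * l powr ((ps - p) / p) + \<beta> * \<gamma> / ps * l powr ((\<beta> - p) / p) * k powr (\<alpha> / p) = 1"
    using sys by (simp_all add: coupling_system_def Let_def sum mult_ac)
  have pos: "u x > 0" "v x > 0" for x
    using k l bubble_pos[OF bubble_facts, of y x] by (auto simp: u_def v_def)
  have sol: "weak_solution p \<alpha> \<beta> \<mu>\<^sub>1 \<mu>\<^sub>2 \<gamma> u v"
    unfolding weak_solution_def Let_def ps[symmetric]
  proof (intro conjI ballI)
    show "u \<in> D1p p" "v \<in> D1p p" unfolding u_def v_def by (rule scaled_bubble_D1p)+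
    fix \<phi> :: "real ^ 'n \<Rightarrow> real" assume \<phi>: "\<phi> \<in> D1p p"
    show "(LINT x|lebesgue. norm (wgrad u x) powr (p - 2) * (wgrad u x \<bullet> wgrad \<phi> x)) =
      (LINT x|lebesgue. (\<mu>\<^sub>1 * \<bar>u x\<bar> powr (ps - 2) * u x
         + \<alpha> * \<gamma> / ps * \<bar>u x\<bar> powr (\<alpha> - 2) * u x * \<bar>v x\<bar> powr \<beta>) * \<phi> x)"
      using scaled_bubble_equation[OF k l sum s1 \<phi>] by (simp add: u_def v_def mult.assoc)
    have "(LINT x|lebesgue. norm (wgrad v x) powr (p - 2) * (wgrad v x \<bullet> wgrad \<phi> x)) =
      (LINT x|lebesgue. (\<mu>\<^sub>2 * (\<bar>v x\<bar> powr (ps - 2) * v x)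
         + \<beta> * \<gamma> / ps * (\<bar>v x\<bar> powr (\<beta> - 2) * v x) * \<bar>u x\<bar> powr \<alpha>) * \<phi> x)"
      unfolding u_def v_def by (rule scaled_bubble_equation[OF l k _ s2 \<phi>]) (use sum in simp)
    also have "\<dots> = (LINT x|lebesgue. (\<mu>\<^sub>2 * \<bar>v x\<bar> powr (ps - 2) * v x
         + \<beta> * \<gamma> / ps * \<bar>u x\<bar> powr \<alpha> * \<bar>v x\<bar> powr (\<beta> - 2) * v x) * \<phi> x)"
      by (rule Bochner_Integration.integral_cong[OF refl]) (simp only: mult_ac)
    finally show "(LINT x|lebesgue. norm (wgrad v x) powr (p - 2) * (wgrad v x \<bullet> wgrad \<phi> x)) =
      (LINT x|lebesgue. (\<mu>\<^sub>2 * \<bar>v x\<bar> powr (ps - 2) * v x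
         + \<beta> * \<gamma> / ps * \<bar>u x\<bar> powr \<alpha> * \<bar>v x\<bar> powr (\<beta> - 2) * v x) * \<phi> x)" .
  qed
  moreover have "critical_point p \<alpha> \<beta> \<mu>\<^sub>1 \<mu>\<^sub>2 \<gamma> u v"
    by (rule weak_solution_imp_critical_point[OF p(1) \<alpha> \<beta> _ sol]) (simp add: sum ps)
  ultimately show "positive_solution p \<alpha> \<beta> \<mu>\<^sub>1 \<mu>\<^sub>2 \<gamma> u v"
    using pos by (simp add: positive_solution_def)
  have nz: "\<not> (AE x in lebesgue. w x = 0)" if "\<And>x. w x > 0" for w :: "real ^ 'n \<Rightarrow> real"
    using that not_AE_lebesgue_False by (simp add: less_imp_neq[THEN not_sym])
  show neh: "(u, v) \<in> nehari p \<alpha> \<beta> \<mu>\<^sub>1 \<mu>\<^sub>2 \<gamma>"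
    by (rule weak_solution_in_nehari[OF sol]) (use nz pos in blast)+
  have "energy p \<alpha> \<beta> \<mu>\<^sub>1 \<mu>\<^sub>2 \<gamma> u v = (1 / p - 1 / (\<alpha> + \<beta>)) *
     ((LINT x|lebesgue. norm (wgrad u x) powr p) + (LINT x|lebesgue. norm (wgrad v x) powr p))"
    by (rule energy_on_nehari[OF neh]) (use \<alpha> \<beta> sum ps in auto)
  then show "energy p \<alpha> \<beta> \<mu>\<^sub>1 \<mu>\<^sub>2 \<gamma> u v =
      (1 / p - 1 / ps) * (k + l) * (LINT x|lebesgue. norm (bubble_grad p \<epsilon> y x) powr p)"
    unfolding u_def v_def integral_scaled_bubble_grad[OF k] integral_scaled_bubble_grad[OF l] sum
    by (simp only: mult.assoc flip: distrib_right)
qed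

end

theorem theorem1p4:
  fixes p \<alpha> \<beta> \<mu>\<^sub>1 \<mu>\<^sub>2 N ps :: real
  defines "N \<equiv> real CARD('n::finite)"
  defines "ps \<equiv> crit_exp N p"
  assumes "CARD('n) \<ge> 3"
    and "2 * N / (N + 2) < p" and "p < N / 2" and "p > 1"
    and "\<alpha> > 1" and "\<beta> > 1" and "\<alpha> + \<beta> = ps" and "\<alpha> < p" and "\<beta> < p"
    and "\<mu>\<^sub>1 > 0" and "\<mu>\<^sub>2 > 0"
  shows "\<exists>\<gamma>\<^sub>1. 0 < \<gamma>\<^sub>1 \<and>
      \<gamma>\<^sub>1 \<le> N * p\<^sup>2 / (N - p)\<^sup>2 *
             max (\<mu>\<^sub>1 / \<alpha> * ((p - \<beta>) / (p - \<alpha>)) powr ((p - \<beta>) / p))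
                 (\<mu>\<^sub>2 / \<beta> * ((p - \<alpha>) / (p - \<beta>)) powr ((p - \<alpha>) / p)) \<and>
      (\<forall>\<gamma>. 0 < \<gamma> \<and> \<gamma> < \<gamma>\<^sub>1 \<longrightarrow>
        (\<exists>k l. k > 0 \<and> l > 0 \<and>
          \<mu>\<^sub>1 * k powr ((ps - p) / p)
            + \<alpha> * \<gamma> / ps * k powr ((\<alpha> - p) / p) * l powr (\<beta> / p) = 1 \<and>
          \<mu>\<^sub>2 * l powr ((ps - p) / p)
            + \<beta> * \<gamma> / ps * k powr (\<alpha> / p) * l powr ((\<beta> - p) / p) = 1 \<and>
          (\<forall>\<epsilon> (y :: real ^ 'n). \<epsilon> > 0 \<longrightarrow>
            (let u = (\<lambda>x. k powr (1 / p) * bubble p \<epsilon> y x);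
                 v = (\<lambda>x. l powr (1 / p) * bubble p \<epsilon> y x)
             in energy p \<alpha> \<beta> \<mu>\<^sub>1 \<mu>\<^sub>2 \<gamma> u v > least_energy TYPE('n) p \<alpha> \<beta> \<mu>\<^sub>1 \<mu>\<^sub>2 \<gamma> \<and>
                positive_solution p \<alpha> \<beta> \<mu>\<^sub>1 \<mu>\<^sub>2 \<gamma> u v \<and>
                (\<forall>u' v'. positive_solution p \<alpha> \<beta> \<mu>\<^sub>1 \<mu>\<^sub>2 \<gamma> u' v' \<and>
                    energy p \<alpha> \<beta> \<mu>\<^sub>1 \<mu>\<^sub>2 \<gamma> u' v' = least_energy TYPE('n) p \<alpha> \<beta> \<mu>\<^sub>1 \<mu>\<^sub>2 \<gamma> \<longrightarrow>
                    \<not> ((AE x in lebesgue. u x = u' x) \<and> (AE x in lebesgue. v x = v' x)))))))"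
proof -
  have pN: "1 < p" "p < real CARD('n)" and N: "N > p"
    using assms(5,6) by (auto simp: N_def)
  have ps: "ps = crit_exp (real CARD('n)) p" by (simp add: ps_def N_def)
  have ps_gt: "ps > p"
    using pN N by (simp add: ps_def crit_exp_def field_simps)
  obtain \<delta> where \<delta>: "\<delta> > 0" and two: "\<And>\<gamma>. 0 < \<gamma> \<Longrightarrow> \<gamma> < \<delta> \<Longrightarrow> \<exists>k l k' l'.
     coupling_system p \<alpha> \<beta> \<mu>\<^sub>1 \<mu>\<^sub>2 \<gamma> k l \<and> coupling_system p \<alpha> \<beta> \<mu>\<^sub>1 \<mu>\<^sub>2 \<gamma> k' l' \<and> k' + l' < k + l"
    using two_coupling_solutions[of p \<alpha> \<beta> \<mu>\<^sub>1 \<mu>\<^sub>2] assms ps_gt by auto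
  \<comment> \<open>\<open>b\<close> is the prescribed upper end of the interval for
    \<open>\<gamma>\<^sub>1\<close>. Only its positivity has to be checked, since
    \<open>\<gamma>\<^sub>1\<close> will be the minimum of \<open>b\<close> and
    \<open>\<delta>\<close>.\<close>
  define b where "b = N * p\<^sup>2 / (N - p)\<^sup>2 *
             max (\<mu>\<^sub>1 / \<alpha> * ((p - \<beta>) / (p - \<alpha>)) powr ((p - \<beta>) / p))
                 (\<mu>\<^sub>2 / \<beta> * ((p - \<alpha>) / (p - \<beta>)) powr ((p - \<alpha>) / p))"
  have "b > 0"
    unfolding b_def using assms N pN by (intro mult_pos_pos) (auto simp: less_max_iff_disj)
  have main: "\<exists>k l. k > 0 \<and> l > 0 \<and>
          \<mu>\<^sub>1 * k powr ((ps - p) / p)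
            + \<alpha> * \<gamma> / ps * k powr ((\<alpha> - p) / p) * l powr (\<beta> / p) = 1 \<and>
          \<mu>\<^sub>2 * l powr ((ps - p) / p)
            + \<beta> * \<gamma> / ps * k powr (\<alpha> / p) * l powr ((\<beta> - p) / p) = 1 \<and>
          (\<forall>\<epsilon> (y :: real ^ 'n). \<epsilon> > 0 \<longrightarrow>
            (let u = (\<lambda>x. k powr (1 / p) * bubble p \<epsilon> y x);
                 v = (\<lambda>x. l powr (1 / p) * bubble p \<epsilon> y x)
             in energy p \<alpha> \<beta> \<mu>\<^sub>1 \<mu>\<^sub>2 \<gamma> u v > least_energy TYPE('n) p \<alpha> \<beta> \<mu>\<^sub>1 \<mu>\<^sub>2 \<gamma> \<and>
                positive_solution p \<alpha> \<beta> \<mu>\<^sub>1 \<mu>\<^sub>2 \<gamma> u v \<and>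
                (\<forall>u' v'. positive_solution p \<alpha> \<beta> \<mu>\<^sub>1 \<mu>\<^sub>2 \<gamma> u' v' \<and>
                    energy p \<alpha> \<beta> \<mu>\<^sub>1 \<mu>\<^sub>2 \<gamma> u' v' = least_energy TYPE('n) p \<alpha> \<beta> \<mu>\<^sub>1 \<mu>\<^sub>2 \<gamma> \<longrightarrow>
                    \<not> ((AE x in lebesgue. u x = u' x) \<and> (AE x in lebesgue. v x = v' x)))))"
    if \<gamma>: "0 < \<gamma>" "\<gamma> < \<delta>" for \<gamma>
  proof -
    \<comment> \<open>The pairs are fixed before \<open>\<epsilon>\<close> and \<open>y\<close>, as
      the statement requires; (k, l) is the solution claimed and (k', l') a competitor for the
      infimum.\<close>
    obtain k l k' l' where sys: "coupling_system p \<alpha> \<beta> \<mu>\<^sub>1 \<mu>\<^sub>2 \<gamma> k l"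
      and sys': "coupling_system p \<alpha> \<beta> \<mu>\<^sub>1 \<mu>\<^sub>2 \<gamma> k' l'" and less: "k' + l' < k + l"
      using two[OF \<gamma>] by blast
    show ?thesis
    proof (rule exI[of _ k], rule exI[of _ l], intro conjI allI impI)
      fix \<epsilon> :: real and y :: "real ^ 'n" assume \<epsilon>: "\<epsilon> > 0"
      note sol = scaled_bubble_solution[OF pN \<epsilon> ps assms(9,7,8) sys, of y]
      note sol' = scaled_bubble_solution[OF pN \<epsilon> ps assms(9,7,8) sys', of y]
      let ?u = "\<lambda>x. k powr (1 / p) * bubble p \<epsilon> y x" and ?v = "\<lambda>x. l powr (1 / p) * bubble p \<epsilon> y x"
      \<comment> \<open>Both pairs are compared on the same bubble, so the gradient integral is a
        common positive factor and only the sums differ.\<close>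
      have "least_energy TYPE('n) p \<alpha> \<beta> \<mu>\<^sub>1 \<mu>\<^sub>2 \<gamma> \<le> (1 / p - 1 / ps) * (k' + l') * (LINT x|lebesgue. norm (bubble_grad p \<epsilon> y x) powr p)"
        unfolding sol'(3)[symmetric]
        by (rule least_energy_le[OF sol'(2)]) (use assms ps_gt in \<open>auto simp: ps\<close>)
      also have "\<dots> < (1 / p - 1 / ps) * (k + l) * (LINT x|lebesgue. norm (bubble_grad p \<epsilon> y x) powr p)"
      proof -
        have "1 / p - 1 / ps > 0" using ps_gt pN by (simp add: field_simps)
        then show ?thesis
          using less integral_bubble_grad_pos[OF pN \<epsilon> ps, of y] by simp
      qed
      finally have gt: "least_energy TYPE('n) p \<alpha> \<beta> \<mu>\<^sub>1 \<mu>\<^sub>2 \<gamma> < energy p \<alpha> \<beta> \<mu>\<^sub>1 \<mu>\<^sub>2 \<gamma> ?u ?v"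
        unfolding sol(3) .
      have "\<not> ((AE x in lebesgue. ?u x = u' x) \<and> (AE x in lebesgue. ?v x = v' x))"
        if "positive_solution p \<alpha> \<beta> \<mu>\<^sub>1 \<mu>\<^sub>2 \<gamma> u' v' \<and>
            energy p \<alpha> \<beta> \<mu>\<^sub>1 \<mu>\<^sub>2 \<gamma> u' v' = least_energy TYPE('n) p \<alpha> \<beta> \<mu>\<^sub>1 \<mu>\<^sub>2 \<gamma>" for u' v'
      proof
        assume "(AE x in lebesgue. ?u x = u' x) \<and> (AE x in lebesgue. ?v x = v' x)"
        then have "energy p \<alpha> \<beta> \<mu>\<^sub>1 \<mu>\<^sub>2 \<gamma> ?u ?v = energy p \<alpha> \<beta> \<mu>\<^sub>1 \<mu>\<^sub>2 \<gamma> u' v'"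
          using that sol(1) unfolding positive_solution_def critical_point_def
          by (intro energy_cong_AE) blast+
        with gt that show False by simp
      qed
      with gt sol(1) show "let u = ?u; v = ?v
             in energy p \<alpha> \<beta> \<mu>\<^sub>1 \<mu>\<^sub>2 \<gamma> u v > least_energy TYPE('n) p \<alpha> \<beta> \<mu>\<^sub>1 \<mu>\<^sub>2 \<gamma> \<and>
                positive_solution p \<alpha> \<beta> \<mu>\<^sub>1 \<mu>\<^sub>2 \<gamma> u v \<and>
                (\<forall>u' v'. positive_solution p \<alpha> \<beta> \<mu>\<^sub>1 \<mu>\<^sub>2 \<gamma> u' v' \<and>
                    energy p \<alpha> \<beta> \<mu>\<^sub>1 \<mu>\<^sub>2 \<gamma> u' v' = least_energy TYPE('n) p \<alpha> \<beta> \<mu>\<^sub>1 \<mu>\<^sub>2 \<gamma> \<longrightarrow>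
                    \<not> ((AE x in lebesgue. u x = u' x) \<and> (AE x in lebesgue. v x = v' x)))"
        unfolding Let_def by blast
    qed (use sys in \<open>simp_all add: coupling_system_def Let_def assms(9)\<close>)
  qed
  show ?thesis
  proof (rule exI[of _ "min \<delta> b"], intro conjI allI impI)
    show "0 < min \<delta> b" using \<delta> \<open>b > 0\<close> by simp
    show "min \<delta> b \<le> N * p\<^sup>2 / (N - p)\<^sup>2 *
             max (\<mu>\<^sub>1 / \<alpha> * ((p - \<beta>) / (p - \<alpha>)) powr ((p - \<beta>) / p))
                 (\<mu>\<^sub>2 / \<beta> * ((p - \<alpha>) / (p - \<beta>)) powr ((p - \<alpha>) / p))"
      unfolding b_def[symmetric] by simp
  qed (rule main, simp_all)
qed

end
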